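(* Let $\{x_i\}_{1\le i\le n}$ admit the physical representation $x_i=G(i/n,\mathcal F_i)$ and satisfy the UPDC condition, the short-range dependence condition with exponent $\tau>1$, the smoothness condition of order $d$, and the local stationarity condition with some exponent $q>2$ (all defined in the context). Let $b_*=b_*(n)$ satisfy $b_*/\log b_*\asymp n^{1/(\tau+1)}$, and let $\boldsymbol{\phi}(t)=(\phi_1(t),\dots,\phi_{b_*}(t))$ be the coefficient functions defined in the context. (1) If $\{x_i\}_{i=1}^n$ is correlation stationary, i.e. there is a function $\varrho$ with $\operatorname{Corr}(x_i,x_j)=\varrho(|i-j|)$ for all $i,j$, then there exist constants $\phi_j$, $1\le j\le b_*$ (not depending on $i$), such that with $\boldsymbol{\phi}^{b_*}=(\phi_1,\dots,\phi_{b_*})$, $$\big|\boldsymbol{\phi}(i/n)-\boldsymbol{\phi}^{b_*}\big|=O\Big(\frac{b_*^2}{n}\Big).$$ Consequently, for $\boldsymbol{\phi}_i^{b_*}=(\phi_{i1},\phi_{i2},\dots,\phi_{ib_*})$, $i>b_*$, $$\big|\boldsymbol{\phi}^{b_*}_i-\boldsymbol{\phi}^{b_*}\big|=O\Big((\log b_* )^{\tau-1}b_*^{-\tau+1}+\frac{b_*^2}{n}\Big).$$ (2) If $\phi_j(\cdot)$ is a constant function on $[0,1]$ for every $j=1,\dots,b_*$, i.e. $\phi_j(i/n)=\phi_j$, then there exists a smooth function $\varrho$ such that $$\operatorname{Corr}(x_i,x_{i+j})=\varrho(j)+O\Big((\log b_* )^{\tau-1}b_*^{-(\tau-2)}+\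frac{b_*^{2.5}}{n}\Big).$$
   Context: All objects may depend on $n$; the subscript $n$ is suppressed. $|\cdot|$ is the Euclidean norm, $\|\cdot\|_q=(\mathbb{E}|\cdot|^q)^{1/q}$; constants, including those implicit in $O$, do not depend on $n$ (nor on $i,j$). $a_n\asymp b_n$ means $a_n=O(b_n)$ and $b_n=O(a_n)$. Physical representation: $x_i=G(\tfrac in,\mathcal F_i)$, $1\le i\le n$, where $\mathcal F_i=(\dots,\eta_{i-1},\eta_i)$, $\eta_i$ ($i\in\mathbb{Z}$) are i.i.d. random variables and $G=G_n:[0,1]\times\mathbb{R}^\infty\to\mathbb{R}$ is measurable with $G(t,\mathcal F_i)$ a properly defined random variable for all $t$. Put $\gamma(t,j)=\operatorname{Cov}(G(t,\mathcal F_0),G(t,\mathcal F_j))$. Local stationarity condition with exponent $q>2$: $\|G(t_1,\mathcal F_i)-G(t_2,\mathcal F_i)\|_q\le C|t_1-t_2|$ for all $t_1,t_2\in[0,1]$, and $\sup_{t\in[0,1]}\max_{1\le i\le n}\|G(t,\mathcal F_i)\|_q<\infty$. (Then $\operatorname{Cov}(x_i,x_j)=\gamma(i/n,|i-j|)+O((|i-j|+1)/n)$.) UPDC condition: there is a universal $\kappa>0$ such that for all sufficiently large $n$ the smallest eigenvalue of $\operatorname{Cov}(x_1,\dots,x_n)$ is at least $\kappa$. Short-range dependence condition with exponent $\tau>1$: $|\operatorname{Cov}(x_k,x_{k+r})|\le C|r|^{-\tau}$ for all $n$, $1\le k\le n$, $-k+1\le r\le n-k$, $r\ne0$, and $\sup_{i,n}\mathbb{E}|x_i|<\infty$.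 Smoothness condition of order $d$ ($d>0$ a given integer): $\mathbb{E}x_i=\mu(i/n)$ for some $\mu\in C^d([0,1])$, and $\gamma(\cdot,j)\in C^d([0,1])$ for every $j\ge0$. Coefficient functions: $(\phi_1(t),\dots,\phi_{b_*}(t))^*=\Gamma(t)^{-1}\boldsymbol{\gamma}(t)$ with $\Gamma(t)\in\mathbb{R}^{b_*\times b_*}$, $\Gamma_{ij}(t)=\gamma(t,|i-j|)$, and $\boldsymbol{\gamma}(t)\in\mathbb{R}^{b_*}$, $\boldsymbol{\gamma}_i(t)=\gamma(t,i)$. $\phi_{ij}$, $0\le j\le i-1$, are the coefficients of the best linear prediction $\widehat x_i=\phi_{i0}+\sum_{j=1}^{i-1}\phi_{ij}x_{i-j}$ of $x_i$ from $x_{i-1},\dots,x_1$. *)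

theory Defs
  imports
    "HOL-Probability.Probability"
    "HOL-Library.Landau_Symbols"
    "Jordan_Normal_Form.Gauss_Jordan_Elimination"
    "Jordan_Normal_Form.Spectral_Radius"
begin

text \<open>
  Every object is a triangular array: it takes the sample size \<open>n\<close> as an explicit first argument
  (or is applied to \<open>n\<close> before it is passed on). This includes the probability space \<open>M n\<close>, the
  innovations \<open>\<eta> n\<close> and the filter \<open>G n\<close>. Constants \<open>C\<close>, \<open>\<kappa>\<close> are quantified outside of \<open>n\<close>.
\<close>

definition covariance :: "'a measure \<Rightarrow> ('a \<Rightarrow> real) \<Rightarrow> ('a \<Rightarrow> real) \<Rightarrow> real" where
  "covariance M X Y =
     (\<integral>\<omega>. (X \<omega> - (\<integral>w. X w \<partial>M)) * (Y \<omega> - (\<integral>w. Y w \<partial>M)) \<partial>M)"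

definition correlation :: "'a measure \<Rightarrow> ('a \<Rightarrow> real) \<Rightarrow> ('a \<Rightarrow> real) \<Rightarrow> real" where
  "correlation M X Y = covariance M X Y / (sqrt (covariance M X X) * sqrt (covariance M Y Y))"

definition Lq_norm :: "'a measure \<Rightarrow> real \<Rightarrow> ('a \<Rightarrow> real) \<Rightarrow> real" where
  "Lq_norm M q X = (\<integral>\<omega>. \<bar>X \<omega>\<bar> powr q \<partial>M) powr (1 / q)"

text \<open>
  \<open>C\<^sup>d\<close> on a set \<open>S\<close>, with one-sided derivatives at the boundary points of \<open>S\<close>; \<open>F m\<close> is the
  \<open>m\<close>-th derivative.
\<close>
definition C_on :: "nat \<Rightarrow> real set \<Rightarrow> (real \<Rightarrow> real) \<Rightarrow> bool" where
  "C_on d S f \<longleftrightarrow> (\<exists>F :: nat \<Rightarrow> real \<Rightarrow> real.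
     (\<forall>t\<in>S. F 0 t = f t) \<and>
     (\<forall>m<d. \<forall>t\<in>S. (F m has_real_derivative F (Suc m) t) (at t within S)) \<and>
     continuous_on S (F d))"

definition smooth :: "(real \<Rightarrow> real) \<Rightarrow> bool" where
  "smooth f \<longleftrightarrow> (\<forall>d. C_on d UNIV f)"


text \<open>
  The history \<open>\<F>\<^sub>i = (\<dots>, \<eta>\<^sub>i\<^sub>-\<^sub>1, \<eta>\<^sub>i)\<close>, read backwards as an element of \<open>nat \<Rightarrow> real\<close>: entry \<open>k\<close> is
  the innovation at time \<open>i - k\<close>.
\<close>
definition history :: "(int \<Rightarrow> 'a \<Rightarrow> real) \<Rightarrow> int \<Rightarrow> 'a \<Rightarrow> (nat \<Rightarrow> real)" where
  "history \<eta> i \<omega> = (\<lambda>k. \<eta> (i - int k) \<omega>)"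

definition physical_representation ::
  "(nat \<Rightarrow> 'a measure) \<Rightarrow> (nat \<Rightarrow> int \<Rightarrow> 'a \<Rightarrow> real) \<Rightarrow> (nat \<Rightarrow> real \<Rightarrow> (nat \<Rightarrow> real) \<Rightarrow> real) \<Rightarrow>
   (nat \<Rightarrow> nat \<Rightarrow> 'a \<Rightarrow> real) \<Rightarrow> bool" where
  "physical_representation M \<eta> G x \<longleftrightarrow> (\<forall>n.
     prob_space (M n) \<and>
     prob_space.indep_vars (M n) (\<lambda>_. borel) (\<eta> n) UNIV \<and>
     (\<forall>i. distr (M n) borel (\<eta> n i) = distr (M n) borel (\<eta> n 0)) \<and>
     (\<lambda>(t, h). G n t h) \<in> borel_measurable
        (restrict_space borel {0..1} \<Otimes>\<^sub>M (\<Pi>\<^sub>M k\<in>(UNIV :: nat set). borel)) \<and>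
     (\<forall>i\<in>{1..n}. \<forall>\<omega>\<in>space (M n).
        x n i \<omega> = G n (real i / real n) (history (\<eta> n) (int i) \<omega>)))"

definition local_autocov ::
  "'a measure \<Rightarrow> (int \<Rightarrow> 'a \<Rightarrow> real) \<Rightarrow> (real \<Rightarrow> (nat \<Rightarrow> real) \<Rightarrow> real) \<Rightarrow> real \<Rightarrow> nat \<Rightarrow> real" where
  "local_autocov M \<eta> G t j =
     covariance M (\<lambda>\<omega>. G t (history \<eta> 0 \<omega>)) (\<lambda>\<omega>. G t (history \<eta> (int j) \<omega>))"

definition locally_stationary ::
  "real \<Rightarrow> (nat \<Rightarrow> 'a measure) \<Rightarrow> (nat \<Rightarrow> int \<Rightarrow> 'a \<Rightarrow> real) \<Rightarrow>
   (nat \<Rightarrow> real \<Rightarrow> (nat \<Rightarrow> real) \<Rightarrow> real) \<Rightarrow> bool" where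
  "locally_stationary q M \<eta> G \<longleftrightarrow>
     (\<exists>C. \<forall>n. \<forall>i\<in>{1..n}. \<forall>t\<^sub>1\<in>{0..1}. \<forall>t\<^sub>2\<in>{0..1}.
        Lq_norm (M n) q
          (\<lambda>\<omega>. G n t\<^sub>1 (history (\<eta> n) (int i) \<omega>) - G n t\<^sub>2 (history (\<eta> n) (int i) \<omega>))
        \<le> C * \<bar>t\<^sub>1 - t\<^sub>2\<bar>) \<and>
     (\<exists>C. \<forall>n. \<forall>i\<in>{1..n}. \<forall>t\<in>{0..1}.
        integrable (M n) (\<lambda>\<omega>. \<bar>G n t (history (\<eta> n) (int i) \<omega>)\<bar> powr q) \<and>
        Lq_norm (M n) q (\<lambda>\<omega>. G n t (history (\<eta> n) (int i) \<omega>)) \<le> C)"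

definition cov_matrix :: "'a measure \<Rightarrow> (nat \<Rightarrow> 'a \<Rightarrow> real) \<Rightarrow> nat \<Rightarrow> real mat" where
  "cov_matrix M x n = Matrix.mat n n (\<lambda>(i, j). covariance M (x (i + 1)) (x (j + 1)))"

definition UPDC :: "(nat \<Rightarrow> 'a measure) \<Rightarrow> (nat \<Rightarrow> nat \<Rightarrow> 'a \<Rightarrow> real) \<Rightarrow> bool" where
  "UPDC M x \<longleftrightarrow>
     (\<exists>\<kappa>>0. \<forall>\<^sub>F n in sequentially. Min (spectrum (cov_matrix (M n) (x n) n)) \<ge> \<kappa>)"

definition short_range_dependent ::
  "real \<Rightarrow> (nat \<Rightarrow> 'a measure) \<Rightarrow> (nat \<Rightarrow> nat \<Rightarrow> 'a \<Rightarrow> real) \<Rightarrow> bool" where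
  "short_range_dependent \<tau> M x \<longleftrightarrow>
     (\<exists>C. \<forall>n. \<forall>k\<in>{1..n}. \<forall>r\<in>{- int k + 1..int n - int k}. r \<noteq> 0 \<longrightarrow>
        \<bar>covariance (M n) (x n k) (x n (nat (int k + r)))\<bar> \<le> C * real_of_int \<bar>r\<bar> powr (- \<tau>)) \<and>
     (\<exists>C. \<forall>n. \<forall>i\<in>{1..n}. integrable (M n) (x n i) \<and> (\<integral>\<omega>. \<bar>x n i \<omega>\<bar> \<partial>M n) \<le> C)"

definition smoothness_condition ::
  "nat \<Rightarrow> (nat \<Rightarrow> 'a measure) \<Rightarrow> (nat \<Rightarrow> int \<Rightarrow> 'a \<Rightarrow> real) \<Rightarrow>
   (nat \<Rightarrow> real \<Rightarrow> (nat \<Rightarrow> real) \<Rightarrow> real) \<Rightarrow> (nat \<Rightarrow> nat \<Rightarrow> 'a \<Rightarrow> real) \<Rightarrow> bool" where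
  "smoothness_condition d M \<eta> G x \<longleftrightarrow> (\<forall>n.
     (\<exists>\<mu>. C_on d {0..1} \<mu> \<and> (\<forall>i\<in>{1..n}. (\<integral>\<omega>. x n i \<omega> \<partial>M n) = \<mu> (real i / real n))) \<and>
     (\<forall>j. C_on d {0..1} (\<lambda>t. local_autocov (M n) (\<eta> n) (G n) t j)))"

definition correlation_stationary ::
  "'a measure \<Rightarrow> (nat \<Rightarrow> 'a \<Rightarrow> real) \<Rightarrow> nat \<Rightarrow> bool" where
  "correlation_stationary M x n \<longleftrightarrow> (\<exists>\<rho> :: nat \<Rightarrow> real. \<forall>i\<in>{1..n}. \<forall>j\<in>{1..n}.
     correlation M (x i) (x j) = \<rho> (nat \<bar>int i - int j\<bar>))"


text \<open>
  \<open>AR_coeff \<gamma> b t j\<close> is \<open>\<phi>\<^sub>j(t)\<close>, \<open>1 \<le> j \<le> b\<close>, where \<open>\<phi>(t) = \<Gamma>(t)\<^sup>-\<^sup>1 \<gamma>(t)\<close>. Matrices and vectors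
  are indexed from 0. The value is meaningful only if \<open>\<Gamma>(t)\<close> is invertible.
\<close>
definition autocov_matrix :: "(real \<Rightarrow> nat \<Rightarrow> real) \<Rightarrow> nat \<Rightarrow> real \<Rightarrow> real mat" where
  "autocov_matrix \<gamma> b t = Matrix.mat b b (\<lambda>(i, j). \<gamma> t (nat \<bar>int i - int j\<bar>))"

definition autocov_vector :: "(real \<Rightarrow> nat \<Rightarrow> real) \<Rightarrow> nat \<Rightarrow> real \<Rightarrow> real Matrix.vec" where
  "autocov_vector \<gamma> b t = Matrix.vec b (\<lambda>i. \<gamma> t (i + 1))"

definition AR_coeff :: "(real \<Rightarrow> nat \<Rightarrow> real) \<Rightarrow> nat \<Rightarrow> real \<Rightarrow> nat \<Rightarrow> real" where
  "AR_coeff \<gamma> b t j =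
     vec_index (the (mat_inverse (autocov_matrix \<gamma> b t)) *\<^sub>v autocov_vector \<gamma> b t) (j - 1)"

definition best_linear_prediction ::
  "'a measure \<Rightarrow> (nat \<Rightarrow> 'a \<Rightarrow> real) \<Rightarrow> nat \<Rightarrow> (nat \<Rightarrow> real) \<Rightarrow> bool" where
  "best_linear_prediction M x i a \<longleftrightarrow> (\<forall>c :: nat \<Rightarrow> real.
     (\<integral>\<omega>. (x i \<omega> - (a 0 + (\<Sum>j = 1..i - 1. a j * x (i - j) \<omega>)))\<^sup>2 \<partial>M)
     \<le> (\<integral>\<omega>. (x i \<omega> - (c 0 + (\<Sum>j = 1..i - 1. c j * x (i - j) \<omega>)))\<^sup>2 \<partial>M))"

end

theory Submission
  imports Defs "HOL-Real_Asymp.Real_Asymp"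
begin

text \<open>
  By the UPDC condition the covariance matrix is coercive, and a window of length \<open>O(b)\<close> around
  time \<open>i\<close> differs entrywise by \<open>O(b / n)\<close>, hence in operator norm by \<open>O(b\<^sup>2 / n)\<close>, from the Toeplitz
  matrix of \<open>\<gamma>(i / n, \<cdot>)\<close>; so all Yule--Walker systems below are uniformly well conditioned.

  (1) Under correlation stationarity, rescaling by standard deviations turns the local system and
  the prediction normal equations into perturbed Yule--Walker systems of the correlation function
  \<open>\<rho>\<close>, of orders \<open>b\<close> and \<open>i - 1\<close>. Passing from order \<open>i - 1\<close> to order \<open>b\<close> costs the norm of the
  solution beyond lag \<open>b\<close>. To bound it, cut \<open>\<rho>\<close> off at lag \<open>w \<approx> b / log b\<close>, an error \<open>O(w\<^sup>1\<^sup>-\<^sup>\<tau>)\<close>;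
  for the banded system \<open>O(log b)\<close> Richardson steps give accuracy \<open>b\<^sup>1\<^sup>-\<^sup>\<tau>\<close>, and their result is
  supported in \<open>{1..b}\<close>.

  (2) The solution of a positive definite Yule--Walker system of order \<open>b\<close> determines the
  correlations up to lag \<open>b\<close> exactly, by running the Levinson recursion backwards. So
  \<open>\<gamma>(t, k) / \<gamma>(t, 0)\<close> does not depend on \<open>t\<close> for \<open>k \<le> b\<close>, and the correlations beyond lag \<open>b\<close> are
  \<open>O(b\<^sup>-\<^sup>\<tau>)\<close>.
\<close>

section \<open>Coercive quadratic forms\<close>

text \<open>All constants have to be uniform in n although b and the predictor order i - 1 grow.
  Norms of inverse matrices are therefore replaced by coercivity, and operator norms by row sums of
  absolute values; the bounds then involve only \<kappa>, C and \<tau>.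

  The power of the logarithm comes from a balance of two errors. Each Richardson step widens the
  support by w, so k steps allow w of size b / k. The iteration error is geometric in k, so k must
  be of order log b to reach b^(1-\<tau>); the cut-off error w^(1-\<tau>) then has the size (log
  b)^(\<tau>-1) b^(1-\<tau>).

  Part (2) is an inverse problem: each of the b backward Levinson steps divides by 1 minus a squared
  reflection coefficient, which could amplify errors again and again.\<close>

lemma L2_set_inner_le: "\<bar>\<Sum>i\<in>I. f i * g i\<bar> \<le> L2_set f I * L2_set g I"
  by (rule order_trans[OF sum_abs]) (simp add: abs_mult L2_set_mult_ineq)

lemma L2_set_power2: "(L2_set f I)\<^sup>2 = (\<Sum>i\<in>I. (f i)\<^sup>2)"
  by (simp add: L2_set_def sum_nonneg)

lemma L2_set_diff_le: "L2_set (\<lambda>i. f i - g i) I \<le> L2_set f I + L2_set g I"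
  using L2_set_triangle_ineq[of f "\<lambda>i. - g i" I] by (simp add: L2_set_def)

lemma L2_set_mono_set: "finite J \<Longrightarrow> I \<subseteq> J \<Longrightarrow> L2_set f I \<le> L2_set f J"
  by (auto simp: L2_set_def intro!: sum_mono2)

text \<open>Split \<open>\<bar>A k l\<bar>\<close> into two square roots and apply Cauchy-Schwarz to
  each row: row sums bound one factor, and column sums the other after exchanging the sums. This
  turns summable decay into an operator bound that does not depend on the dimension.\<close>

lemma schur_test:
  fixes A :: "'i \<Rightarrow> 'j \<Rightarrow> real"
  assumes fin: "finite I" "finite J" and M: "0 \<le> M"
    and row: "\<And>k. k \<in> I \<Longrightarrow> (\<Sum>l\<in>J. \<bar>A k l\<bar>) \<le> M"
    and col: "\<And>l. l \<in> J \<Longrightarrow> (\<Sum>k\<in>I. \<bar>A k l\<bar>) \<le> M"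
  shows "L2_set (\<lambda>k. \<Sum>l\<in>J. A k l * v l) I \<le> M * L2_set v J"
proof -
  have 1: "(\<Sum>l\<in>J. A k l * v l)\<^sup>2 \<le> M * (\<Sum>l\<in>J. \<bar>A k l\<bar> * (v l)\<^sup>2)" if "k \<in> I" for k
  proof -
    have "\<bar>\<Sum>l\<in>J. A k l * v l\<bar> \<le> (\<Sum>l\<in>J. sqrt \<bar>A k l\<bar> * (sqrt \<bar>A k l\<bar> * \<bar>v l\<bar>))"
      by (rule order_trans[OF sum_abs]) (auto intro!: sum_mono simp: abs_mult simp flip: mult.assoc)
    then have "(\<Sum>l\<in>J. A k l * v l)\<^sup>2 \<le> (\<Sum>l\<in>J. sqrt \<bar>A k l\<bar> * (sqrt \<bar>A k l\<bar> * \<bar>v l\<bar>))\<^sup>2"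
      by (metis abs_ge_zero power2_abs power_mono)
    also have "\<dots> \<le> (\<Sum>l\<in>J. (sqrt \<bar>A k l\<bar>)\<^sup>2) * (\<Sum>l\<in>J. (sqrt \<bar>A k l\<bar> * \<bar>v l\<bar>)\<^sup>2)"
      by (rule Cauchy_Schwarz_ineq_sum)
    also have "\<dots> = (\<Sum>l\<in>J. \<bar>A k l\<bar>) * (\<Sum>l\<in>J. \<bar>A k l\<bar> * (v l)\<^sup>2)"
      by (simp add: power_mult_distrib)
    also have "\<dots> \<le> M * (\<Sum>l\<in>J. \<bar>A k l\<bar> * (v l)\<^sup>2)"
      by (intro mult_right_mono row that sum_nonneg) auto
    finally show ?thesis .
  qed
  have "(\<Sum>k\<in>I. (\<Sum>l\<in>J. A k l * v l)\<^sup>2) \<le> (\<Sum>k\<in>I. M * (\<Sum>l\<in>J. \<bar>A k l\<bar> * (v l)\<^sup>2))"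
    by (intro sum_mono 1)
  also have "\<dots> = M * (\<Sum>l\<in>J. (\<Sum>k\<in>I. \<bar>A k l\<bar>) * (v l)\<^sup>2)"
    by (subst sum_distrib_left[symmetric], subst sum.swap) (simp add: sum_distrib_right)
  also have "\<dots> \<le> M * (\<Sum>l\<in>J. M * (v l)\<^sup>2)"
    by (intro mult_left_mono sum_mono mult_right_mono col M) auto
  also have "\<dots> = (M * L2_set v J)\<^sup>2"
    by (simp add: power_mult_distrib L2_set_power2 power2_eq_square[of M] sum_distrib_left mult.assoc)
  finally have "(L2_set (\<lambda>k. \<Sum>l\<in>J. A k l * v l) I)\<^sup>2 \<le> (M * L2_set v J)\<^sup>2"
    by (simp add: L2_set_power2)
  then show ?thesis
    by (rule power2_le_imp_le) (simp add: M L2_set_nonneg)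
qed

lemma schur_test_const:
  assumes fin: "finite I" "finite J" and card: "real (card I) \<le> m" "real (card J) \<le> m" and "0 \<le> \<delta>"
    and "\<And>k l. k \<in> I \<Longrightarrow> l \<in> J \<Longrightarrow> \<bar>A k l\<bar> \<le> \<delta>"
  shows "L2_set (\<lambda>k. \<Sum>l\<in>J. A k l * v l) I \<le> m * \<delta> * L2_set v J"
proof (rule schur_test[OF fin])
  show "0 \<le> m * \<delta>" using card(1) assms(5) by (smt (verit) mult_nonneg_nonneg of_nat_0_le_iff)
  show "(\<Sum>l\<in>J. \<bar>A k l\<bar>) \<le> m * \<delta>" if "k \<in> I" for k
    using sum_bounded_above[of J "\<lambda>l. \<bar>A k l\<bar>" \<delta>] assms that
    by (smt (verit) mult_right_mono)
  show "(\<Sum>k\<in>I. \<bar>A k l\<bar>) \<le> m * \<delta>" if "l \<in> J" for l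
    using sum_bounded_above[of I "\<lambda>k. \<bar>A k l\<bar>" \<delta>] assms that
    by (smt (verit) mult_right_mono)
qed

text \<open>A lower bound c on the quadratic form. The index type is arbitrary, so windows and
  shifted or restricted index sets are all instances of reindexing.\<close>

definition coercive :: "real \<Rightarrow> 'i set \<Rightarrow> ('i \<Rightarrow> 'i \<Rightarrow> real) \<Rightarrow> bool" where
  "coercive c I A \<longleftrightarrow> (\<forall>v. c * (\<Sum>k\<in>I. (v k)\<^sup>2) \<le> (\<Sum>k\<in>I. \<Sum>l\<in>I. A k l * v k * v l))"

lemma coerciveD: "coercive c I A \<Longrightarrow> c * (\<Sum>k\<in>I. (v k)\<^sup>2) \<le> (\<Sum>k\<in>I. \<Sum>l\<in>I. A k l * v k * v l)"
  by (simp add: coercive_def)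

lemma quadratic_form_eq:
  "(\<Sum>k\<in>I. \<Sum>l\<in>I. A k l * v k * v l) = (\<Sum>k\<in>I. v k * (\<Sum>l\<in>I. A k l * (v l :: real)))"
  by (simp add: sum_distrib_left mult_ac)

lemma coercive_cong:
  assumes "coercive c I A" "\<And>k l. k \<in> I \<Longrightarrow> l \<in> I \<Longrightarrow> A k l = B k l"
  shows "coercive c I B"
  using assms unfolding coercive_def by (smt (verit) sum.cong)

text \<open>Quantitative injectivity: the difference of two solutions is at most 1/c times the
  difference of their right-hand sides. Every perturbation estimate for Yule-Walker systems rests on
  this.\<close>

lemma coercive_L2_le:
  assumes "coercive c I A"
  shows "c * L2_set v I \<le> L2_set (\<lambda>k. \<Sum>l\<in>I. A k l * v l) I"
proof (cases "L2_set v I = 0")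
  case False
  then have pos: "L2_set v I > 0" using L2_set_nonneg[of v I] by linarith
  have "c * (L2_set v I)\<^sup>2 \<le> (\<Sum>k\<in>I. v k * (\<Sum>l\<in>I. A k l * v l))"
    using coerciveD[OF assms, of v] by (simp add: L2_set_power2 quadratic_form_eq)
  also have "\<dots> \<le> L2_set v I * L2_set (\<lambda>k. \<Sum>l\<in>I. A k l * v l) I"
    using L2_set_inner_le[of v "\<lambda>k. \<Sum>l\<in>I. A k l * v l" I] by linarith
  finally have "L2_set v I * (c * L2_set v I) \<le> L2_set v I * L2_set (\<lambda>k. \<Sum>l\<in>I. A k l * v l) I"
    by (simp add: power2_eq_square mult_ac)
  then show ?thesis using pos by simp
qed (simp add: L2_set_nonneg)

text \<open>A vector on \<open>I\<close> is transported along \<open>f\<close> and extended by zero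
  to \<open>J\<close>; neither the form nor the norm changes.\<close>

lemma coercive_reindex:
  assumes A: "coercive c J A" and inj: "inj_on f I" and sub: "f ` I \<subseteq> J" and fin: "finite J"
  shows "coercive c I (\<lambda>k l. A (f k) (f l))"
  unfolding coercive_def
proof
  fix v :: "'b \<Rightarrow> real"
  define w where "w j = (if j \<in> f ` I then v (inv_into I f j) else 0)" for j
  have w: "w (f k) = v k" if "k \<in> I" for k
    using that inj by (simp add: w_def inv_into_f_f)
  have *: "(\<Sum>k\<in>J. h k) = (\<Sum>k\<in>I. h (f k))" if "\<And>j. j \<notin> f ` I \<Longrightarrow> h j = 0" for h :: "'a \<Rightarrow> real"
  proof -
    have "(\<Sum>k\<in>J. h k) = (\<Sum>k\<in>f ` I. h k)"
      using that by (intro sum.mono_neutral_right fin sub) auto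
    then show ?thesis by (simp add: sum.reindex[OF inj])
  qed
  have w0: "w j = 0" if "j \<notin> f ` I" for j using that by (simp add: w_def)
  have "c * (\<Sum>k\<in>J. (w k)\<^sup>2) \<le> (\<Sum>k\<in>J. \<Sum>l\<in>J. A k l * w k * w l)"
    by (rule coerciveD[OF A])
  also have "(\<Sum>k\<in>J. (w k)\<^sup>2) = (\<Sum>k\<in>I. (v k)\<^sup>2)"
    by (subst *) (auto simp: w0 w)
  also have "(\<Sum>k\<in>J. \<Sum>l\<in>J. A k l * w k * w l) = (\<Sum>k\<in>I. \<Sum>l\<in>J. A (f k) l * w (f k) * w l)"
    by (subst *) (auto simp: w0)
  also have "\<dots> = (\<Sum>k\<in>I. \<Sum>l\<in>I. A (f k) (f l) * v k * v l)"
    by (intro sum.cong refl, subst *) (auto simp: w0 w)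
  finally show "c * (\<Sum>k\<in>I. (v k)\<^sup>2) \<le> (\<Sum>k\<in>I. \<Sum>l\<in>I. A (f k) (f l) * v k * v l)" .
qed

lemma coercive_subset: "coercive c J A \<Longrightarrow> I \<subseteq> J \<Longrightarrow> finite J \<Longrightarrow> coercive c I A"
  using coercive_reindex[of c J A "\<lambda>x. x" I] by auto

lemma coercive_le: "coercive c I A \<Longrightarrow> c' \<le> c \<Longrightarrow> coercive c' I A"
  unfolding coercive_def by (meson mult_right_mono order_trans sum_nonneg zero_le_power2)

lemma coercive_diag:
  assumes "coercive c I A" "finite I" "i \<in> I"
  shows "c \<le> A i i"
  using coerciveD[OF coercive_subset[OF assms(1), of "{i}"], of "\<lambda>_. 1"] assms by simp

lemma coercive_perturb:
  assumes A: "coercive c I A" and fin: "finite I" and M: "0 \<le> M"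
    and row: "\<And>k. k \<in> I \<Longrightarrow> (\<Sum>l\<in>I. \<bar>A k l - B k l\<bar>) \<le> M"
    and col: "\<And>l. l \<in> I \<Longrightarrow> (\<Sum>k\<in>I. \<bar>A k l - B k l\<bar>) \<le> M"
  shows "coercive (c - M) I B"
  unfolding coercive_def
proof
  fix v :: "'a \<Rightarrow> real"
  have "\<bar>\<Sum>k\<in>I. v k * (\<Sum>l\<in>I. (A k l - B k l) * v l)\<bar> 
      \<le> L2_set v I * L2_set (\<lambda>k. \<Sum>l\<in>I. (A k l - B k l) * v l) I"
    by (rule L2_set_inner_le)
  also have "\<dots> \<le> L2_set v I * (M * L2_set v I)"
    by (intro mult_left_mono schur_test fin M row col L2_set_nonneg)
  also have "\<dots> = M * (\<Sum>k\<in>I. (v k)\<^sup>2)"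
    using L2_set_power2[of v I] by (simp add: power2_eq_square)
  also have "(\<Sum>k\<in>I. v k * (\<Sum>l\<in>I. (A k l - B k l) * v l)) 
      = (\<Sum>k\<in>I. \<Sum>l\<in>I. A k l * v k * v l) - (\<Sum>k\<in>I. \<Sum>l\<in>I. B k l * v k * v l)"
    by (simp add: quadratic_form_eq left_diff_distrib sum_subtractf right_diff_distrib)
  finally show "(c - M) * (\<Sum>k\<in>I. (v k)\<^sup>2) \<le> (\<Sum>k\<in>I. \<Sum>l\<in>I. B k l * v k * v l)"
    using coerciveD[OF A, of v] by (simp add: left_diff_distrib)
qed

lemma coercive_perturb_const:
  assumes "coercive c I A" "finite I" "0 \<le> \<delta>"
    and "\<And>k l. k \<in> I \<Longrightarrow> l \<in> I \<Longrightarrow> \<bar>A k l - B k l\<bar> \<le> \<delta>"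
  shows "coercive (c - real (card I) * \<delta>) I B"
  using assms by (intro coercive_perturb[OF assms(1)]) (auto intro!: sum_bounded_above)

text \<open>Substitute \<open>v k / s k\<close> for \<open>v k\<close>. With \<open>s\<close> the
  standard deviations this passes from the covariance to the correlation matrix.\<close>

lemma coercive_scale:
  assumes A: "coercive c I A" and c: "0 \<le> c" 
    and s: "\<And>k. k \<in> I \<Longrightarrow> (s k)\<^sup>2 \<le> S" "\<And>k. k \<in> I \<Longrightarrow> s k \<noteq> 0" and S: "S > 0"
  shows "coercive (c / S) I (\<lambda>k l. A k l / (s k * s l))"
  unfolding coercive_def
proof
  fix v :: "'a \<Rightarrow> real"
  have "c / S * (\<Sum>k\<in>I. (v k)\<^sup>2) = c * (\<Sum>k\<in>I. (v k)\<^sup>2 / S)"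
    by (simp add: sum_divide_distrib[symmetric])
  also have "\<dots> \<le> c * (\<Sum>k\<in>I. (v k / s k)\<^sup>2)"
    using s S c by (intro mult_left_mono sum_mono) (auto simp: power_divide intro!: divide_left_mono)
  also have "\<dots> \<le> (\<Sum>k\<in>I. \<Sum>l\<in>I. A k l * (v k / s k) * (v l / s l))"
    by (rule coerciveD[OF A])
  finally show "c / S * (\<Sum>k\<in>I. (v k)\<^sup>2) \<le> (\<Sum>k\<in>I. \<Sum>l\<in>I. A k l / (s k * s l) * v k * v l)"
    by (simp add: field_simps)
qed

section \<open>Yule--Walker equations\<close>

definition toeplitz :: "(nat \<Rightarrow> real) \<Rightarrow> nat \<Rightarrow> nat \<Rightarrow> real" where
  "toeplitz \<rho> k l = \<rho> (nat \<bar>int k - int l\<bar>)"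

lemma toeplitz_sym: "toeplitz \<rho> k l = toeplitz \<rho> l k"
  by (simp add: toeplitz_def abs_minus_commute)

lemma toeplitz_0_right [simp]: "toeplitz \<rho> k 0 = \<rho> k"
  by (simp add: toeplitz_def)

lemma toeplitz_diag [simp]: "toeplitz \<rho> k k = \<rho> 0"
  by (simp add: toeplitz_def)

lemma toeplitz_ge: "l \<le> k \<Longrightarrow> toeplitz \<rho> k l = \<rho> (k - l)"
  by (simp add: toeplitz_def nat_diff_distrib)

lemma toeplitz_reflect: "k \<le> m \<Longrightarrow> l \<le> m \<Longrightarrow> toeplitz \<rho> (m - k) (m - l) = toeplitz \<rho> k l"
  by (simp add: toeplitz_def of_nat_diff abs_minus_commute)

lemma toeplitz_shift: "toeplitz \<rho> (k + s) (l + s) = toeplitz \<rho> k l"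
  by (simp add: toeplitz_def)

definition yule_walker :: "nat \<Rightarrow> (nat \<Rightarrow> real) \<Rightarrow> (nat \<Rightarrow> real) \<Rightarrow> bool" where
  "yule_walker m \<rho> \<phi> \<longleftrightarrow> (\<forall>k\<in>{1..m}. (\<Sum>l=1..m. toeplitz \<rho> k l * \<phi> l) = \<rho> k)"

lemma yule_walkerD: "yule_walker m \<rho> \<phi> \<Longrightarrow> k \<in> {1..m} \<Longrightarrow> (\<Sum>l=1..m. toeplitz \<rho> k l * \<phi> l) = \<rho> k"
  by (simp add: yule_walker_def)

text \<open>
  If the last reflection coefficient were \<open>\<plusminus>1\<close>, the forward and the backward prediction error
  filters would be proportional, although the Toeplitz matrix maps them to multiples of different
  unit vectors.
\<close>
lemma last_coefficient_not_unit:
  assumes pd: "coercive c {0..m} (toeplitz \<rho>)" and c: "c > 0" and m: "m \<ge> 1" and yw: "yule_walker m \<rho> \<phi>"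
  shows "(\<phi> m)\<^sup>2 \<noteq> 1"
proof
  assume s: "(\<phi> m)\<^sup>2 = 1"
  define s where "s = \<phi> m"
  have s2: "s * s = 1" using s by (simp add: s_def power2_eq_square)
  define v where "v l = (if l = 0 then 1 else - \<phi> l)" for l
  define \<sigma> where "\<sigma> = (\<Sum>l=0..m. toeplitz \<rho> 0 l * v l)"
  have row: "(\<Sum>l=0..m. toeplitz \<rho> k l * v l) = (if k = 0 then \<sigma> else 0)" if "k \<le> m" for k
  proof (cases "k = 0")
    case False
    have "(\<Sum>l=0..m. toeplitz \<rho> k l * v l) = toeplitz \<rho> k 0 * v 0 + (\<Sum>l=1..m. toeplitz \<rho> k l * v l)"
      by (simp add: sum.atLeast_Suc_atMost)
    also have "(\<Sum>l=1..m. toeplitz \<rho> k l * v l) = - (\<Sum>l=1..m. toeplitz \<rho> k l * \<phi> l)"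
      by (simp add: v_def sum_negf)
    finally show ?thesis using yule_walkerD[OF yw, of k] that False by (simp add: v_def)
  qed (simp add: \<sigma>_def)
  define u where "u l = v l + s * v (m - l)" for l
  have rowu: "(\<Sum>l=0..m. toeplitz \<rho> k l * u l) = (if k = 0 then \<sigma> else if k = m then s * \<sigma> else 0)"
    if "k \<le> m" for k
  proof -
    have "(\<Sum>l=0..m. toeplitz \<rho> k l * v (m - l)) = (\<Sum>l=0..m. toeplitz \<rho> k (m - l) * v l)"
      by (subst sum.atLeastAtMost_rev) simp
    also have "\<dots> = (\<Sum>l=0..m. toeplitz \<rho> (m - k) l * v l)"
      using that toeplitz_reflect[of "m - k" m _ \<rho>] by (intro sum.cong) auto
    finally have "(\<Sum>l=0..m. toeplitz \<rho> k l * v (m - l)) = (if k = m then \<sigma> else 0)"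
      using row[of "m - k"] that by auto
    moreover have "(\<Sum>l=0..m. toeplitz \<rho> k l * u l)
        = (\<Sum>l=0..m. toeplitz \<rho> k l * v l) + s * (\<Sum>l=0..m. toeplitz \<rho> k l * v (m - l))"
      by (simp add: u_def distrib_left sum.distrib sum_distrib_left mult_ac)
    ultimately show ?thesis using row[OF that] m by auto
  qed
  have u0: "u 0 = 0" using s2 m by (simp add: u_def v_def s_def)
  have um: "u m = 0" using m by (simp add: u_def v_def s_def)
  have "c * (\<Sum>k=0..m. (u k)\<^sup>2) \<le> (\<Sum>k=0..m. u k * (\<Sum>l=0..m. toeplitz \<rho> k l * u l))"
    using coerciveD[OF pd, of u] by (simp only: quadratic_form_eq)
  \<comment> \<open>\<open>u\<close> vanishes at 0 and m because \<open>s * s = 1\<close>, and its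
    Toeplitz image vanishes at all other indices.\<close>
  also have "\<dots> = 0"
    by (intro sum.neutral) (auto simp: rowu u0 um)
  finally have "(\<Sum>k=0..m. (u k)\<^sup>2) \<le> 0"
    using c by (simp add: mult_le_0_iff)
  then have "(\<Sum>k=0..m. (u k)\<^sup>2) = 0"
    by (meson antisym sum_nonneg zero_le_power2)
  then have "u k = 0" if "k \<le> m" for k
    using that by (subst (asm) sum_nonneg_eq_0_iff) auto
  then have "\<sigma> = 0" using rowu[of 0] by simp
  have "c * (\<Sum>k=0..m. (v k)\<^sup>2) \<le> (\<Sum>k=0..m. v k * (\<Sum>l=0..m. toeplitz \<rho> k l * v l))"
    using coerciveD[OF pd, of v] by (simp only: quadratic_form_eq)
  also have "\<dots> = 0"
    using \<open>\<sigma> = 0\<close> by (intro sum.neutral) (auto simp: row)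
  finally have "(\<Sum>k=0..m. (v k)\<^sup>2) \<le> 0"
    using c by (simp add: mult_le_0_iff)
  moreover have "(v 0)\<^sup>2 \<le> (\<Sum>k=0..m. (v k)\<^sup>2)"
    by (rule member_le_sum) auto
  ultimately show False by (simp add: v_def)
qed

text \<open>One Levinson step backwards, with s the last coefficient. The first m equations carry
  the extra term s times \<rho>(m + 1 - k). Reflecting k to m + 1 - k swaps \<rho>(k) and \<rho>(m +
  1 - k), so adding s times the reflected system cancels this term and leaves the factor 1 -
  s^2.\<close>

lemma yule_walker_step_down:
  assumes yw: "yule_walker (Suc m) \<rho> \<phi>" and s: "(\<phi> (Suc m))\<^sup>2 \<noteq> 1"
  shows "yule_walker m \<rho> (\<lambda>l. (\<phi> l + \<phi> (Suc m) * \<phi> (Suc m - l)) / (1 - (\<phi> (Suc m))\<^sup>2))"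
  unfolding yule_walker_def
proof
  fix k assume k: "k \<in> {1..m}"
  define s where "s = \<phi> (Suc m)"
  have *: "(\<Sum>l=1..m. toeplitz \<rho> k l * \<phi> l) = \<rho> k - \<rho> (Suc m - k) * s" if "k \<in> {1..m}" for k
    using yule_walkerD[OF yw, of k] that toeplitz_sym[of \<rho> k "Suc m"]
    by (simp add: s_def toeplitz_ge)
  have "(\<Sum>l=1..m. toeplitz \<rho> k l * \<phi> (Suc m - l)) = (\<Sum>l=1..m. toeplitz \<rho> k (Suc m - l) * \<phi> l)"
    by (subst sum.atLeastAtMost_rev) simp
  also have "\<dots> = (\<Sum>l=1..m. toeplitz \<rho> (Suc m - k) l * \<phi> l)"
    using k toeplitz_reflect[of "Suc m - k" "Suc m" _ \<rho>] by (intro sum.cong) auto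
  also have "\<dots> = \<rho> (Suc m - k) - \<rho> k * s"
  proof -
    have "Suc m - k \<in> {1..m}" "Suc m - (Suc m - k) = k" using k by auto
    then show ?thesis using *[of "Suc m - k"] by simp
  qed
  finally have "(\<Sum>l=1..m. toeplitz \<rho> k l * (\<phi> l + s * \<phi> (Suc m - l))) = \<rho> k * (1 - s\<^sup>2)"
    using *[OF k] by (simp add: distrib_left sum.distrib mult.left_commute[of _ s] 
        flip: sum_distrib_left) (simp add: algebra_simps power2_eq_square)
  then show "(\<Sum>l=1..m. toeplitz \<rho> k l * ((\<phi> l + \<phi> (Suc m) * \<phi> (Suc m - l)) / (1 - (\<phi> (Suc m))\<^sup>2))) = \<rho> k"
    using s by (simp add: s_def sum_divide_distrib[symmetric] field_simps)
qed

text \<open>The stepped-down coefficients are computed from \<open>\<phi>\<close> alone, so both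
  sequences again share a solution of order m, and the induction hypothesis covers the lags up to m.
  The last equation of order m + 1 expresses lag m + 1 through the smaller lags with the same
  coefficients.\<close>

lemma yule_walker_determines_correlation:
  assumes "coercive c {0..m} (toeplitz \<rho>)" "coercive c' {0..m} (toeplitz \<rho>')" "c > 0" "c' > 0"
    and "yule_walker m \<rho> \<phi>" "yule_walker m \<rho>' \<phi>" and "k \<le> m"
  shows "\<rho> k * \<rho>' 0 = \<rho>' k * \<rho> 0"
  using assms(1,2,5,6,7)
proof (induction m arbitrary: \<phi> k)
  case (Suc m)
  have s: "(\<phi> (Suc m))\<^sup>2 \<noteq> 1"
    by (rule last_coefficient_not_unit[OF Suc.prems(1) assms(3) _ Suc.prems(3)]) simp
  have sub: "coercive c {0..m} (toeplitz \<rho>)" "coercive c' {0..m} (toeplitz \<rho>')"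
    by (rule coercive_subset[OF Suc.prems(1)] coercive_subset[OF Suc.prems(2)]; simp)+
  have IH: "\<rho> k * \<rho>' 0 = \<rho>' k * \<rho> 0" if "k \<le> m" for k
    by (rule Suc.IH[OF sub yule_walker_step_down[OF Suc.prems(3) s] 
          yule_walker_step_down[OF Suc.prems(4) s] that])
  show ?case
  proof (cases "k = Suc m")
    case True
    have *: "(\<Sum>l=1..Suc m. r (Suc m - l) * \<phi> l) = r (Suc m)" if "yule_walker (Suc m) r \<phi>" for r
      using yule_walkerD[OF that, of "Suc m"] by (simp add: toeplitz_ge)
    have "\<rho> (Suc m) * \<rho>' 0 = (\<Sum>l=1..Suc m. \<rho> (Suc m - l) * \<rho>' 0 * \<phi> l)"
      by (subst *[OF Suc.prems(3), symmetric], subst sum_distrib_right) (simp add: mult_ac)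
    also have "\<dots> = (\<Sum>l=1..Suc m. \<rho>' (Suc m - l) * \<rho> 0 * \<phi> l)"
      by (intro sum.cong refl) (subst IH, auto)
    also have "\<dots> = \<rho>' (Suc m) * \<rho> 0"
      by (subst *[OF Suc.prems(4), symmetric], subst sum_distrib_right) (simp add: mult_ac)
    finally show ?thesis using True by simp
  next
    case False
    then show ?thesis using IH[of k] Suc.prems(5) by simp
  qed
qed simp

section \<open>Short-range dependent Toeplitz systems\<close>

text \<open>Each lag occurs at most twice in a row, once on either side of the diagonal.\<close>

lemma sum_toeplitz_le:
  assumes f: "\<And>j. 0 \<le> f j" and k: "k \<in> {1..m}"
  shows "(\<Sum>l=1..m. toeplitz f k l) \<le> 2 * (\<Sum>j=0..m. f j)"
proof -
  have "(\<Sum>l=1..m. toeplitz f k l) = (\<Sum>l\<in>{1..k} \<union> {k<..m}. toeplitz f k l)"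
    using k by (intro sum.cong) auto
  also have "\<dots> = (\<Sum>l=1..k. toeplitz f k l) + (\<Sum>l\<in>{k<..m}. toeplitz f k l)"
    by (rule sum.union_disjoint) auto
  also have "(\<Sum>l=1..k. toeplitz f k l) = sum f ((\<lambda>l. k - l) ` {1..k})"
    by (subst sum.reindex) (auto simp: inj_on_def toeplitz_ge)
  also have "\<dots> \<le> (\<Sum>j=0..m. f j)"
    using k f by (intro sum_mono2) auto
  also have "(\<Sum>l\<in>{k<..m}. toeplitz f k l) = sum f ((\<lambda>l. l - k) ` {k<..m})"
    by (subst sum.reindex) (auto simp: inj_on_def toeplitz_ge toeplitz_sym[of _ k])
  also have "\<dots> \<le> (\<Sum>j=0..m. f j)"
    using k f by (intro sum_mono2) auto
  finally show ?thesis by simp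
qed

lemma sum_powr_tail_le:
  assumes \<tau>: "\<tau> > 1" and w: "w \<ge> 1"
  shows "(\<Sum>j\<in>{w<..m}. real j powr (-\<tau>)) \<le> real w powr (1 - \<tau>) / (\<tau> - 1)"
proof (cases "w \<le> m")
  case True
  \<comment> \<open>The added term is the integral of y^(-\<tau>) from m to infinity. It makes the
    induction telescope: by the mean value theorem each new summand is at most the decrease of this
    integral.\<close>
  then have "(\<Sum>j\<in>{w<..m}. real j powr (-\<tau>)) + real m powr (1 - \<tau>) / (\<tau> - 1)
      \<le> real w powr (1 - \<tau>) / (\<tau> - 1)"
  proof (induction m rule: dec_induct)
    case (step m)
    have m: "real m > 0" using step w by simp
    have "\<exists>z. z > real m \<and> z < real m + 1 \<and> 
        (real m + 1) powr (1 - \<tau>) - real m powr (1 - \<tau>) = (real m + 1 - real m) * ((1 - \<tau>) * z powr (1 - \<tau> - 1))"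
      using m by (intro MVT2) (auto intro!: derivative_eq_intros)
    then obtain z where z: "z > real m" "z < real m + 1"
      and eq: "(real m + 1) powr (1 - \<tau>) - real m powr (1 - \<tau>) = (1 - \<tau>) * z powr (- \<tau>)"
      by auto
    have "(real m + 1) powr (-\<tau>) \<le> z powr (-\<tau>)"
      using z m \<tau> by (intro powr_mono2') auto
    then have "(\<tau> - 1) * (real m + 1) powr (-\<tau>) \<le> (\<tau> - 1) * z powr (-\<tau>)"
      using \<tau> by (intro mult_left_mono) auto
    then have "(\<tau> - 1) * (real m + 1) powr (-\<tau>) + (real m + 1) powr (1 - \<tau>) \<le> real m powr (1 - \<tau>)"
      using eq by (simp add: algebra_simps)
    then have "((\<tau> - 1) * (real m + 1) powr (-\<tau>) + (real m + 1) powr (1 - \<tau>)) / (\<tau> - 1) \<le> real m powr (1 - \<tau>) / (\<tau> - 1)"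
      using \<tau> by (intro divide_right_mono) auto
    then have "(real m + 1) powr (-\<tau>) + (real m + 1) powr (1 - \<tau>) / (\<tau> - 1) \<le> real m powr (1 - \<tau>) / (\<tau> - 1)"
      using \<tau> by (simp add: add_divide_distrib)
    moreover have "{w<..Suc m} = insert (Suc m) {w<..m}" using step by auto
    ultimately show ?case using step.IH by (simp add: add_ac)
  qed simp
  moreover have "real m powr (1 - \<tau>) / (\<tau> - 1) \<ge> 0" using \<tau> by simp
  ultimately show ?thesis by linarith
next
  case False
  then have "{w<..m} = {}" by auto
  then show ?thesis using \<tau> by simp
qed

text \<open>Twice the bound \<open>C + C + C / (\<tau> - 1)\<close> on the sum of
  \<bar>\<rho>(j)\<bar> (lag 0, lag 1, larger lags), plus \<open>c\<close>. The summand
  \<open>c\<close> ensures \<open>c \<le> bound\<close>, so that the radicand in the contraction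
  rate is nonnegative.\<close>

definition srd_bound :: "real \<Rightarrow> real \<Rightarrow> real \<Rightarrow> real" where
  "srd_bound c C \<tau> = c + 2 * C * (2 + 1 / (\<tau> - 1))"

text \<open>The contraction factor of Richardson's iteration for a form with coercivity constant
  \<open>c / 2\<close> and operator norm at most \<open>srd_bound\<close>.\<close>

definition srd_rate :: "real \<Rightarrow> real \<Rightarrow> real \<Rightarrow> real" where
  "srd_rate c C \<tau> = sqrt (1 - (c / 2)\<^sup>2 / (srd_bound c C \<tau>)\<^sup>2)"

locale srd_toeplitz =
  fixes \<rho> :: "nat \<Rightarrow> real" and m :: nat and c C \<tau> :: real
  assumes c: "c > 0" and \<tau>: "\<tau> > 1"
    and coercive: "coercive c {1..m} (toeplitz \<rho>)"
    and \<rho>0: "\<bar>\<rho> 0\<bar> \<le> C" and \<rho>: "\<And>k. k \<in> {1..m} \<Longrightarrow> \<bar>\<rho> k\<bar> \<le> C * real k powr (-\<tau>)"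
begin

abbreviation "bound \<equiv> srd_bound c C \<tau>"

abbreviation "rate \<equiv> srd_rate c C \<tau>"

definition "tail w = C * real w powr (1 - \<tau>) / (\<tau> - 1)"

lemma C: "C \<ge> 0" using \<rho>0 by linarith

lemma bound_ge: "c \<le> bound" "bound > 0"
  using C c \<tau> by (auto simp: srd_bound_def intro: add_pos_nonneg)

lemma tail_nonneg: "tail w \<ge> 0" using C \<tau> by (simp add: tail_def)

lemma sum_tail: "w \<ge> 1 \<Longrightarrow> (\<Sum>j\<in>{w<..m}. \<bar>\<rho> j\<bar>) \<le> tail w"
proof -
  assume w: "w \<ge> 1"
  have "(\<Sum>j\<in>{w<..m}. \<bar>\<rho> j\<bar>) \<le> (\<Sum>j\<in>{w<..m}. C * real j powr (-\<tau>))"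
    using w by (intro sum_mono \<rho>) auto
  also have "\<dots> \<le> C * (real w powr (1 - \<tau>) / (\<tau> - 1))"
    by (subst sum_distrib_left[symmetric]) (intro mult_left_mono sum_powr_tail_le \<tau> w C)
  finally show ?thesis by (simp add: tail_def)
qed

lemma sum_abs_bound: "2 * (\<Sum>j=0..m. \<bar>\<rho> j\<bar>) \<le> bound"
proof -
  have "(\<Sum>j=0..m. \<bar>\<rho> j\<bar>) \<le> C + C + tail 1"
  proof (cases "m = 0")
    case False
    then have "{0..m} = insert 0 (insert 1 {1<..m})" by auto
    then show ?thesis using \<rho>[of 1] \<rho>0 sum_tail[of 1] False by simp
  qed (use \<rho>0 C tail_nonneg[of 1] in simp)
  moreover have "bound = c + 4 * C + 2 * tail 1" by (simp add: srd_bound_def tail_def algebra_simps)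
  ultimately show ?thesis using c by linarith
qed

lemma row_sum: "k \<in> {1..m} \<Longrightarrow> (\<Sum>l=1..m. \<bar>toeplitz \<rho> k l\<bar>) \<le> bound"
  using sum_toeplitz_le[of "\<lambda>j. \<bar>\<rho> j\<bar>" k m] sum_abs_bound by (simp add: toeplitz_def)

lemma L2_rho: "L2_set \<rho> {1..m} \<le> bound"
proof -
  have "L2_set \<rho> {1..m} \<le> (\<Sum>j=1..m. \<bar>\<rho> j\<bar>)" by (rule L2_set_le_sum_abs)
  also have "\<dots> \<le> (\<Sum>j=0..m. \<bar>\<rho> j\<bar>)" by (intro sum_mono2) auto
  also have "\<dots> \<le> 2 * (\<Sum>j=0..m. \<bar>\<rho> j\<bar>)" by (simp add: sum_nonneg)
  finally show ?thesis using sum_abs_bound by linarith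
qed

lemma L2_yule_walker:
  assumes "yule_walker m \<rho> \<alpha>" 
  shows "L2_set \<alpha> {1..m} \<le> bound / c"
proof -
  have "c * L2_set \<alpha> {1..m} \<le> L2_set (\<lambda>k. \<Sum>l=1..m. toeplitz \<rho> k l * \<alpha> l) {1..m}"
    by (rule coercive_L2_le[OF coercive])
  also have "\<dots> = L2_set \<rho> {1..m}"
    by (intro L2_set_cong refl yule_walkerD[OF assms])
  also have "\<dots> \<le> bound" by (rule L2_rho)
  finally show ?thesis using c by (simp add: field_simps)
qed

section \<open>Banded truncation and Richardson iteration\<close>

definition "banded w j = (if j \<le> w then \<rho> j else 0)"

lemma banded_row_sum:
  assumes "w \<ge> 1" "k \<in> {1..m}"
  shows "(\<Sum>l=1..m. \<bar>toeplitz \<rho> k l - toeplitz (banded w) k l\<bar>) \<le> 2 * tail w"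
proof -
  have "(\<Sum>l=1..m. \<bar>toeplitz \<rho> k l - toeplitz (banded w) k l\<bar>) \<le> 2 * (\<Sum>j=0..m. \<bar>\<rho> j - banded w j\<bar>)"
    using sum_toeplitz_le[of "\<lambda>j. \<bar>\<rho> j - banded w j\<bar>" k m] assms(2) by (simp add: toeplitz_def)
  also have "(\<Sum>j=0..m. \<bar>\<rho> j - banded w j\<bar>) = (\<Sum>j\<in>{w<..m}. \<bar>\<rho> j\<bar>)"
    by (intro sum.mono_neutral_cong_right) (auto simp: banded_def)
  finally show ?thesis using sum_tail[OF assms(1)] by linarith
qed

lemma banded_row_sum_abs:
  assumes "k \<in> {1..m}"
  shows "(\<Sum>l=1..m. \<bar>toeplitz (banded w) k l\<bar>) \<le> bound"
proof -
  have "(\<Sum>l=1..m. \<bar>toeplitz (banded w) k l\<bar>) \<le> (\<Sum>l=1..m. \<bar>toeplitz \<rho> k l\<bar>)"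
    by (intro sum_mono) (auto simp: toeplitz_def banded_def)
  then show ?thesis using row_sum[OF assms] by linarith
qed

lemma banded_coercive:
  assumes "w \<ge> 1" "2 * tail w \<le> c / 2"
  shows "coercive (c / 2) {1..m} (toeplitz (banded w))"
proof -
  have "coercive (c - 2 * tail w) {1..m} (toeplitz (banded w))"
    using banded_row_sum[OF assms(1)] tail_nonneg[of w] 
    by (intro coercive_perturb[OF coercive]) (auto simp: toeplitz_sym[of _ _ l for l])
  then show ?thesis by (rule coercive_le) (use assms(2) in linarith)
qed

text \<open>The step size h = \<open>c / 2 / bound\<^sup>2\<close> minimises 1 - 2 h (c/2) + h^2
  bound^2, the bound for the squared contraction factor.\<close>

primrec richardson :: "nat \<Rightarrow> nat \<Rightarrow> nat \<Rightarrow> real" where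
  "richardson w 0 = (\<lambda>l. 0)"
| "richardson w (Suc k) = (\<lambda>l. richardson w k l + c / 2 / bound\<^sup>2 * 
     (banded w l - (\<Sum>j=1..m. toeplitz (banded w) l j * richardson w k j)))"

definition "residual w k l = banded w l - (\<Sum>j=1..m. toeplitz (banded w) l j * richardson w k j)"

lemma residual_Suc:
  "residual w (Suc k) l = residual w k l - c / 2 / bound\<^sup>2 * (\<Sum>j=1..m. toeplitz (banded w) l j * residual w k j)"
proof -
  have "richardson w (Suc k) = (\<lambda>j. richardson w k j + c / 2 / bound\<^sup>2 * residual w k j)"
    by (simp add: residual_def)
  then show ?thesis
    unfolding residual_def[of w "Suc k" l]
    by (simp only:) (simp add: distrib_left sum.distrib mult.left_commute[of _ "c / _"] mult.left_commute[of _ c] 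
        residual_def[of w k l] sum_distrib_left)
qed

text \<open>A matrix of bandwidth \<open>w\<close> widens the support by at most \<open>w\<close>,
  and the iteration starts from zero with a right-hand side supported up to lag
  \<open>w\<close>.\<close>

lemma richardson_support: "l > k * w \<Longrightarrow> richardson w k l = 0"
proof (induction k arbitrary: l)
  case (Suc k)
  have "(\<Sum>j=1..m. toeplitz (banded w) l j * richardson w k j) = 0"
  proof (intro sum.neutral ballI)
    fix j
    show "toeplitz (banded w) l j * richardson w k j = 0"
    proof (cases "j > k * w")
      case False
      then have "nat \<bar>int l - int j\<bar> > w" using Suc.prems by (simp add: nat_diff_distrib' zless_nat_eq_int_zless)
      then show ?thesis by (simp add: toeplitz_def banded_def)
    qed (simp add: Suc.IH)
  qed
  moreover have "l > w" "l > k * w" using Suc.prems by (auto simp: order_le_less_trans)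
  ultimately show ?case using Suc.IH by (simp add: banded_def)
qed simp

lemma rate_nonneg: "0 \<le> rate" and rate_less: "rate < 1"
proof -
  have "(c / 2)\<^sup>2 \<le> bound\<^sup>2" using bound_ge c by (intro power_mono) auto
  then show "0 \<le> rate" using bound_ge by (auto simp: srd_rate_def)
  show "rate < 1" using bound_ge c by (auto simp: srd_rate_def)
qed

text \<open>Expand the square of e - h T e, where T is the banded matrix: coercivity bounds the
  mixed term from below, and the Schur test bounds the norm of T e.\<close>

lemma residual_contract:
  assumes "w \<ge> 1" "2 * tail w \<le> c / 2"
  shows "L2_set (residual w (Suc k)) {1..m} \<le> rate * L2_set (residual w k) {1..m}"
proof -
  define e where "e = residual w k"
  define S where "S l = (\<Sum>j=1..m. toeplitz (banded w) l j * e j)" for l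
  define h where "h = c / 2 / bound\<^sup>2"
  have h: "h \<ge> 0" using c by (simp add: h_def)
  have b2: "bound\<^sup>2 > 0" using bound_ge by simp
  have 1: "c / 2 * (L2_set e {1..m})\<^sup>2 \<le> (\<Sum>l=1..m. e l * S l)"
    using coerciveD[OF banded_coercive[OF assms], of e] 
    by (simp only: S_def quadratic_form_eq L2_set_power2)
  have "L2_set S {1..m} \<le> bound * L2_set e {1..m}"
    unfolding S_def using bound_ge banded_row_sum_abs 
    by (intro schur_test) (auto simp: toeplitz_sym[of _ _ l for l])
  then have 2: "(L2_set S {1..m})\<^sup>2 \<le> bound\<^sup>2 * (L2_set e {1..m})\<^sup>2"
    by (metis L2_set_nonneg power_mono power_mult_distrib)
  have "(L2_set (residual w (Suc k)) {1..m})\<^sup>2 = (\<Sum>l=1..m. (e l - h * S l)\<^sup>2)"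
    by (simp add: L2_set_power2 residual_Suc e_def S_def h_def)
  also have "\<dots> = (\<Sum>l=1..m. (e l)\<^sup>2 - 2 * h * (e l * S l) + h\<^sup>2 * (S l)\<^sup>2)"
    by (intro sum.cong) (auto simp: power2_eq_square algebra_simps)
  also have "\<dots> = (L2_set e {1..m})\<^sup>2 - 2 * h * (\<Sum>l=1..m. e l * S l) + h\<^sup>2 * (L2_set S {1..m})\<^sup>2"
    by (simp add: sum.distrib sum_subtractf sum_distrib_left L2_set_power2)
  also have "\<dots> \<le> (L2_set e {1..m})\<^sup>2 - 2 * h * (c / 2 * (L2_set e {1..m})\<^sup>2) + h\<^sup>2 * (bound\<^sup>2 * (L2_set e {1..m})\<^sup>2)"
    by (intro add_mono diff_mono mult_left_mono 1 2) (auto simp: h)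
  also have "\<dots> = (1 - 2 * h * (c / 2) + h\<^sup>2 * bound\<^sup>2) * (L2_set e {1..m})\<^sup>2"
    by (simp add: algebra_simps)
  also have "1 - 2 * h * (c / 2) + h\<^sup>2 * bound\<^sup>2 = 1 - (c / 2)\<^sup>2 / bound\<^sup>2"
    using b2 bound_ge by (simp add: h_def field_simps power2_eq_square)
  also have "\<dots> = rate\<^sup>2"
    using rate_nonneg by (simp add: srd_rate_def real_sqrt_ge_0_iff)
  finally have "(L2_set (residual w (Suc k)) {1..m})\<^sup>2 \<le> (rate * L2_set e {1..m})\<^sup>2"
    by (simp add: power_mult_distrib)
  then show ?thesis unfolding e_def
    by (rule power2_le_imp_le) (simp add: rate_nonneg L2_set_nonneg)
qed

lemma L2_banded: "L2_set (banded w) {1..m} \<le> bound"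
proof -
  have "L2_set (banded w) {1..m} \<le> L2_set \<rho> {1..m}"
    unfolding L2_set_def by (intro real_sqrt_le_mono sum_mono) (auto simp: banded_def)
  then show ?thesis using L2_rho by linarith
qed

lemma residual_bound:
  assumes "w \<ge> 1" "2 * tail w \<le> c / 2"
  shows "L2_set (residual w k) {1..m} \<le> rate ^ k * bound"
proof (induction k)
  case 0
  have "residual w 0 = banded w" by (simp add: residual_def fun_eq_iff)
  then show ?case using L2_banded by simp
next
  case (Suc k)
  have "L2_set (residual w (Suc k)) {1..m} \<le> rate * L2_set (residual w k) {1..m}"
    by (rule residual_contract[OF assms])
  also have "\<dots> \<le> rate * (rate ^ k * bound)"
    by (intro mult_left_mono Suc.IH rate_nonneg)
  finally show ?case by (simp add: mult_ac)
qed

text \<open>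
  The \<open>k\<close>-th Richardson iterate for the banded system vanishes beyond \<open>k * w \<le> b\<close>, so it bounds
  the tail of \<open>\<alpha>\<close> by its own distance to \<open>\<alpha>\<close>.
\<close>
lemma yule_walker_tail_banded:
  assumes w: "w \<ge> 1" "2 * tail w \<le> c / 2" and yw: "yule_walker m \<rho> \<alpha>" and b: "k * w \<le> b"
  shows "L2_set \<alpha> {b<..m} \<le> (tail w + rate ^ k * bound + 2 * tail w * (4 * bound / c)) / c"
proof -
  let ?\<beta> = "richardson w k"
  let ?I = "{1..m}"
  have "c / 2 * L2_set ?\<beta> ?I \<le> L2_set (\<lambda>l. \<Sum>j=1..m. toeplitz (banded w) l j * ?\<beta> j) ?I"
    by (rule coercive_L2_le[OF banded_coercive[OF w]])
  also have "\<dots> = L2_set (\<lambda>l. banded w l - residual w k l) ?I"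
    by (simp add: residual_def)
  also have "\<dots> \<le> L2_set (banded w) ?I + L2_set (residual w k) ?I"
    by (rule L2_set_diff_le)
  also have "\<dots> \<le> bound + rate ^ k * bound"
    by (intro add_mono L2_banded residual_bound w)
  also have "\<dots> \<le> 2 * bound"
    using rate_nonneg rate_less bound_ge power_le_one[of rate k] by (simp add: mult_le_cancel_right1)
  finally have \<beta>: "L2_set ?\<beta> ?I \<le> 4 * bound / c"
    using c by (simp add: field_simps)
  have "L2_set \<alpha> {b<..m} = L2_set (\<lambda>l. \<alpha> l - ?\<beta> l) {b<..m}"
    using b by (intro L2_set_cong) (auto simp: richardson_support)
  also have "\<dots> \<le> L2_set (\<lambda>l. \<alpha> l - ?\<beta> l) ?I"
    by (intro L2_set_mono_set) auto
  finally have 1: "L2_set \<alpha> {b<..m} \<le> L2_set (\<lambda>l. \<alpha> l - ?\<beta> l) ?I" .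
  \<comment> \<open>Three sources of error: the truncated right-hand side, the unfinished iteration
    and the truncated matrix. The last acts on the iterate, which is why its norm was bounded
    first.\<close>
  have eq: "(\<Sum>j=1..m. toeplitz \<rho> l j * (\<alpha> j - ?\<beta> j)) 
     = (\<rho> l - banded w l) + (residual w k l - (\<Sum>j=1..m. (toeplitz \<rho> l j - toeplitz (banded w) l j) * ?\<beta> j))"
    if "l \<in> ?I" for l
    using yule_walkerD[OF yw that]
    by (simp add: right_diff_distrib left_diff_distrib sum_subtractf residual_def)
  have "c * L2_set (\<lambda>l. \<alpha> l - ?\<beta> l) ?I \<le> L2_set (\<lambda>l. \<Sum>j=1..m. toeplitz \<rho> l j * (\<alpha> j - ?\<beta> j)) ?I"
    by (rule coercive_L2_le[OF coercive])
  also have "\<dots> = L2_set (\<lambda>l. (\<rho> l - banded w l) + (residual w k l - (\<Sum>j=1..m. (toeplitz \<rho> l j - toeplitz (banded w) l j) * ?\<beta> j))) ?I"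
    by (intro L2_set_cong refl eq)
  also have "\<dots> \<le> L2_set (\<lambda>l. \<rho> l - banded w l) ?I + (L2_set (residual w k) ?I + L2_set (\<lambda>l. \<Sum>j=1..m. (toeplitz \<rho> l j - toeplitz (banded w) l j) * ?\<beta> j) ?I)"
    by (intro order_trans[OF L2_set_triangle_ineq] add_left_mono L2_set_diff_le)
  also have "\<dots> \<le> tail w + (rate ^ k * bound + 2 * tail w * (4 * bound / c))"
  proof (intro add_mono residual_bound w)
    have "L2_set (\<lambda>l. \<rho> l - banded w l) ?I \<le> (\<Sum>l\<in>?I. \<bar>\<rho> l - banded w l\<bar>)"
      by (rule L2_set_le_sum_abs)
    also have "\<dots> = (\<Sum>j\<in>{w<..m}. \<bar>\<rho> j\<bar>)"
      using w by (intro sum.mono_neutral_cong_right) (auto simp: banded_def)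
    finally show "L2_set (\<lambda>l. \<rho> l - banded w l) ?I \<le> tail w"
      using sum_tail[OF w(1)] by linarith
    have "L2_set (\<lambda>l. \<Sum>j=1..m. (toeplitz \<rho> l j - toeplitz (banded w) l j) * ?\<beta> j) ?I 
        \<le> 2 * tail w * L2_set ?\<beta> ?I"
      using banded_row_sum[OF w(1)] tail_nonneg
      by (intro schur_test) (auto simp: toeplitz_sym[of _ _ l for l])
    also have "\<dots> \<le> 2 * tail w * (4 * bound / c)"
      using \<beta> tail_nonneg by (intro mult_left_mono) auto
    finally show "L2_set (\<lambda>l. \<Sum>j=1..m. (toeplitz \<rho> l j - toeplitz (banded w) l j) * ?\<beta> j) ?I 
        \<le> 2 * tail w * (4 * bound / c)" .
  qed
  finally have "L2_set (\<lambda>l. \<alpha> l - ?\<beta> l) ?I \<le> (tail w + rate ^ k * bound + 2 * tail w * (4 * bound / c)) / c"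
    using c by (simp add: field_simps)
  with 1 show ?thesis by linarith
qed

end

section \<open>Spectra and matrix inverses\<close>

text \<open>
  The infimum of the Rayleigh quotient is an eigenvalue: otherwise \<open>A - \<theta>\<close> would be invertible, and
  an invertible positive semidefinite form is bounded away from \<open>0\<close> on the unit sphere.
\<close>
lemma coercive_if_spectrum_ge:
  fixes A :: "real mat"
  assumes A: "A \<in> carrier_mat n n" and sym: "\<And>i j. i < n \<Longrightarrow> j < n \<Longrightarrow> A $$ (i, j) = A $$ (j, i)"
    and ev: "\<And>e. eigenvalue A e \<Longrightarrow> \<kappa> \<le> e" and n: "n > 0"
  shows "coercive \<kappa> {..<n} (\<lambda>i j. A $$ (i, j))"
proof -
  define a where "a i j = A $$ (i, j)" for i j
  define Q where "Q v = (\<Sum>k<n. \<Sum>l<n. a k l * v k * v l)" for v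
  define S where "S v = (\<Sum>k<n. (v k)\<^sup>2)" for v :: "nat \<Rightarrow> real"
  define M where "M = (\<Sum>k<n. \<Sum>l<n. \<bar>a k l\<bar>)"
  have M: "M \<ge> 0" by (simp add: M_def sum_nonneg)
  have Snn: "S v \<ge> 0" for v by (simp add: S_def sum_nonneg)
  have QM: "\<bar>Q v\<bar> \<le> M" if "S v = 1" for v
  proof -
    have v1: "\<bar>v k\<bar> \<le> 1" if "k < n" for k
    proof -
      have "(v k)\<^sup>2 \<le> S v" unfolding S_def using that by (intro member_le_sum) auto
      then show ?thesis using \<open>S v = 1\<close> by (simp add: abs_square_le_1)
    qed
    have "\<bar>Q v\<bar> \<le> (\<Sum>k<n. \<Sum>l<n. \<bar>a k l * v k * v l\<bar>)"
      unfolding Q_def by (intro order_trans[OF sum_abs] sum_mono) simp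
    also have "\<dots> \<le> M" unfolding M_def
    proof (intro sum_mono)
      fix k l assume "k \<in> {..<n}" "l \<in> {..<n}"
      then have "\<bar>v k\<bar> * \<bar>v l\<bar> \<le> 1" by (intro mult_le_one v1) auto
      then have "\<bar>a k l\<bar> * (\<bar>v k\<bar> * \<bar>v l\<bar>) \<le> \<bar>a k l\<bar> * 1" by (intro mult_left_mono) auto
      then show "\<bar>a k l * v k * v l\<bar> \<le> \<bar>a k l\<bar>" by (simp add: abs_mult mult_ac)
    qed
    finally show ?thesis .
  qed
  define \<theta> where "\<theta> = Inf (Q ` {v. S v = 1})"
  have "S (\<lambda>k. if k = 0 then 1 else 0) = 1"
  proof -
    have "S (\<lambda>k. if k = 0 then 1 else 0) = (\<Sum>k<n. if k = 0 then 1 else 0)"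
      unfolding S_def by (intro sum.cong) auto
    then show ?thesis using n by (simp add: sum.delta)
  qed
  then have ne: "Q ` {v. S v = 1} \<noteq> {}" by blast
  have bdd: "bdd_below (Q ` {v. S v = 1})"
    using QM by (intro bdd_belowI[of _ "-M"]) (auto simp: abs_le_iff dest!: QM)
  have hom: "\<theta>' * S v \<le> Q v" if "\<And>v. S v = 1 \<Longrightarrow> \<theta>' \<le> Q v" for \<theta>' v
  proof (cases "S v = 0")
    case True
    then have "v k = 0" if "k < n" for k
      using that unfolding S_def by (subst (asm) sum_nonneg_eq_0_iff) auto
    then have "Q v = 0" unfolding Q_def by (intro sum.neutral ballI) auto
    then show ?thesis using True by simp
  next
    case False
    then have pos: "S v > 0" using Snn[of v] by linarith
    define u where "u k = v k / sqrt (S v)" for k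
    have "S u = 1" using pos by (simp add: S_def u_def power_divide flip: sum_divide_distrib)
    moreover have "Q u = Q v / S v"
      using pos by (simp add: Q_def u_def sum_divide_distrib flip: power2_eq_square)
    ultimately have "\<theta>' \<le> Q v / S v" using that[of u] by simp
    then show ?thesis using pos by (simp add: pos_le_divide_eq)
  qed
  have lower: "\<theta> * S v \<le> Q v" for v
    by (rule hom) (auto simp: \<theta>_def intro!: cInf_lower bdd)
  have "eigenvalue A \<theta>"
  proof (rule ccontr)
    assume not_ev: "\<not> eigenvalue A \<theta>"
    define B where "B = char_matrix A \<theta>"
    have Bc: "B \<in> carrier_mat n n" using A by (simp add: B_def)
    define b where "b i j = a i j - (if i = j then \<theta> else 0)" for i j
    have Bb: "B $$ (i, j) = b i j" if "i < n" "j < n" for i j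
      using A that by (auto simp: B_def char_matrix_def b_def a_def)
    have "det B \<noteq> 0" using eigenvalue_det[OF A, of \<theta>] not_ev by (simp add: B_def)
    then have "B \<in> Units (ring_mat TYPE(real) n ())" by (rule det_non_zero_imp_unit[OF Bc])
    then obtain D where D: "D \<in> carrier_mat n n" "D * B = 1\<^sub>m n"
      by (auto simp: Units_def ring_mat_def)
    have Dinv: "(\<Sum>k<n. D $$ (i, k) * (\<Sum>l<n. b k l * v l)) = v i" if "i < n" for i v
    proof -
      have "(\<Sum>k<n. D $$ (i, k) * (\<Sum>l<n. b k l * v l)) = (\<Sum>k<n. \<Sum>l<n. D $$ (i, k) * B $$ (k, l) * v l)"
        by (simp add: sum_distrib_left mult_ac Bb)
      also have "\<dots> = (\<Sum>l<n. (\<Sum>k<n. D $$ (i, k) * B $$ (k, l)) * v l)"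
        by (subst sum.swap) (simp add: sum_distrib_right)
      also have "\<dots> = (\<Sum>l<n. (D * B) $$ (i, l) * v l)"
        using that D(1) Bc by (intro sum.cong refl) (auto simp: scalar_prod_def atLeast0LessThan)
      also have "\<dots> = (\<Sum>l<n. (if l = i then v l else 0))"
        unfolding D(2) using that by (intro sum.cong) auto
      finally show ?thesis using that by simp
    qed
    define P where "P v = (\<Sum>k<n. v k * (\<Sum>l<n. b k l * v l))" for v
    have P_eq: "P v = Q v - \<theta> * S v" for v
    proof -
      have "(\<Sum>l<n. b k l * v l) = (\<Sum>l<n. a k l * v l) - \<theta> * v k" if "k < n" for k
      proof -
        have "(\<Sum>l<n. b k l * v l) = (\<Sum>l<n. a k l * v l) - (\<Sum>l<n. if l = k then \<theta> * v k else 0)"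
          unfolding b_def sum_subtractf[symmetric] by (intro sum.cong) (auto simp: algebra_simps)
        then show ?thesis using that by simp
      qed
      then have "P v = (\<Sum>k<n. v k * ((\<Sum>l<n. a k l * v l) - \<theta> * v k))"
        unfolding P_def by (intro sum.cong) auto
      then show ?thesis
        by (simp add: Q_def S_def quadratic_form_eq right_diff_distrib sum_subtractf sum_distrib_left 
            power2_eq_square mult_ac)
    qed
    have Pnn: "P v \<ge> 0" for v using lower[of v] by (simp add: P_eq)
    \<comment> \<open>One number dominating the row and column sums of A - \<theta> and of its
      inverse \<open>D\<close>.\<close>
    define N where "N = 1 + (\<Sum>k<n. \<Sum>l<n. \<bar>b k l\<bar>) + (\<Sum>k<n. \<Sum>l<n. \<bar>D $$ (k, l)\<bar>)"
    have N: "N \<ge> 1" by (simp add: N_def sum_nonneg)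
    have entries: "(\<Sum>l<n. \<bar>f k l\<bar>) \<le> (\<Sum>k<n. \<Sum>l<n. \<bar>f k l\<bar>)" "(\<Sum>l<n. \<bar>f l k\<bar>) \<le> (\<Sum>k<n. \<Sum>l<n. \<bar>f k l\<bar>)" 
      if "k < n" for f :: "nat \<Rightarrow> nat \<Rightarrow> real" and k
    proof -
      show "(\<Sum>l<n. \<bar>f k l\<bar>) \<le> (\<Sum>k<n. \<Sum>l<n. \<bar>f k l\<bar>)"
        using that by (intro member_le_sum[of k _ "\<lambda>k. \<Sum>l<n. \<bar>f k l\<bar>"] sum_nonneg) auto
      have "(\<Sum>l<n. \<bar>f l k\<bar>) \<le> (\<Sum>k<n. \<Sum>l<n. \<bar>f l k\<bar>)"
        using that by (intro member_le_sum[of k _ "\<lambda>k. \<Sum>l<n. \<bar>f l k\<bar>"] sum_nonneg) auto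
      then show "(\<Sum>l<n. \<bar>f l k\<bar>) \<le> (\<Sum>k<n. \<Sum>l<n. \<bar>f k l\<bar>)"
        by (subst sum.swap)
    qed
    have nn: "0 \<le> (\<Sum>k<n. \<Sum>l<n. \<bar>b k l\<bar>)" "0 \<le> (\<Sum>k<n. \<Sum>l<n. \<bar>D $$ (k, l)\<bar>)"
      by (simp_all add: sum_nonneg)
    have Nb: "(\<Sum>k<n. \<Sum>l<n. \<bar>b k l\<bar>) \<le> N" using nn by (simp add: N_def)
    have strict: "1 / N ^ 3 \<le> Q v - \<theta>" if "S v = 1" for v
    proof -
      define w where "w k = (\<Sum>l<n. b k l * v l)" for k
      define z where "z k = (\<Sum>l<n. b k l * w l)" for k
      have "L2_set v {..<n} = L2_set (\<lambda>i. \<Sum>k<n. D $$ (i, k) * w k) {..<n}"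
        by (intro L2_set_cong) (auto simp: w_def Dinv)
      also have "\<dots> \<le> N * L2_set w {..<n}"
        using entries[of _ "\<lambda>k l. D $$ (k, l)"] nn N
        by (intro schur_test) (auto simp: N_def intro: add_increasing add_nonneg_nonneg)
      finally have "1 \<le> N * L2_set w {..<n}" using that by (simp add: S_def L2_set_def)
      then have w1: "1 \<le> N\<^sup>2 * S w"
        using power_mono[of 1 "N * L2_set w {..<n}" 2] by (simp add: power_mult_distrib L2_set_power2 S_def)
      have "L2_set z {..<n} \<le> N * L2_set w {..<n}"
        unfolding z_def using N
        by (intro schur_test order_trans[OF entries(1)[of _ b] Nb] order_trans[OF entries(2)[of _ b] Nb]) auto
      then have zw: "(\<Sum>k<n. w k * z k) \<le> N * S w"
        using L2_set_inner_le[of w z "{..<n}"] 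
          mult_left_mono[of "L2_set z {..<n}" "N * L2_set w {..<n}" "L2_set w {..<n}"]
        by (simp add: S_def mult_ac flip: L2_set_power2 power2_eq_square)
      have symb: "b k l = b l k" if "k < n" "l < n" for k l
        using sym that by (simp add: b_def a_def)
      have vz: "(\<Sum>k<n. v k * z k) = S w"
      proof -
        have "(\<Sum>k<n. v k * z k) = (\<Sum>l<n. \<Sum>k<n. b k l * v k * w l)"
          unfolding z_def sum_distrib_left by (subst sum.swap) (simp add: mult_ac)
        also have "\<dots> = (\<Sum>l<n. w l * w l)"
          by (intro sum.cong refl) (auto simp: w_def[of l for l] sum_distrib_right symb intro!: sum.cong)
        finally show ?thesis by (simp add: S_def power2_eq_square)
      qed
      \<comment> \<open>Here w is (A - \<theta>) v. Nonnegativity of the form after a gradient step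
        of length 1/N bounds the squared norm of w by N times the form at v. Invertibility bounds
        that norm below by 1/N^2, hence the gap 1/N^3.\<close>
      have "0 \<le> P (\<lambda>k. v k - w k / N)" by (rule Pnn)
      also have "P (\<lambda>k. v k - w k / N) = (\<Sum>k<n. (v k - w k / N) * (w k - z k / N))"
      proof -
        have "(\<Sum>l<n. b k l * (v l - w l / N)) = w k - z k / N" for k
          by (simp add: w_def[of k] z_def[of k] right_diff_distrib sum_subtractf sum_divide_distrib)
        then show ?thesis by (simp add: P_def)
      qed
      also have "\<dots> = (\<Sum>k<n. v k * w k) - (\<Sum>k<n. v k * z k) / N - (\<Sum>k<n. w k * w k) / N + (\<Sum>k<n. w k * z k) / N\<^sup>2"
        by (simp add: sum.distrib sum_subtractf sum_divide_distrib algebra_simps power2_eq_square)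
      also have "\<dots> = P v - 2 * S w / N + (\<Sum>k<n. w k * z k) / N\<^sup>2"
        unfolding vz by (simp add: P_def w_def S_def power2_eq_square)
      also have "\<dots> \<le> P v - 2 * S w / N + N * S w / N\<^sup>2"
        using zw N by (intro add_left_mono divide_right_mono) auto
      also have "\<dots> = P v - S w / N"
        using N by (simp add: power2_eq_square)
      finally have "S w / N \<le> Q v - \<theta>" using that by (simp add: P_eq)
      moreover have "1 / N ^ 3 \<le> S w / N"
        using w1 N by (simp add: field_simps power2_eq_square power3_eq_cube)
      ultimately show ?thesis by linarith
    qed
    have "\<theta> + 1 / N ^ 3 \<le> Inf (Q ` {v. S v = 1})"
    proof (rule cInf_greatest[OF ne])
      fix y assume "y \<in> Q ` {v. S v = 1}"
      then obtain v where "S v = 1" "y = Q v" by auto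
      then show "\<theta> + 1 / N ^ 3 \<le> y" using strict[of v] by linarith
    qed
    then have "\<theta> + 1 / N ^ 3 \<le> \<theta>" by (simp only: \<theta>_def)
    then show False using N by simp
  qed
  then have "\<kappa> \<le> \<theta>" by (rule ev)
  then have "\<kappa> * S v \<le> Q v" for v
    using lower[of v] mult_right_mono[of \<kappa> \<theta> "S v"] Snn[of v] by linarith
  then show ?thesis unfolding coercive_def S_def Q_def a_def by simp
qed

lemma coercive_cov_if_spectrum_ge:
  assumes n: "n > 0" and min: "Min (spectrum (cov_matrix M x n)) \<ge> \<kappa>"
  shows "coercive \<kappa> {1..n} (\<lambda>k l. covariance M (x k) (x l))"
proof -
  let ?A = "cov_matrix M x n"
  have A: "?A \<in> carrier_mat n n" by (simp add: cov_matrix_def)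
  have "coercive \<kappa> {..<n} (\<lambda>i j. ?A $$ (i, j))"
  proof (rule coercive_if_spectrum_ge[OF A _ _ n])
    show "?A $$ (i, j) = ?A $$ (j, i)" if "i < n" "j < n" for i j
      using that by (simp add: cov_matrix_def covariance_def mult.commute)
    \<comment> \<open>\<open>Min\<close> bounds every eigenvalue from below because the spectrum of
      a matrix is finite.\<close>
    show "\<kappa> \<le> e" if "eigenvalue ?A e" for e
      using Min_le[OF card_finite_spectrum(1)[OF A], of e] that min by (simp add: spectrum_def)
  qed
  then have "coercive \<kappa> {1..n} (\<lambda>k l. ?A $$ (k - 1, l - 1))"
    by (rule coercive_reindex) (auto simp: inj_on_def)
  then show ?thesis
    by (rule coercive_cong) (auto simp: cov_matrix_def)
qed

text \<open>\<open>AR_coeff\<close> reads its value from \<open>the (mat_inverse ...)\<close>, which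
  is meaningful only for an invertible matrix. Coercivity leaves no nonzero kernel vector, so the
  determinant is nonzero and the inverse exists.\<close>

lemma yule_walker_AR_coeff:
  assumes pd: "coercive c {1..b} (toeplitz (\<gamma> t))" and c: "c > 0"
  shows "yule_walker b (\<gamma> t) (AR_coeff \<gamma> b t)"
proof -
  define A where "A = autocov_matrix \<gamma> b t"
  have A: "A \<in> carrier_mat b b" by (simp add: A_def autocov_matrix_def)
  have Aij: "A $$ (i, j) = toeplitz (\<gamma> t) (Suc i) (Suc j)" if "i < b" "j < b" for i j
    using that by (simp add: A_def autocov_matrix_def toeplitz_def)
  have "det A \<noteq> 0"
  proof
    assume "det A = 0"
    then obtain v where v: "v \<in> carrier_vec b" "v \<noteq> 0\<^sub>v b" "A *\<^sub>v v = 0\<^sub>v b"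
      using det_0_iff_vec_prod_zero_field[OF A] by blast
    define u where "u k = vec_index v (k - 1)" for k
    have row: "(\<Sum>l=1..b. toeplitz (\<gamma> t) k l * u l) = 0" if "k \<in> {1..b}" for k
    proof -
      have "(\<Sum>l=1..b. toeplitz (\<gamma> t) k l * u l) = (\<Sum>j<b. toeplitz (\<gamma> t) k (Suc j) * u (Suc j))"
        by (rule sum.reindex_bij_witness[of _ Suc "\<lambda>l. l - 1"]) auto
      also have "\<dots> = vec_index (A *\<^sub>v v) (k - 1)"
        using that A v(1) by (auto simp: scalar_prod_def Aij u_def atLeast0LessThan intro!: sum.cong)
      also have "\<dots> = 0" unfolding v(3) using that by (intro index_zero_vec) auto
      finally show ?thesis .
    qed
    have "c * L2_set u {1..b} \<le> L2_set (\<lambda>k. \<Sum>l=1..b. toeplitz (\<gamma> t) k l * u l) {1..b}"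
      by (rule coercive_L2_le[OF pd])
    also have "\<dots> = 0" using row by (subst L2_set_eq_0_iff) auto
    finally have "L2_set u {1..b} = 0"
      using c L2_set_nonneg[of u "{1..b}"] by (simp add: mult_le_0_iff antisym)
    then have "u k = 0" if "k \<in> {1..b}" for k using that by (subst (asm) L2_set_eq_0_iff) auto
    then have "vec_index v i = 0" if "i < b" for i using that by (auto simp: u_def dest: meta_spec[of _ "Suc i"])
    then have "v = 0\<^sub>v b" using v(1) by (intro eq_vecI) auto
    with v(2) show False by simp
  qed
  then have "A \<in> Units (ring_mat TYPE(real) b ())" by (rule det_non_zero_imp_unit[OF A])
  then obtain B where B: "mat_inverse A = Some B" using mat_inverse(1)[OF A, where b = "()"] by (cases "mat_inverse A") auto
  then have AB: "A * B = 1\<^sub>m b" and Bc: "B \<in> carrier_mat b b" using mat_inverse(2)[OF A] by auto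
  define g where "g = autocov_vector \<gamma> b t"
  have g: "g \<in> carrier_vec b" by (simp add: g_def autocov_vector_def)
  define p where "p = B *\<^sub>v g"
  have p: "p \<in> carrier_vec b" using Bc g by (simp add: p_def)
  have Ap: "A *\<^sub>v p = g" unfolding p_def
    by (subst assoc_mult_mat_vec[OF A Bc g, symmetric]) (simp add: AB g)
  show ?thesis unfolding yule_walker_def
  proof
    fix k assume k: "k \<in> {1..b}"
    have "(\<Sum>l=1..b. toeplitz (\<gamma> t) k l * AR_coeff \<gamma> b t l) = (\<Sum>j<b. toeplitz (\<gamma> t) k (Suc j) * vec_index p j)"
      by (rule sum.reindex_bij_witness[of _ Suc "\<lambda>l. l - 1"])
        (auto simp: AR_coeff_def B p_def g_def simp flip: A_def)
    also have "\<dots> = vec_index (A *\<^sub>v p) (k - 1)"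
      using k A p by (auto simp: scalar_prod_def Aij atLeast0LessThan intro!: sum.cong)
    also have "\<dots> = \<gamma> t k" using k by (auto simp: Ap g_def autocov_vector_def)
    finally show "(\<Sum>l=1..b. toeplitz (\<gamma> t) k l * AR_coeff \<gamma> b t l) = \<gamma> t k" .
  qed
qed

section \<open>Asymptotics and interpolation\<close>

text \<open>\<open>D\<close> and the threshold are obtained before \<rho>, m and b, so the bound is
  uniform over all systems with the same c, C and \<tau>. It results from the banded estimate with k
  of order ln b and \<open>w = b div k\<close>.\<close>

lemma yule_walker_tail:
  assumes c: "c > 0" and \<tau>: "\<tau> > 1"
  obtains D b\<^sub>0 where "D \<ge> 0"
    and "\<And>\<rho> m \<alpha> b. srd_toeplitz \<rho> m c C \<tau> \<Longrightarrow> yule_walker m \<rho> \<alpha> \<Longrightarrow> b\<^sub>0 \<le> real b \<Longrightarrow>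
      L2_set \<alpha> {b<..m} \<le> D * (ln (real b) powr (\<tau> - 1) * real b powr (1 - \<tau>))"
proof (cases "C \<ge> 0")
  case True
  define q where "q = srd_rate c C \<tau>"
  define B where "B = srd_bound c C \<tau>"
  have "(c / 2)\<^sup>2 \<le> B\<^sup>2" "0 < (c / 2)\<^sup>2 / B\<^sup>2" "B > 0"
  proof -
    have "c \<le> B" using True c \<tau> by (simp add: B_def srd_bound_def)
    then show "B > 0" using c by simp
    then show "0 < (c / 2)\<^sup>2 / B\<^sup>2" using c by simp
    show "(c / 2)\<^sup>2 \<le> B\<^sup>2" using \<open>c \<le> B\<close> c by (intro power_mono) auto
  qed
  then have q: "0 \<le> q" "q < 1" by (auto simp: q_def srd_rate_def B_def)
  \<comment> \<open>With k at least A ln b, q^k is at most exp(-(1 - q) k), hence at most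
    b^(1-\<tau>).\<close>
  define A where "A = (\<tau> - 1) / (1 - q)"
  have A: "A > 0" using \<tau> q by (simp add: A_def)
  \<comment> \<open>The extra 1 absorbs the rounding up of A ln b, since ln b is at least 1.\<close>
  define A' where "A' = A + 1"
  define E where "E = C * (2 * A') powr (\<tau> - 1) / (\<tau> - 1)"
  have E: "E \<ge> 0" using True \<tau> by (simp add: E_def)
  define R where "R y = ln y powr (\<tau> - 1) * y powr (1 - \<tau>)" for y :: real
  have "\<forall>\<^sub>F y in at_top. ln y \<ge> (1::real)" by real_asymp
  moreover have "\<forall>\<^sub>F y in at_top. y \<ge> 2 * A' * ln y" by real_asymp
  moreover have "((\<lambda>y. 2 * E * R y) \<longlongrightarrow> 0) at_top"
    unfolding R_def using \<tau> by real_asymp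
  then have "\<forall>\<^sub>F y in at_top. 2 * E * R y < c / 2"
    by (rule order_tendstoD) (use c in simp)
  moreover have "\<forall>\<^sub>F y in at_top. y \<ge> (1::real)" by real_asymp
  \<comment> \<open>The second condition gives 2 k \<le> b and hence \<open>w \<ge> 1\<close>; the
    third makes the truncation small enough to keep half of the coercivity.\<close>
  ultimately have "\<forall>\<^sub>F y in at_top. ln y \<ge> 1 \<and> y \<ge> 2 * A' * ln y \<and> 2 * E * R y < c / 2 \<and> y \<ge> 1"
    by eventually_elim auto
  then obtain b\<^sub>0 where b\<^sub>0: "\<And>y. y \<ge> b\<^sub>0 \<Longrightarrow> ln y \<ge> 1 \<and> y \<ge> 2 * A' * ln y \<and> 2 * E * R y < c / 2 \<and> y \<ge> 1"
    unfolding eventually_at_top_linorder by blast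
  define D where "D = (E + B + 2 * E * (4 * B / c)) / c"
  show ?thesis
  proof
    show "D \<ge> 0" using E \<open>B > 0\<close> c by (simp add: D_def)
    fix \<rho> m \<alpha> b assume "srd_toeplitz \<rho> m c C \<tau>" and yw: "yule_walker m \<rho> \<alpha>" and "b\<^sub>0 \<le> real b"
    interpret srd_toeplitz \<rho> m c C \<tau> by fact
    note b = b\<^sub>0[OF \<open>b\<^sub>0 \<le> real b\<close>]
    define k where "k = nat \<lceil>A * ln b\<rceil>"
    define w where "w = b div k"
    have lnpos: "ln b > 0" and bpos: "real b > 0" and A'pos: "A' > 0" using b A by (auto simp: A'_def simp del: ln_gt_zero_iff)
    have Aln: "A * ln b > 0" by (rule mult_pos_pos[OF A lnpos])
    have k1: "k \<ge> 1" using Aln by (simp add: k_def nat_le_iff Suc_le_eq)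
    have k_ge: "A * ln b \<le> real k" unfolding k_def by (rule real_nat_ceiling_ge)
    have "real k \<le> A * ln b + 1" using Aln unfolding k_def by linarith
    then have k_le: "real k \<le> A' * ln b" using b by (simp add: A'_def algebra_simps)
    then have kb: "2 * real k \<le> real b" using b by (simp add: mult.assoc)
    have "real b / real k - 1 \<le> real w"
    proof -
      have "real_of_int \<lfloor>real b / real k\<rfloor> = real w"
        by (simp add: w_def floor_divide_of_nat_eq)
      then show ?thesis by linarith
    qed
    moreover have "1 \<le> real b / (2 * real k)" using kb k1 by (simp add: field_simps)
    moreover have "real b / real k = 2 * (real b / (2 * real k))" using k1 by simp
    ultimately have w_ge: "real b / (2 * real k) \<le> real w" by linarith
    then have w1: "w \<ge> 1" using \<open>1 \<le> real b / (2 * real k)\<close> by linarith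
    have "real b / (2 * (A' * ln b)) \<le> real b / (2 * real k)"
      using k1 k_le by (intro frac_le) auto
    then have w_ge': "real b / (2 * A' * ln b) \<le> real w" using w_ge by (simp add: mult.assoc)
    have pos: "0 < real b / (2 * A' * ln b)" by (intro divide_pos_pos mult_pos_pos bpos A'pos lnpos) simp
    have "real w powr (1 - \<tau>) \<le> (real b / (2 * A' * ln b)) powr (1 - \<tau>)"
      using w_ge' pos \<tau> by (intro powr_mono2') auto
    also have "\<dots> = (2 * A') powr (\<tau> - 1) * R b"
    proof -
      have inv: "y powr (1 - \<tau>) = inverse (y powr (\<tau> - 1))" for y :: real
        by (metis minus_diff_eq powr_minus)
      have "(real b / (2 * A' * ln b)) powr (1 - \<tau>) = real b powr (1 - \<tau>) / ((2 * A') powr (1 - \<tau>) * ln b powr (1 - \<tau>))"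
        using lnpos bpos A'pos by (simp add: powr_divide powr_mult)
      also have "\<dots> = real b powr (1 - \<tau>) / (inverse ((2 * A') powr (\<tau> - 1)) * inverse (ln b powr (\<tau> - 1)))"
        unfolding inv[of "2 * A'"] inv[of "ln b"] ..
      also have "\<dots> = (2 * A') powr (\<tau> - 1) * (ln b powr (\<tau> - 1) * real b powr (1 - \<tau>))"
        by (simp only: divide_inverse inverse_mult_distrib inverse_inverse_eq mult_ac)
      finally show ?thesis by (simp only: R_def)
    qed
    finally have "C * real w powr (1 - \<tau>) / (\<tau> - 1) \<le> C * ((2 * A') powr (\<tau> - 1) * R b) / (\<tau> - 1)"
      using C \<tau> by (intro divide_right_mono mult_left_mono) auto
    then have tw: "tail w \<le> E * R b" by (simp add: tail_def E_def)
    then have w2: "2 * tail w \<le> c / 2" using b by linarith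
    have "q ^ k \<le> exp (- (1 - q)) ^ k"
      using q exp_ge_add_one_self[of "- (1 - q)"] by (intro power_mono) auto
    also have "\<dots> = exp (- ((1 - q) * k))" by (simp add: exp_of_nat_mult[symmetric] algebra_simps)
    also have "\<dots> \<le> exp (- ((1 - q) * (A * ln b)))"
      using k_ge q by (auto intro!: mult_left_mono)
    also have "(1 - q) * (A * ln b) = (\<tau> - 1) * ln b" using q by (simp add: A_def)
    also have "exp (- ((\<tau> - 1) * ln b)) = real b powr (1 - \<tau>)"
      using b by (simp add: powr_def algebra_simps)
    also have "\<dots> \<le> R b"
      using b \<tau> ge_one_powr_ge_zero[of "ln b" "\<tau> - 1"] mult_right_mono[of 1 "ln b powr (\<tau> - 1)" "b powr (1 - \<tau>)"]
      by (simp add: R_def)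
    finally have qk: "q ^ k \<le> R b" .
    have "L2_set \<alpha> {b<..m} \<le> (tail w + rate ^ k * bound + 2 * tail w * (4 * bound / c)) / c"
      by (rule yule_walker_tail_banded[OF w1 w2 yw]) (simp add: w_def)
    also have "\<dots> \<le> (E * R b + R b * B + 2 * (E * R b) * (4 * B / c)) / c"
      using tw qk \<open>B > 0\<close> c unfolding q_def[symmetric] B_def[symmetric]
      by (intro divide_right_mono add_mono mult_right_mono mult_left_mono) auto
    also have "\<dots> = D * R b" by (simp add: D_def algebra_simps add_divide_distrib)
    finally show "L2_set \<alpha> {b<..m} \<le> D * (ln (real b) powr (\<tau> - 1) * real b powr (1 - \<tau>))"
      by (simp add: R_def)
  qed
next
  case False
  \<comment> \<open>For negative \<open>C\<close> no sequence satisfies the locale assumptions, so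
    the claim is vacuous.\<close>
  show ?thesis
  proof (rule that[of 0])
    fix \<rho> m \<alpha> b assume "srd_toeplitz \<rho> m c C \<tau>"
    then show "L2_set \<alpha> {b<..m} \<le> 0 * (ln (real b) powr (\<tau> - 1) * real b powr (1 - \<tau>))"
      using srd_toeplitz.C False by blast
  qed simp
qed

text \<open>The lower half of the \<Theta> relation forces b to infinity. Raising the upper half to
  the power \<tau> + 1 gives b^(\<tau>+1) = O(n (ln b)^(\<tau>+1)), so b^2 / n = O((ln b)^(\<tau>+1)
  b^(1-\<tau>)), which vanishes because \<tau> > 1.\<close>

lemma bandwidth_asymptotics:
  fixes b :: "nat \<Rightarrow> nat"
  assumes \<tau>: "\<tau> > 1" 
    and b: "(\<lambda>n. real (b n) / ln (real (b n))) \<in> \<Theta>(\<lambda>n. real n powr (1 / (\<tau> + 1)))"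
  shows "filterlim (\<lambda>n. real (b n)) at_top sequentially"
    and "(\<lambda>n. (real (b n))\<^sup>2 / real n) \<longlonglongrightarrow> 0"
proof -
  define p where "p = 1 / (\<tau> + 1)"
  have p: "p > 0" using \<tau> by (simp add: p_def)
  from b obtain c1 where c1: "c1 > 0" 
      "\<forall>\<^sub>F n in sequentially. norm (real (b n) / ln (real (b n))) \<ge> c1 * norm (real n powr p)"
    unfolding bigtheta_def p_def by (auto elim!: landau_omega.bigE)
  from b obtain c2 where c2: "c2 > 0" 
      "\<forall>\<^sub>F n in sequentially. norm (real (b n) / ln (real (b n))) \<le> c2 * norm (real n powr p)"
    unfolding bigtheta_def p_def by (auto elim!: landau_o.bigE)
  have low: "\<forall>\<^sub>F n in sequentially. c1 * ln 2 * real n powr p \<le> real (b n)"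
    using c1(2) eventually_gt_at_top[of 0]
  proof eventually_elim
    case (elim n)
    have n: "c1 * real n powr p > 0" using c1 elim by simp
    \<comment> \<open>Both values would make the quotient 0: for b = 1 the denominator
      \<open>ln 1\<close> is 0, and division by zero yields 0.\<close>
    have "b n \<noteq> 0" "b n \<noteq> 1"
    proof -
      show "b n \<noteq> 0"
      proof
        assume "b n = 0"
        with elim(1) n show False by simp
      qed
      show "b n \<noteq> 1"
      proof
        assume "b n = 1"
        with elim(1) n show False by simp
      qed
    qed
    then have b2: "real (b n) \<ge> 2" by linarith
    then have "ln 2 \<le> ln (real (b n))" by simp
    then have "real (b n) / ln (real (b n)) \<le> real (b n) / ln 2"
      using b2 by (intro divide_left_mono mult_pos_pos) auto
    then have "c1 * real n powr p \<le> real (b n) / ln 2" using elim b2 by simp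
    then show ?case by (simp add: field_simps)
  qed
  have "filterlim (\<lambda>n. c1 * ln 2 * real n powr p) at_top sequentially"
    using c1(1) p by real_asymp
  then show top: "filterlim (\<lambda>n. real (b n)) at_top sequentially"
    by (rule filterlim_at_top_mono) (rule low)
  define K where "K = c2 powr (\<tau> + 1)"
  have up: "\<forall>\<^sub>F n in sequentially. (real (b n))\<^sup>2 / real n \<le> K * (ln (real (b n)) powr (\<tau> + 1) * real (b n) powr (1 - \<tau>))"
    using c2(2) eventually_gt_at_top[of 0] filterlim_at_top_dense[THEN iffD1, OF top, rule_format, of 2]
  proof eventually_elim
    case (elim n)
    then have pos: "ln (real (b n)) > 0" "real (b n) > 0" by auto
    have "(real (b n) / ln (real (b n))) powr (\<tau> + 1) \<le> (c2 * real n powr p) powr (\<tau> + 1)"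
      using elim \<tau> pos by (intro powr_mono2) auto
    also have "\<dots> = K * real n" using \<tau> c2(1) elim by (simp add: powr_mult powr_powr p_def K_def)
    finally have "real (b n) powr (\<tau> + 1) \<le> K * ln (real (b n)) powr (\<tau> + 1) * real n"
      using pos by (simp add: powr_divide field_simps)
    then have "real (b n) powr (1 - \<tau>) * real (b n) powr (\<tau> + 1) 
        \<le> real (b n) powr (1 - \<tau>) * (K * ln (real (b n)) powr (\<tau> + 1) * real n)"
      by (intro mult_left_mono) auto
    moreover have "real (b n) powr (1 - \<tau>) * real (b n) powr (\<tau> + 1) = (real (b n))\<^sup>2"
      using pos by (simp flip: powr_add)
    ultimately show ?case using elim by (simp add: divide_le_eq mult_ac)
  qed
  have "((\<lambda>y. K * (ln y powr (\<tau> + 1) * y powr (1 - \<tau>))) \<longlongrightarrow> 0) at_top"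
    using \<tau> by real_asymp
  from filterlim_compose[OF this top] 
  have "(\<lambda>n. K * (ln (real (b n)) powr (\<tau> + 1) * real (b n) powr (1 - \<tau>))) \<longlonglongrightarrow> 0" .
  then show "(\<lambda>n. (real (b n))\<^sup>2 / real n) \<longlonglongrightarrow> 0"
    by (rule tendsto_sandwich[OF _ up tendsto_const, rotated]) simp
qed

text \<open>Only finitely many lags occur for each \<open>n\<close>, so smoothness of \<open>\<rho>\<close> comes for free.\<close>
lemma smooth_interpolation:
  fixes y :: "nat \<Rightarrow> real"
  obtains f where "smooth f" "\<And>j. j < N \<Longrightarrow> f (real j) = y j"
proof -
  have "\<exists>p :: real poly. \<forall>j<N. poly p (real j) = y j"
  proof (induction N)
    case (Suc N)
    then obtain p where p: "\<And>j. j < N \<Longrightarrow> poly p (real j) = y j" by blast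
    \<comment> \<open>Newton interpolation: \<open>r\<close> vanishes at all earlier nodes, so
      adding a multiple of it corrects only the value at N.\<close>
    define r where "r = (\<Prod>i<N. [:- real i, 1:])"
    have r: "poly r (real j) = (\<Prod>i<N. real j - real i)" for j
      by (simp add: r_def poly_prod)
    have rN: "poly r (real N) \<noteq> 0" by (simp add: r)
    have r0: "poly r (real j) = 0" if "j < N" for j using that by (auto simp: r)
    define p' where "p' = p + Polynomial.smult ((y N - poly p (real N)) / poly r (real N)) r"
    have "poly p' (real j) = y j" if "j < Suc N" for j
      using that p r0 rN by (cases "j = N") (auto simp: p'_def)
    then show ?case by blast
  qed simp
  then obtain p :: "real poly" where p: "\<And>j. j < N \<Longrightarrow> poly p (real j) = y j" by blast
  have "smooth (poly p)"
    unfolding smooth_def C_on_def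
  proof (rule allI, rule exI[of _ "\<lambda>m. poly ((pderiv ^^ m) p)"], intro conjI)
    fix d :: nat
    show "\<forall>t\<in>UNIV. poly ((pderiv ^^ 0) p) t = poly p t" by simp
    show "\<forall>m<d. \<forall>t\<in>UNIV. (poly ((pderiv ^^ m) p) has_real_derivative poly ((pderiv ^^ Suc m) p) t) (at t within UNIV)"
      by (simp add: poly_DERIV)
    show "continuous_on UNIV (poly ((pderiv ^^ d) p))" by (intro continuous_intros)
  qed
  then show ?thesis using p that by blast
qed

section \<open>One row of the array\<close>

text \<open>Transfers a Lipschitz bound for variances to standard deviations.\<close>

lemma abs_diff_mult_sum_le:
  fixes s t :: real
  assumes "0 \<le> s" "0 \<le> t"
  shows "s * \<bar>s - t\<bar> \<le> \<bar>s\<^sup>2 - t\<^sup>2\<bar>"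
proof -
  have "\<bar>s\<^sup>2 - t\<^sup>2\<bar> = (s + t) * \<bar>s - t\<bar>"
    using assms by (simp add: power2_eq_square square_diff_square_factored abs_mult)
  then show ?thesis using assms by (simp add: mult_right_mono)
qed

text \<open>
  The covariance matrix \<open>K\<close> of one row of the array; \<open>\<gamma> i\<close> is the autocovariance function frozen
  at time \<open>i / n\<close>.
\<close>
locale covariance_row =
  fixes n b :: nat and K \<gamma> :: "nat \<Rightarrow> nat \<Rightarrow> real" and \<kappa> C \<tau> :: real
  assumes \<kappa>: "\<kappa> > 0" and \<tau>: "\<tau> > 1" and b: "1 \<le> b" "2 * b < n" 
    and small: "2 * C * (real b + 1)\<^sup>2 / real n \<le> \<kappa> / 2"
    and coerc: "coercive \<kappa> {1..n} K"
    and sym: "\<And>k l. K k l = K l k"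
    and diag: "\<And>k. k \<in> {1..n} \<Longrightarrow> K k k \<le> C"
    and srd: "\<And>k l. k \<in> {1..n} \<Longrightarrow> l \<in> {1..n} \<Longrightarrow> k \<noteq> l \<Longrightarrow> \<bar>K k l\<bar> \<le> C * \<bar>real k - real l\<bar> powr (-\<tau>)"
    and approx: "\<And>i k l. i \<in> {1..n} \<Longrightarrow> k \<in> {1..n} \<Longrightarrow> l \<in> {1..n} \<Longrightarrow>
      \<bar>K k l - toeplitz (\<gamma> i) k l\<bar> \<le> C * ((\<bar>real k - real i\<bar> + \<bar>real l - real i\<bar>) / real n)"
begin

definition "sd k = sqrt (K k k)"

lemma n: "n > 0" using b by simp

lemma diag_ge: "k \<in> {1..n} \<Longrightarrow> \<kappa> \<le> K k k"
  using coercive_diag[OF coerc] by simp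

lemma C: "\<kappa> \<le> C" "C > 0"
  using diag_ge[of 1] diag[of 1] n \<kappa> by auto

lemma sd: 
  assumes "k \<in> {1..n}" 
  shows "sd k > 0" "(sd k)\<^sup>2 = K k k" "\<kappa> \<le> (sd k)\<^sup>2" "(sd k)\<^sup>2 \<le> C"
  using diag_ge[OF assms] diag[OF assms] \<kappa> by (auto simp: sd_def)

lemma diag_eq: "i \<in> {1..n} \<Longrightarrow> \<gamma> i 0 = K i i"
  using approx[of i i i] by simp

text \<open>Freeze time at k: the approximation compares \<open>K l l\<close> with
  \<open>\<gamma> k 0\<close>, which is exactly \<open>K k k\<close>.\<close>

lemma var_diff:
  assumes "k \<in> {1..n}" "l \<in> {1..n}"
  shows "\<bar>(sd k)\<^sup>2 - (sd l)\<^sup>2\<bar> \<le> 2 * C * (\<bar>real k - real l\<bar> / real n)"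
  using approx[of k l l] diag_eq[of k] assms by (simp add: sd(2) abs_minus_commute mult_ac)

lemma sd_ratio:
  assumes "k \<in> {1..n}" "l \<in> {1..n}"
  shows "\<bar>sd k / sd l - 1\<bar> \<le> 2 * C / \<kappa> * (\<bar>real k - real l\<bar> / real n)"
proof -
  note k = sd[OF assms(1)] and l = sd[OF assms(2)]
  have "\<bar>sd k / sd l - 1\<bar> = sd l * \<bar>sd l - sd k\<bar> / (sd l)\<^sup>2"
  proof -
    have "sd k / sd l - 1 = (sd k - sd l) / sd l" using l by (simp add: diff_divide_distrib)
    then have "\<bar>sd k / sd l - 1\<bar> = \<bar>sd l - sd k\<bar> / sd l" using l by (simp add: abs_minus_commute)
    then show ?thesis using l(1) by (simp add: power2_eq_square)
  qed
  also have "\<dots> \<le> \<bar>(sd l)\<^sup>2 - (sd k)\<^sup>2\<bar> / (sd l)\<^sup>2"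
    using k(1) l(1) by (intro divide_right_mono abs_diff_mult_sum_le) auto
  also have "\<dots> \<le> \<bar>(sd l)\<^sup>2 - (sd k)\<^sup>2\<bar> / \<kappa>"
    using l \<kappa> by (intro divide_left_mono) auto
  also have "\<dots> \<le> 2 * C * (\<bar>real l - real k\<bar> / real n) / \<kappa>"
    using \<kappa> by (intro divide_right_mono var_diff assms) auto
  finally show ?thesis by (simp add: abs_minus_commute mult_ac)
qed

definition "corr k l = K k l / (sd k * sd l)"

lemma corr_le:
  assumes "k \<in> {1..n}" "l \<in> {1..n}" "k \<noteq> l"
  shows "\<bar>corr k l\<bar> \<le> C / \<kappa> * \<bar>real k - real l\<bar> powr (-\<tau>)"
proof -
  note k = sd[OF assms(1)] and l = sd[OF assms(2)]
  have "sqrt \<kappa> * sqrt \<kappa> \<le> sd k * sd l"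
    using diag_ge[OF assms(1)] diag_ge[OF assms(2)] \<kappa> unfolding sd_def
    by (intro mult_mono real_sqrt_le_mono) auto
  then have "\<kappa> \<le> sd k * sd l" using \<kappa> by simp
  then have "\<bar>K k l\<bar> / (sd k * sd l) \<le> C * \<bar>real k - real l\<bar> powr (-\<tau>) / \<kappa>"
    using \<kappa> srd[OF assms] C by (intro frac_le) auto
  then show ?thesis using k l by (simp add: corr_def abs_mult)
qed

lemma corr_le_const:
  assumes "k \<in> {1..n}" "l \<in> {1..n}"
  shows "\<bar>corr k l\<bar> \<le> C / \<kappa>"
proof (cases "k = l")
  case True
  moreover have "corr k k = (sd k)\<^sup>2 / (sd k * sd k)" unfolding corr_def sd(2)[OF assms(1)] ..
  ultimately have "corr k l = 1" using sd(1)[OF assms(1)] by (simp add: power2_eq_square)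
  then show ?thesis using C \<kappa> by simp
next
  case False
  then have "\<bar>real k - real l\<bar> \<ge> 1" by linarith
  then have "\<bar>real k - real l\<bar> powr (-\<tau>) \<le> \<bar>real k - real l\<bar> powr 0"
    using \<tau> by (intro powr_mono) auto
  also have "\<dots> = 1" using False by simp
  finally have "C / \<kappa> * \<bar>real k - real l\<bar> powr (-\<tau>) \<le> C / \<kappa> * 1"
    using C \<kappa> by (intro mult_left_mono) auto
  then show ?thesis using corr_le[OF assms False] by simp
qed

lemma window:
  assumes i: "i \<in> {1..n}" and m: "m \<le> b + 1"
  shows "coercive (\<kappa> / 2) {1..m} (toeplitz (\<gamma> i))"
proof -
  \<comment> \<open>The block starts at time i unless it would leave {1..n}; then it is pushed back
    to end at n and still contains i.\<close>
  define s where "s = min (i - 1) (n - m)"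
  have mn: "m \<le> n" using m b by simp
  have in_range: "k + s \<in> {1..n}" "\<bar>real (k + s) - real i\<bar> \<le> real m" if "k \<in> {1..m}" for k
    using that i mn by (auto simp: s_def min_def not_le split: if_splits)
  have "coercive \<kappa> {1..m} (\<lambda>k l. K (k + s) (l + s))"
    using in_range by (intro coercive_reindex[OF coerc]) auto
  moreover have "\<bar>K (k + s) (l + s) - toeplitz (\<gamma> i) k l\<bar> \<le> 2 * C * real m / real n" 
    if "k \<in> {1..m}" "l \<in> {1..m}" for k l
  proof -
    have "\<bar>K (k + s) (l + s) - toeplitz (\<gamma> i) (k + s) (l + s)\<bar> \<le> C * ((\<bar>real (k + s) - real i\<bar> + \<bar>real (l + s) - real i\<bar>) / real n)"
      by (intro approx i in_range that)
    also have "\<dots> \<le> C * ((real m + real m) / real n)"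
      using C by (intro mult_left_mono divide_right_mono add_mono in_range that) auto
    finally show ?thesis by (simp add: toeplitz_shift mult_ac)
  qed
  ultimately have pert: "coercive (\<kappa> - real (card {1..m}) * (2 * C * real m / real n)) {1..m} (toeplitz (\<gamma> i))"
    using C by (intro coercive_perturb_const[of \<kappa> _ "\<lambda>k l. K (k + s) (l + s)"]) auto
  have "real (card {1..m}) * (2 * C * real m / real n) \<le> \<kappa> / 2"
  proof -
    have "real (card {1..m}) * (2 * C * real m / real n) = 2 * C * (real m)\<^sup>2 / real n"
      by (simp add: power2_eq_square)
    also have "\<dots> \<le> 2 * C * (real b + 1)\<^sup>2 / real n"
      using C m by (intro divide_right_mono mult_left_mono power_mono) auto
    finally show ?thesis using small by linarith
  qed
  then show ?thesis by (intro coercive_le[OF pert]) linarith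
qed

text \<open>Every lag up to b is realised from i, forwards or backwards, because 2 b < n. The local
  autocovariance can thus be compared with actual correlations at both ends of the sample.\<close>

lemma partner:
  assumes "i \<in> {1..n}" "k \<le> b"
  obtains l where "l \<in> {1..n}" "\<bar>int l - int i\<bar> = int k"
proof (cases "i + k \<le> n")
  case True
  then show ?thesis using assms that[of "i + k"] by auto
next
  case False
  then have "k < i" using assms b by linarith
  then show ?thesis using assms by (intro that[of "i - k"]) (auto simp: of_nat_diff)
qed

lemma corr_approx:
  assumes i: "i \<in> {1..n}" and l: "l \<in> {1..n}"
  shows "\<bar>\<gamma> i (nat \<bar>int i - int l\<bar>) / (sd i)\<^sup>2 - corr i l\<bar> 
    \<le> (C / \<kappa> + 2 * C\<^sup>2 / \<kappa>\<^sup>2) * (\<bar>real i - real l\<bar> / real n)"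
proof -
  define g where "g = \<gamma> i (nat \<bar>int i - int l\<bar>)"
  define r where "r = \<bar>real i - real l\<bar> / real n"
  note si = sd[OF i] and sl = sd[OF l]
  have 1: "\<bar>K i l - g\<bar> \<le> C * r"
    using approx[OF i i l] by (simp add: g_def r_def toeplitz_def abs_minus_commute)
  have "\<bar>g / (sd i)\<^sup>2 - K i l / (sd i)\<^sup>2\<bar> = \<bar>K i l - g\<bar> / (sd i)\<^sup>2"
    by (simp add: diff_divide_distrib[symmetric] abs_minus_commute)
  also have "\<dots> \<le> C * r / \<kappa>"
    using 1 si \<kappa> C by (intro frac_le) (auto simp: r_def)
  finally have 2: "\<bar>g / (sd i)\<^sup>2 - K i l / (sd i)\<^sup>2\<bar> \<le> C / \<kappa> * r" by simp
  have "K i l / (sd i)\<^sup>2 - corr i l = corr i l * (sd l / sd i - 1)"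
    using si(1) sl(1) by (simp add: corr_def field_simps power2_eq_square)
  then have "\<bar>K i l / (sd i)\<^sup>2 - corr i l\<bar> = \<bar>corr i l\<bar> * \<bar>sd l / sd i - 1\<bar>" by (simp add: abs_mult)
  also have "\<dots> \<le> C / \<kappa> * (2 * C / \<kappa> * r)"
    using sd_ratio[OF l i] corr_le_const[OF i l] C \<kappa>
    by (intro mult_mono) (auto simp: r_def abs_minus_commute)
  finally have 3: "\<bar>K i l / (sd i)\<^sup>2 - corr i l\<bar> \<le> 2 * C\<^sup>2 / \<kappa>\<^sup>2 * r" by (simp add: power2_eq_square mult_ac)
  have "\<bar>g / (sd i)\<^sup>2 - corr i l\<bar> \<le> C / \<kappa> * r + 2 * C\<^sup>2 / \<kappa>\<^sup>2 * r" using 2 3 by linarith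
  also have "\<dots> = (C / \<kappa> + 2 * C\<^sup>2 / \<kappa>\<^sup>2) * r" by (rule distrib_right[symmetric])
  finally show ?thesis by (simp only: g_def r_def)
qed

text \<open>
  By uniqueness in the Yule--Walker equations, a constant coefficient vector freezes the local
  correlation function up to lag \<open>b\<close>; at larger lags all correlations are negligible.
\<close>
lemma constant_coefficients_corr:
  assumes yw: "\<And>i. i \<in> {1..n} \<Longrightarrow> yule_walker b (\<gamma> i) \<phi>"
    and ik: "1 \<le> i" "i + k \<le> n"
  shows "\<bar>corr i (i + k) - (if k \<le> b then \<gamma> 1 k / \<gamma> 1 0 else 0)\<bar>
    \<le> (C / \<kappa> + 2 * C\<^sup>2 / \<kappa>\<^sup>2) * (real b / real n) + C / \<kappa> * real b powr (-\<tau>)"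
proof (cases "k \<le> b")
  case True
  have i: "i \<in> {1..n}" "i + k \<in> {1..n}" and one: "1 \<in> {1..n}" using ik n by auto
  \<comment> \<open>The window {1..b+1} moved down by one; a Toeplitz form does not notice the
    shift.\<close>
  have pd: "coercive (\<kappa> / 2) {0..b} (toeplitz (\<gamma> i))" if "i \<in> {1..n}" for i
    using coercive_reindex[OF window[OF that order_refl], of Suc "{0..b}"]
    by (simp add: toeplitz_shift[of _ _ 1, simplified])
  have "\<gamma> i k * \<gamma> 1 0 = \<gamma> 1 k * \<gamma> i 0"
    using \<kappa> by (intro yule_walker_determines_correlation[OF pd[OF i(1)] pd[OF one] _ _ yw[OF i(1)] yw[OF one] True]) auto
  moreover have "\<gamma> i 0 > 0" "\<gamma> 1 0 > 0" using diag_eq diag_ge i(1) one \<kappa> by fastforce+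
  ultimately have "\<gamma> 1 k / \<gamma> 1 0 = \<gamma> i k / \<gamma> i 0"
    by (simp add: frac_eq_eq)
  then have "\<gamma> 1 k / \<gamma> 1 0 = \<gamma> i k / (sd i)\<^sup>2"
    using diag_eq[OF i(1)] sd(2)[OF i(1)] by simp
  then have "\<bar>corr i (i + k) - \<gamma> 1 k / \<gamma> 1 0\<bar> \<le> (C / \<kappa> + 2 * C\<^sup>2 / \<kappa>\<^sup>2) * (real k / real n)"
    using corr_approx[OF i] by (simp add: abs_minus_commute)
  also have "\<dots> \<le> (C / \<kappa> + 2 * C\<^sup>2 / \<kappa>\<^sup>2) * (real b / real n)"
    using C \<kappa> True by (intro mult_left_mono divide_right_mono) auto
  finally show ?thesis using True C \<kappa> by (simp add: add_increasing2)
next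
  case False
  have "\<bar>corr i (i + k)\<bar> \<le> C / \<kappa> * real k powr (-\<tau>)"
    using corr_le[of i "i + k"] ik False by simp
  also have "\<dots> \<le> C / \<kappa> * real b powr (-\<tau>)"
    using C \<kappa> False b \<tau> by (intro mult_left_mono powr_mono2') auto
  finally show ?thesis using False C \<kappa> by (simp add: add_increasing)
qed

end

section \<open>Correlation stationary rows\<close>

locale stationary_row = covariance_row +
  fixes \<rho> :: "nat \<Rightarrow> real" and a :: "nat \<Rightarrow> nat \<Rightarrow> real"
  assumes \<rho>: "\<And>k l. k \<in> {1..n} \<Longrightarrow> l \<in> {1..n} \<Longrightarrow> corr k l = toeplitz \<rho> k l"
    and normal: "\<And>i k. i \<in> {1..n} \<Longrightarrow> k \<in> {1..i - 1} \<Longrightarrow> (\<Sum>l=1..i - 1. a i l * K (i - l) (i - k)) = K i (i - k)"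
begin

text \<open>The constants \<open>\<kappa> / C\<close> and \<open>C / \<kappa>\<close> do not depend
  on n or m, which makes the tail bound uniform. Lag k is realised by the pair (k + 1, 1), hence the
  restriction m < n.\<close>

lemma srd_toeplitz:
  assumes "m < n"
  shows "srd_toeplitz \<rho> m (\<kappa> / C) (C / \<kappa>) \<tau>"
proof
  show "\<kappa> / C > 0" "\<tau> > 1" using \<kappa> C \<tau> by auto
  have "coercive (\<kappa> / C) {1..n} (\<lambda>k l. K k l / (sd k * sd l))"
    using sd \<kappa> C by (intro coercive_scale[OF coerc]) (auto simp: less_imp_neq[symmetric])
  then have "coercive (\<kappa> / C) {1..n} (toeplitz \<rho>)"
    by (rule coercive_cong) (simp add: \<rho>[symmetric] corr_def)
  then show "coercive (\<kappa> / C) {1..m} (toeplitz \<rho>)"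
    by (rule coercive_subset) (use assms in auto)
  show "\<bar>\<rho> 0\<bar> \<le> C / \<kappa>" using corr_le_const[of 1 1] \<rho>[of 1 1] n by simp
  show "\<bar>\<rho> k\<bar> \<le> C / \<kappa> * real k powr (- \<tau>)" if "k \<in> {1..m}" for k
    using corr_le[of "Suc k" 1] \<rho>[of "Suc k" 1] that assms by (simp add: toeplitz_ge)
qed

text \<open>The predictor coefficients of the standardised variables. In these units the normal
  equations are exactly the Yule-Walker equations of \<rho>.\<close>

definition "\<alpha> i j = a i j * sd (i - j) / sd i"

lemma yule_walker_\<alpha>:
  assumes i: "i \<in> {1..n}"
  shows "yule_walker (i - 1) \<rho> (\<alpha> i)"
  unfolding yule_walker_def
proof
  fix k assume k: "k \<in> {1..i - 1}"
  have ik: "i - k \<in> {1..n}" using i k by auto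
  have Keq: "K k l = sd k * sd l * toeplitz \<rho> k l" if "k \<in> {1..n}" "l \<in> {1..n}" for k l
    using \<rho>[OF that] sd(1)[OF that(1)] sd(1)[OF that(2)] by (simp add: corr_def field_simps)
  have "sd i * sd (i - k) * (\<Sum>l=1..i - 1. toeplitz \<rho> k l * \<alpha> i l) = (\<Sum>l=1..i - 1. a i l * K (i - l) (i - k))"
    unfolding sum_distrib_left
  proof (rule sum.cong)
    fix l assume l: "l \<in> {1..i - 1}"
    then have "i - l \<in> {1..n}" using i by auto
    moreover have "toeplitz \<rho> (i - l) (i - k) = toeplitz \<rho> k l"
      using k l by (subst toeplitz_reflect) (auto simp: toeplitz_sym)
    ultimately show "sd i * sd (i - k) * (toeplitz \<rho> k l * \<alpha> i l) = a i l * K (i - l) (i - k)"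
      using sd[OF i] Keq[OF _ ik] by (simp add: \<alpha>_def)
  qed simp
  also have "\<dots> = K i (i - k)" by (rule normal[OF i k])
  also have "\<dots> = sd i * sd (i - k) * \<rho> k"
  proof -
    have "i - (i - k) = k" using k by auto
    then show ?thesis by (simp add: Keq[OF i ik] toeplitz_ge)
  qed
  finally show "(\<Sum>l=1..i - 1. toeplitz \<rho> k l * \<alpha> i l) = \<rho> k"
    using sd(1)[OF i] sd(1)[OF ik] by simp
qed

text \<open>The constant vector of part (1). The standardised predictor of the variable at time b +
  1 uses exactly b predecessors, so it supplies a Yule-Walker solution of order b without inverting
  a matrix.\<close>

definition "\<beta> = \<alpha> (Suc b)"

lemma yule_walker_\<beta>: "yule_walker b \<rho> \<beta>"
  using yule_walker_\<alpha>[of "Suc b"] b by (simp add: \<beta>_def)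

abbreviation "bnd \<equiv> srd_bound (\<kappa> / C) (C / \<kappa>) \<tau>"

lemma bnd: "bnd > 0"
  using srd_toeplitz.bound_ge(2)[OF srd_toeplitz[of b]] b by simp

lemma L2_\<alpha>: "i \<in> {1..n} \<Longrightarrow> L2_set (\<alpha> i) {1..i - 1} \<le> bnd / (\<kappa> / C)"
  by (rule srd_toeplitz.L2_yule_walker[OF srd_toeplitz yule_walker_\<alpha>]) auto

lemma L2_\<beta>: "L2_set \<beta> {1..b} \<le> bnd / (\<kappa> / C)"
  using L2_\<alpha>[of "Suc b"] b by (simp add: \<beta>_def)

text \<open>Scaling \<rho> by the variance S at time i leaves the Yule-Walker solution
  \<open>\<beta>\<close> unchanged. The systems of \<open>\<gamma> i\<close> and of S \<rho> then
  differ by O(b / n) in each entry, and order b turns this into O(b^2 / n).\<close>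

lemma local_coefficients_approx:
  assumes i: "i \<in> {1..n}" and yw: "yule_walker b (\<gamma> i) \<phi>"
  shows "L2_set (\<lambda>j. \<phi> j - \<beta> j) {1..b} 
    \<le> 2 / \<kappa> * (C * (C / \<kappa> + 2 * C\<^sup>2 / \<kappa>\<^sup>2)) * (1 + bnd / (\<kappa> / C)) * ((real b)\<^sup>2 / real n)"
proof -
  let ?I = "{1..b}"
  define S where "S = (sd i)\<^sup>2"
  define D where "D = C * (C / \<kappa> + 2 * C\<^sup>2 / \<kappa>\<^sup>2)"
  define \<delta> where "\<delta> = D * (real b / real n)"
  have "D \<ge> 0" using C \<kappa> by (simp add: D_def)
  then have \<delta>: "\<delta> \<ge> 0" by (simp add: \<delta>_def)
  have err: "\<bar>\<gamma> i k - S * \<rho> k\<bar> \<le> \<delta>" if "k \<le> b" for k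
  proof -
    obtain l where l: "l \<in> {1..n}" "\<bar>int l - int i\<bar> = int k" using partner[OF i \<open>k \<le> b\<close>] by blast
    have k: "nat \<bar>int i - int l\<bar> = k" using l(2) by (simp add: abs_minus_commute)
    have "\<bar>real i - real l\<bar> = real k" using l(2) by linarith
    then have "\<bar>\<gamma> i k / S - \<rho> k\<bar> \<le> (C / \<kappa> + 2 * C\<^sup>2 / \<kappa>\<^sup>2) * (real k / real n)"
      using corr_approx[OF i l(1)] \<rho>[OF i l(1)] by (simp add: k S_def toeplitz_def)
    also have "\<dots> \<le> (C / \<kappa> + 2 * C\<^sup>2 / \<kappa>\<^sup>2) * (real b / real n)"
      using C \<kappa> that by (intro mult_left_mono divide_right_mono) auto
    finally have 1: "\<bar>\<gamma> i k / S - \<rho> k\<bar> \<le> (C / \<kappa> + 2 * C\<^sup>2 / \<kappa>\<^sup>2) * (real b / real n)" .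
    have Spos: "S > 0" "S \<le> C" using sd(1,4)[OF i] by (auto simp: S_def)
    have "\<gamma> i k - S * \<rho> k = S * (\<gamma> i k / S - \<rho> k)" using Spos by (simp add: field_simps)
    then have "\<bar>\<gamma> i k - S * \<rho> k\<bar> = S * \<bar>\<gamma> i k / S - \<rho> k\<bar>" using Spos by (simp add: abs_mult)
    also have "\<dots> \<le> C * ((C / \<kappa> + 2 * C\<^sup>2 / \<kappa>\<^sup>2) * (real b / real n))"
      using Spos 1 by (intro mult_mono) auto
    finally show ?thesis by (simp add: \<delta>_def D_def mult.assoc)
  qed
  define E where "E k l = toeplitz (\<gamma> i) k l - S * toeplitz \<rho> k l" for k l
  have E: "\<bar>E k l\<bar> \<le> \<delta>" if "k \<in> ?I" "l \<in> ?I" for k l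
    using err[of "nat \<bar>int k - int l\<bar>"] that by (auto simp: E_def toeplitz_def)
  have eq: "(\<Sum>l=1..b. toeplitz (\<gamma> i) k l * (\<phi> l - \<beta> l)) = (\<gamma> i k - S * \<rho> k) - (\<Sum>l=1..b. E k l * \<beta> l)" 
    if "k \<in> ?I" for k
    using yule_walkerD[OF yw that] yule_walkerD[OF yule_walker_\<beta> that]
    by (simp add: E_def right_diff_distrib left_diff_distrib sum_subtractf mult.assoc flip: sum_distrib_left)
  have "\<kappa> / 2 * L2_set (\<lambda>j. \<phi> j - \<beta> j) ?I \<le> L2_set (\<lambda>k. \<Sum>l=1..b. toeplitz (\<gamma> i) k l * (\<phi> l - \<beta> l)) ?I"
    by (intro coercive_L2_le window[OF i]) simp
  also have "\<dots> = L2_set (\<lambda>k. (\<gamma> i k - S * \<rho> k) - (\<Sum>l=1..b. E k l * \<beta> l)) ?I"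
    by (intro L2_set_cong refl eq)
  also have "\<dots> \<le> L2_set (\<lambda>k. \<gamma> i k - S * \<rho> k) ?I + L2_set (\<lambda>k. \<Sum>l=1..b. E k l * \<beta> l) ?I"
    by (rule L2_set_diff_le)
  also have "\<dots> \<le> real b * \<delta> + real b * \<delta> * L2_set \<beta> ?I"
  proof (intro add_mono)
    have "L2_set (\<lambda>k. \<gamma> i k - S * \<rho> k) ?I \<le> (\<Sum>k=1..b. \<bar>\<gamma> i k - S * \<rho> k\<bar>)"
      by (rule L2_set_le_sum_abs)
    also have "\<dots> \<le> real (card ?I) * \<delta>" by (intro sum_bounded_above err) auto
    finally show "L2_set (\<lambda>k. \<gamma> i k - S * \<rho> k) ?I \<le> real b * \<delta>" by simp
    show "L2_set (\<lambda>k. \<Sum>l=1..b. E k l * \<beta> l) ?I \<le> real b * \<delta> * L2_set \<beta> ?I"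
      by (intro schur_test_const E \<delta>) auto
  qed
  also have "\<dots> \<le> real b * \<delta> + real b * \<delta> * (bnd / (\<kappa> / C))"
    using \<delta> by (intro add_left_mono mult_left_mono L2_\<beta>) auto
  also have "\<dots> = D * (1 + bnd / (\<kappa> / C)) * ((real b)\<^sup>2 / real n)"
    by (simp add: \<delta>_def algebra_simps power2_eq_square)
  finally have "2 / \<kappa> * (\<kappa> / 2 * L2_set (\<lambda>j. \<phi> j - \<beta> j) ?I) \<le> 2 / \<kappa> * (D * (1 + bnd / (\<kappa> / C)) * ((real b)\<^sup>2 / real n))"
    using \<kappa> by (intro mult_left_mono) auto
  then have "L2_set (\<lambda>j. \<phi> j - \<beta> j) ?I \<le> 2 / \<kappa> * (D * (1 + bnd / (\<kappa> / C)) * ((real b)\<^sup>2 / real n))"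
    using \<kappa> by simp
  then show ?thesis by (simp add: D_def mult.assoc)
qed

text \<open>Subtract the first b equations of order i - 1 from those of order b. What remains on the
  right is the off-diagonal block applied to the coefficients beyond lag b, so their norm controls
  the change on {1..b}.\<close>

lemma predictor_approx:
  assumes i: "i \<in> {b<..n}" and tail: "L2_set (\<alpha> i) {b<..i - 1} \<le> T"
  shows "L2_set (\<lambda>j. a i j - \<beta> j) {1..b} 
    \<le> bnd / (\<kappa> / C) * T + 2 * C / \<kappa> * (bnd / (\<kappa> / C)) * (real b / real n)"
proof -
  let ?I = "{1..b}" and ?J = "{b<..i - 1}"
  have i1: "i \<in> {1..n}" using i by auto
  have split: "{1..i - 1} = ?I \<union> ?J" using i b by auto
  interpret T: srd_toeplitz \<rho> "i - 1" "\<kappa> / C" "C / \<kappa>" \<tau> using i1 by (intro srd_toeplitz) auto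
  have eq: "(\<Sum>l=1..b. toeplitz \<rho> k l * (\<beta> l - \<alpha> i l)) = (\<Sum>l\<in>?J. toeplitz \<rho> k l * \<alpha> i l)" if "k \<in> ?I" for k
  proof -
    have "k \<in> {1..i - 1}" using that i by auto
    then have "(\<Sum>l\<in>?I \<union> ?J. toeplitz \<rho> k l * \<alpha> i l) = \<rho> k"
      using yule_walkerD[OF yule_walker_\<alpha>[OF i1]] by (simp only: split)
    then have "(\<Sum>l\<in>?I. toeplitz \<rho> k l * \<alpha> i l) + (\<Sum>l\<in>?J. toeplitz \<rho> k l * \<alpha> i l) = \<rho> k"
      by (subst (asm) sum.union_disjoint) auto
    then show ?thesis
      using yule_walkerD[OF yule_walker_\<beta> that] by (simp add: right_diff_distrib sum_subtractf)
  qed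
  have sub: "(\<Sum>l\<in>A. \<bar>toeplitz \<rho> k l\<bar>) \<le> bnd" if "k \<in> {1..i - 1}" "A \<subseteq> {1..i - 1}" for k A
    using that by (intro order_trans[OF sum_mono2 T.row_sum[OF that(1)]]) auto
  have "\<kappa> / C * L2_set (\<lambda>l. \<beta> l - \<alpha> i l) ?I \<le> L2_set (\<lambda>k. \<Sum>l=1..b. toeplitz \<rho> k l * (\<beta> l - \<alpha> i l)) ?I"
    using i by (intro coercive_L2_le coercive_subset[OF T.coercive]) auto
  also have "\<dots> = L2_set (\<lambda>k. \<Sum>l\<in>?J. toeplitz \<rho> k l * \<alpha> i l) ?I"
    by (intro L2_set_cong refl eq)
  also have "\<dots> \<le> bnd * L2_set (\<alpha> i) ?J"
  proof (rule schur_test)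
    show "(\<Sum>l\<in>?J. \<bar>toeplitz \<rho> k l\<bar>) \<le> bnd" if "k \<in> ?I" for k
      using that i by (intro sub) auto
    show "(\<Sum>k\<in>?I. \<bar>toeplitz \<rho> k l\<bar>) \<le> bnd" if "l \<in> ?J" for l
      using that i by (subst toeplitz_sym, intro sub) auto
  qed (use bnd in auto)
  also have "\<dots> \<le> bnd * T" using bnd tail by (intro mult_left_mono) auto
  finally have 1: "L2_set (\<lambda>l. \<beta> l - \<alpha> i l) ?I \<le> bnd / (\<kappa> / C) * T"
    using \<kappa> C by (simp add: field_simps)
  \<comment> \<open>Undoing the standardisation: within b time steps the standard deviations differ
    by a relative error O(b / n).\<close>
  have "\<bar>a i j - \<alpha> i j\<bar> \<le> 2 * C / \<kappa> * (real b / real n) * \<bar>\<alpha> i j\<bar>" if j: "j \<in> ?I" for j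
  proof -
    have ij: "i - j \<in> {1..n}" using i j by auto
    have "a i j - \<alpha> i j = \<alpha> i j * (sd i / sd (i - j) - 1)"
      using sd(1)[OF i1] sd(1)[OF ij] by (simp add: \<alpha>_def field_simps)
    then have "\<bar>a i j - \<alpha> i j\<bar> = \<bar>sd i / sd (i - j) - 1\<bar> * \<bar>\<alpha> i j\<bar>" by (simp add: abs_mult)
    also have "\<dots> \<le> 2 * C / \<kappa> * (\<bar>real i - real (i - j)\<bar> / real n) * \<bar>\<alpha> i j\<bar>"
      by (intro mult_right_mono sd_ratio i1 ij) auto
    also have "\<dots> \<le> 2 * C / \<kappa> * (real b / real n) * \<bar>\<alpha> i j\<bar>"
      using C \<kappa> j i by (intro mult_right_mono mult_left_mono divide_right_mono) auto
    finally show ?thesis .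
  qed
  then have "L2_set (\<lambda>j. a i j - \<alpha> i j) ?I \<le> L2_set (\<lambda>j. 2 * C / \<kappa> * (real b / real n) * \<bar>\<alpha> i j\<bar>) ?I"
    unfolding L2_set_def
    by (intro real_sqrt_le_mono sum_mono) (metis abs_ge_zero power2_abs power_mono)
  also have "\<dots> = 2 * C / \<kappa> * (real b / real n) * L2_set (\<alpha> i) ?I"
    using C \<kappa> by (subst L2_set_right_distrib[symmetric]) (auto simp: L2_set_def)
  also have "\<dots> \<le> 2 * C / \<kappa> * (real b / real n) * (bnd / (\<kappa> / C))"
    using C \<kappa> i by (intro mult_left_mono order_trans[OF L2_set_mono_set L2_\<alpha>[OF i1]]) auto
  finally have 2: "L2_set (\<lambda>j. a i j - \<alpha> i j) ?I \<le> 2 * C / \<kappa> * (bnd / (\<kappa> / C)) * (real b / real n)"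
    by (simp add: mult_ac)
  have "L2_set (\<lambda>j. a i j - \<beta> j) ?I = L2_set (\<lambda>j. (a i j - \<alpha> i j) - (\<beta> j - \<alpha> i j)) ?I" by simp
  also have "\<dots> \<le> L2_set (\<lambda>j. a i j - \<alpha> i j) ?I + L2_set (\<lambda>j. \<beta> j - \<alpha> i j) ?I"
    by (rule L2_set_diff_le)
  finally show ?thesis using 1 2 by linarith
qed

end

section \<open>Square integrable random variables\<close>

definition L2_fun :: "'a measure \<Rightarrow> ('a \<Rightarrow> real) \<Rightarrow> bool" where
  "L2_fun M X \<longleftrightarrow> X \<in> borel_measurable M \<and> integrable M (\<lambda>\<omega>. (X \<omega>)\<^sup>2)"

lemma L2_fun_measurable: "L2_fun M X \<Longrightarrow> X \<in> borel_measurable M"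
  by (simp add: L2_fun_def)

lemma L2_fun_integrable_mult:
  assumes "L2_fun M X" "L2_fun M Y"
  shows "integrable M (\<lambda>\<omega>. X \<omega> * Y \<omega>)"
proof (rule Bochner_Integration.integrable_bound)
  show "integrable M (\<lambda>\<omega>. (X \<omega>)\<^sup>2 + (Y \<omega>)\<^sup>2)" using assms by (simp add: L2_fun_def)
  show "(\<lambda>\<omega>. X \<omega> * Y \<omega>) \<in> borel_measurable M" by (intro borel_measurable_times L2_fun_measurable assms)
  have "\<bar>a * b\<bar> \<le> a\<^sup>2 + b\<^sup>2" for a b :: real
    using sum_squares_bound[of "\<bar>a\<bar>" "\<bar>b\<bar>"] mult_nonneg_nonneg[of "\<bar>a\<bar>" "\<bar>b\<bar>"]
    unfolding abs_mult power2_abs by linarith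
  then show "AE \<omega> in M. norm (X \<omega> * Y \<omega>) \<le> norm ((X \<omega>)\<^sup>2 + (Y \<omega>)\<^sup>2)" by simp
qed

lemma L2_fun_diff:
  assumes "L2_fun M X" "L2_fun M Y"
  shows "L2_fun M (\<lambda>\<omega>. X \<omega> - Y \<omega>)"
  unfolding L2_fun_def
proof
  show "(\<lambda>\<omega>. X \<omega> - Y \<omega>) \<in> borel_measurable M" by (intro borel_measurable_diff L2_fun_measurable assms)
  have "(\<lambda>\<omega>. (X \<omega> - Y \<omega>)\<^sup>2) = (\<lambda>\<omega>. (X \<omega>)\<^sup>2 - 2 * (X \<omega> * Y \<omega>) + (Y \<omega>)\<^sup>2)"
    by (auto simp: power2_diff)
  then show "integrable M (\<lambda>\<omega>. (X \<omega> - Y \<omega>)\<^sup>2)"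
    using assms L2_fun_integrable_mult[OF assms] by (simp add: L2_fun_def)
qed

lemma L2_fun_scale: "L2_fun M X \<Longrightarrow> L2_fun M (\<lambda>\<omega>. a * X \<omega>)"
  by (auto simp: L2_fun_def power_mult_distrib)

lemma L2_fun_add:
  assumes "L2_fun M X" "L2_fun M Y"
  shows "L2_fun M (\<lambda>\<omega>. X \<omega> + Y \<omega>)"
  using L2_fun_diff[OF assms(1) L2_fun_scale[OF assms(2), of "-1"]] by simp

lemma integrable_square_diff_scale:
  assumes "L2_fun M X" "L2_fun M Y"
  shows "(\<integral>\<omega>. (X \<omega> - s * Y \<omega>)\<^sup>2 \<partial>M) 
     = (\<integral>\<omega>. (X \<omega>)\<^sup>2 \<partial>M) - 2 * s * (\<integral>\<omega>. X \<omega> * Y \<omega> \<partial>M) + s\<^sup>2 * (\<integral>\<omega>. (Y \<omega>)\<^sup>2 \<partial>M)"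
proof -
  have "(\<lambda>\<omega>. (X \<omega> - s * Y \<omega>)\<^sup>2) = (\<lambda>\<omega>. (X \<omega>)\<^sup>2 - 2 * s * (X \<omega> * Y \<omega>) + s\<^sup>2 * (Y \<omega>)\<^sup>2)"
    by (auto simp: power2_diff power_mult_distrib)
  then show ?thesis
    using assms L2_fun_integrable_mult[OF assms] by (simp add: L2_fun_def)
qed

lemma zero_if_quadratic_nonneg:
  fixes w v :: real
  assumes "\<And>s. 2 * s * w \<le> s\<^sup>2 * v" "v \<ge> 0"
  shows "w = 0"
proof (rule ccontr)
  assume w: "w \<noteq> 0"
  \<comment> \<open>The 1 keeps the denominator positive when v = 0.\<close>
  define t where "t = w / (v + 1)"
  have w_eq: "w = t * (v + 1)" using assms(2) by (simp add: t_def)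
  then have "t \<noteq> 0" using w by auto
  have "2 * t * w \<le> t\<^sup>2 * v" by (rule assms)
  then have "t\<^sup>2 * (v + 2) \<le> 0" by (simp add: w_eq algebra_simps power2_eq_square)
  moreover have "t\<^sup>2 * (v + 2) > 0" using \<open>t \<noteq> 0\<close> assms(2) by (intro mult_pos_pos) auto
  ultimately show False by linarith
qed

lemma Cauchy_Schwarz_L2_fun:
  assumes "L2_fun M X" "L2_fun M Y"
  shows "(\<integral>\<omega>. X \<omega> * Y \<omega> \<partial>M)\<^sup>2 \<le> (\<integral>\<omega>. (X \<omega>)\<^sup>2 \<partial>M) * (\<integral>\<omega>. (Y \<omega>)\<^sup>2 \<partial>M)"
proof -
  define u v w where "u = (\<integral>\<omega>. (X \<omega>)\<^sup>2 \<partial>M)" and "v = (\<integral>\<omega>. (Y \<omega>)\<^sup>2 \<partial>M)" 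
    and "w = (\<integral>\<omega>. X \<omega> * Y \<omega> \<partial>M)"
  have v: "v \<ge> 0" by (simp add: v_def)
  have *: "0 \<le> u - 2 * s * w + s\<^sup>2 * v" for s
  proof -
    have "0 \<le> (\<integral>\<omega>. (X \<omega> - s * Y \<omega>)\<^sup>2 \<partial>M)" by simp
    then show ?thesis by (simp add: integrable_square_diff_scale[OF assms] u_def v_def w_def)
  qed
  show ?thesis
  proof (cases "v = 0")
    case True
    have "w = 0"
    proof (rule ccontr)
      assume "w \<noteq> 0"
      \<comment> \<open>This s makes the quadratic expression, linear for v = 0, equal to
        -1.\<close>
      then show False using *[of "(u + 1) / (2 * w)"] True by simp
    qed
    then show ?thesis using True by (simp add: u_def v_def w_def)
  next
    case False
    then have "0 \<le> (u - 2 * (w / v) * w + (w / v)\<^sup>2 * v) * v"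
      using v by (intro mult_nonneg_nonneg *) auto
    also have "\<dots> = u * v - w\<^sup>2" using False by (simp add: field_simps power2_eq_square)
    finally show ?thesis by (simp add: u_def v_def w_def)
  qed
qed

lemma covariance_cong:
  assumes "\<And>\<omega>. \<omega> \<in> space M \<Longrightarrow> X \<omega> = X' \<omega>" "\<And>\<omega>. \<omega> \<in> space M \<Longrightarrow> Y \<omega> = Y' \<omega>"
  shows "covariance M X Y = covariance M X' Y'"
proof -
  have "(\<integral>\<omega>. X \<omega> \<partial>M) = (\<integral>\<omega>. X' \<omega> \<partial>M)" "(\<integral>\<omega>. Y \<omega> \<partial>M) = (\<integral>\<omega>. Y' \<omega> \<partial>M)"
    using assms by (auto intro: Bochner_Integration.integral_cong)
  then show ?thesis using assms by (auto simp: covariance_def intro: Bochner_Integration.integral_cong)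
qed

lemma covariance_commute: "covariance M X Y = covariance M Y X"
  by (simp add: covariance_def mult.commute)

section \<open>Covariances, linear prediction and shift invariance\<close>

context prob_space begin

lemma L2_fun_const: "L2_fun M (\<lambda>_. a)"
  by (simp add: L2_fun_def)

lemma L2_fun_integrable: "L2_fun M X \<Longrightarrow> integrable M X"
  using L2_fun_integrable_mult[of M X "\<lambda>_. 1"] L2_fun_const by simp

lemma covariance_eq:
  assumes "L2_fun M X" "L2_fun M Y"
  shows "covariance M X Y = expectation (\<lambda>\<omega>. X \<omega> * Y \<omega>) - expectation X * expectation Y"
proof -
  define a b where "a = expectation X" and "b = expectation Y"
  have "covariance M X Y = expectation (\<lambda>\<omega>. X \<omega> * Y \<omega> - b * X \<omega> - a * Y \<omega> + a * b)"
    unfolding covariance_def a_def[symmetric] b_def[symmetric]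
    by (intro Bochner_Integration.integral_cong) (auto simp: algebra_simps)
  also have "\<dots> = expectation (\<lambda>\<omega>. X \<omega> * Y \<omega>) - b * a - a * b + a * b"
    using L2_fun_integrable_mult[OF assms] L2_fun_integrable[OF assms(1)] L2_fun_integrable[OF assms(2)]
    by (simp add: a_def b_def prob_space)
  finally show ?thesis by (simp add: a_def b_def)
qed

lemma covariance_diff_left:
  assumes "L2_fun M X" "L2_fun M Y" "L2_fun M Z"
  shows "covariance M (\<lambda>\<omega>. X \<omega> - Y \<omega>) Z = covariance M X Z - covariance M Y Z"
  using assms by (simp add: covariance_eq L2_fun_diff L2_fun_integrable L2_fun_integrable_mult left_diff_distrib)

lemma covariance_scale_left:
  assumes "L2_fun M X" "L2_fun M Z"
  shows "covariance M (\<lambda>\<omega>. a * X \<omega>) Z = a * covariance M X Z"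
  using assms by (simp add: covariance_eq L2_fun_scale L2_fun_integrable L2_fun_integrable_mult mult.assoc right_diff_distrib)

lemma covariance_add_left:
  assumes "L2_fun M X" "L2_fun M Y" "L2_fun M Z"
  shows "covariance M (\<lambda>\<omega>. X \<omega> + Y \<omega>) Z = covariance M X Z + covariance M Y Z"
  using assms by (simp add: covariance_eq L2_fun_add L2_fun_integrable L2_fun_integrable_mult distrib_right)

lemma covariance_const_left: "covariance M (\<lambda>\<omega>. a) Z = 0"
  by (simp add: covariance_def prob_space)

lemma L2_fun_sum: "(\<And>j. j \<in> J \<Longrightarrow> L2_fun M (X j)) \<Longrightarrow> L2_fun M (\<lambda>\<omega>. \<Sum>j\<in>J. X j \<omega>)"
  by (induction J rule: infinite_finite_induct) (auto intro: L2_fun_const L2_fun_add)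

lemma covariance_sum_left:
  assumes "\<And>j. j \<in> J \<Longrightarrow> L2_fun M (X j)" "L2_fun M Z"
  shows "covariance M (\<lambda>\<omega>. \<Sum>j\<in>J. X j \<omega>) Z = (\<Sum>j\<in>J. covariance M (X j) Z)"
  using assms
  by (induction J rule: infinite_finite_induct) 
    (auto simp: covariance_const_left covariance_add_left L2_fun_sum)

text \<open>Cauchy-Schwarz for the centred variables, whose second moments are no larger than the
  uncentred ones.\<close>

lemma covariance_abs_le:
  assumes X: "L2_fun M X" and Y: "L2_fun M Y" 
    and A: "expectation (\<lambda>\<omega>. (X \<omega>)\<^sup>2) \<le> A\<^sup>2" "0 \<le> A" and B: "expectation (\<lambda>\<omega>. (Y \<omega>)\<^sup>2) \<le> B\<^sup>2" "0 \<le> B"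
  shows "\<bar>covariance M X Y\<bar> \<le> A * B"
proof -
  have centered: "expectation (\<lambda>\<omega>. (X \<omega> - expectation X)\<^sup>2) \<le> expectation (\<lambda>\<omega>. (X \<omega>)\<^sup>2)" if "L2_fun M X" for X
    using covariance_eq[OF that that] by (simp add: covariance_def power2_eq_square)
  have "(covariance M X Y)\<^sup>2 \<le> expectation (\<lambda>\<omega>. (X \<omega> - expectation X)\<^sup>2) * expectation (\<lambda>\<omega>. (Y \<omega> - expectation Y)\<^sup>2)"
    unfolding covariance_def
    by (intro Cauchy_Schwarz_L2_fun L2_fun_diff L2_fun_const X Y)
  also have "\<dots> \<le> A\<^sup>2 * B\<^sup>2"
    using centered[OF X] centered[OF Y] A(1) B(1) by (intro mult_mono) auto
  finally have "\<bar>covariance M X Y\<bar>\<^sup>2 \<le> (A * B)\<^sup>2" by (simp add: power_mult_distrib)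
  then show ?thesis by (rule power2_le_imp_le) (simp add: A B)
qed

text \<open>Apply \<open>y\<^sup>2 \<le> 1 + \<bar>y\<bar> powr q\<close> to X / A and integrate:
  each summand contributes at most A^2, hence the factor 2.\<close>

lemma Lq_norm_imp_L2:
  assumes X: "X \<in> borel_measurable M" and int: "integrable M (\<lambda>\<omega>. \<bar>X \<omega>\<bar> powr q)" 
    and q: "q > 2" and A: "Lq_norm M q X \<le> A" "A \<ge> 0"
  shows "L2_fun M X" "expectation (\<lambda>\<omega>. (X \<omega>)\<^sup>2) \<le> 2 * A\<^sup>2"
proof -
  have sq: "y\<^sup>2 \<le> 1 + \<bar>y\<bar> powr q" for y :: real
  proof (cases "\<bar>y\<bar> \<le> 1")
    case True
    then have "y\<^sup>2 \<le> 1" by (simp add: abs_square_le_1)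
    then show ?thesis using powr_ge_zero[of "\<bar>y\<bar>" q] by linarith
  next
    case False
    then have "\<bar>y\<bar> powr 2 \<le> \<bar>y\<bar> powr q" using q by (intro powr_mono) auto
    then show ?thesis using False by simp
  qed
  have int2: "integrable M (\<lambda>\<omega>. (X \<omega>)\<^sup>2)"
    by (rule Bochner_Integration.integrable_bound[of M "\<lambda>\<omega>. 1 + \<bar>X \<omega>\<bar> powr q"]) (use int X sq in auto)
  then show "L2_fun M X" using X by (simp add: L2_fun_def)
  define I where "I = expectation (\<lambda>\<omega>. \<bar>X \<omega>\<bar> powr q)"
  have I: "I \<ge> 0" by (simp add: I_def)
  have "(I powr (1 / q)) powr q \<le> A powr q"
    using A q by (intro powr_mono2) (auto simp: Lq_norm_def I_def)
  then have IA: "I \<le> A powr q" using q I by (simp add: powr_powr)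
  show "expectation (\<lambda>\<omega>. (X \<omega>)\<^sup>2) \<le> 2 * A\<^sup>2"
  \<comment> \<open>Division by A is impossible here, but a vanishing norm forces X to vanish almost
    everywhere.\<close>
  proof (cases "A = 0")
    case True
    then have "I = 0" using IA I by simp
    then have "AE \<omega> in M. \<bar>X \<omega>\<bar> powr q = 0"
      unfolding I_def by (subst (asm) integral_nonneg_eq_0_iff_AE[OF int]) auto
    then have "AE \<omega> in M. (X \<omega>)\<^sup>2 = 0" by (rule AE_mp) auto
    then have "expectation (\<lambda>\<omega>. (X \<omega>)\<^sup>2) = 0" by (rule integral_eq_zero_AE)
    then show ?thesis by simp
  next
    case False
    then have pos: "A > 0" using A by simp
    have "(X \<omega>)\<^sup>2 \<le> A\<^sup>2 + A\<^sup>2 / A powr q * \<bar>X \<omega>\<bar> powr q" for \<omega>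
    proof -
      have "A\<^sup>2 * (X \<omega> / A)\<^sup>2 \<le> A\<^sup>2 * (1 + \<bar>X \<omega> / A\<bar> powr q)"
        by (intro mult_left_mono sq) simp
      then show ?thesis using pos by (simp add: power_divide powr_divide algebra_simps)
    qed
    then have "expectation (\<lambda>\<omega>. (X \<omega>)\<^sup>2) \<le> expectation (\<lambda>\<omega>. A\<^sup>2 + A\<^sup>2 / A powr q * \<bar>X \<omega>\<bar> powr q)"
      using int int2 by (intro integral_mono) auto
    also have "\<dots> = A\<^sup>2 + A\<^sup>2 / A powr q * I" using int by (simp add: I_def prob_space)
    also have "\<dots> \<le> A\<^sup>2 + A\<^sup>2 / A powr q * A powr q"
      using IA by (intro add_left_mono mult_left_mono) auto
    also have "\<dots> = 2 * A\<^sup>2" using pos by simp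
    finally show ?thesis .
  qed
qed

lemma orthogonal_if_minimal:
  assumes "L2_fun M e" "L2_fun M h" 
    and min: "\<And>s. expectation (\<lambda>\<omega>. (e \<omega>)\<^sup>2) \<le> expectation (\<lambda>\<omega>. (e \<omega> - s * h \<omega>)\<^sup>2)"
  shows "expectation (\<lambda>\<omega>. e \<omega> * h \<omega>) = 0"
proof (rule zero_if_quadratic_nonneg)
  show "2 * s * expectation (\<lambda>\<omega>. e \<omega> * h \<omega>) \<le> s\<^sup>2 * expectation (\<lambda>\<omega>. (h \<omega>)\<^sup>2)" for s
    using min[of s] integrable_square_diff_scale[OF assms(1,2), of s] by linarith
qed simp

text \<open>Varying the intercept shows that the prediction error has mean zero, and varying
  coefficient k that it is orthogonal to the k-th predecessor. Together they give equations in
  covariances rather than in raw moments.\<close>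

lemma best_linear_prediction_normal_equations:
  assumes L2: "\<And>j. j \<in> {1..i} \<Longrightarrow> L2_fun M (x j)" and a: "best_linear_prediction M x i a" and k: "k \<in> {1..i - 1}"
  shows "(\<Sum>l = 1..i - 1. a l * covariance M (x (i - l)) (x (i - k))) = covariance M (x i) (x (i - k))"
proof -
  define S where "S \<omega> = (\<Sum>j = 1..i - 1. a j * x (i - j) \<omega>)" for \<omega>
  define e where "e \<omega> = x i \<omega> - (a 0 + S \<omega>)" for \<omega>
  let ?Z = "x (i - k)"
  have S: "L2_fun M S" unfolding S_def by (intro L2_fun_sum L2_fun_scale L2) auto
  have xi: "L2_fun M (x i)" using k by (intro L2) auto
  have e: "L2_fun M e" unfolding e_def by (intro L2_fun_diff L2_fun_add L2_fun_const S xi)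
  have Z: "L2_fun M ?Z" using k by (intro L2) auto
  have min: "expectation (\<lambda>\<omega>. (e \<omega>)\<^sup>2) \<le> expectation (\<lambda>\<omega>. (x i \<omega> - (c 0 + (\<Sum>j = 1..i - 1. c j * x (i - j) \<omega>)))\<^sup>2)" for c
    using a by (simp add: best_linear_prediction_def e_def S_def)
  have "expectation (\<lambda>\<omega>. e \<omega> * 1) = 0"
  proof (rule orthogonal_if_minimal[OF e L2_fun_const])
    fix s
    have "(\<Sum>j = 1..i - 1. (a(0 := a 0 + s)) j * x (i - j) \<omega>) = S \<omega>" for \<omega>
      unfolding S_def by (intro sum.cong) auto
    then show "expectation (\<lambda>\<omega>. (e \<omega>)\<^sup>2) \<le> expectation (\<lambda>\<omega>. (e \<omega> - s * 1)\<^sup>2)"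
      using min[of "a(0 := a 0 + s)"] by (simp add: e_def algebra_simps)
  qed
  moreover have "expectation (\<lambda>\<omega>. e \<omega> * ?Z \<omega>) = 0"
  proof (rule orthogonal_if_minimal[OF e Z])
    fix s
    have "(\<Sum>j = 1..i - 1. (a(k := a k + s)) j * x (i - j) \<omega>) = S \<omega> + s * ?Z \<omega>" for \<omega>
    proof -
      have "(\<Sum>j = 1..i - 1. (a(k := a k + s)) j * x (i - j) \<omega>) 
          = (\<Sum>j = 1..i - 1. a j * x (i - j) \<omega> + (if j = k then s * ?Z \<omega> else 0))"
        by (intro sum.cong) (auto simp: distrib_right)
      then show ?thesis using k by (simp add: sum.distrib S_def)
    qed
    then show "expectation (\<lambda>\<omega>. (e \<omega>)\<^sup>2) \<le> expectation (\<lambda>\<omega>. (e \<omega> - s * ?Z \<omega>)\<^sup>2)"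
      using min[of "a(k := a k + s)"] k by (simp add: e_def algebra_simps)
  qed
  ultimately have "covariance M e ?Z = 0" by (simp add: covariance_eq[OF e Z])
  moreover have "covariance M e ?Z = covariance M (x i) ?Z - covariance M S ?Z"
    unfolding e_def
    by (simp add: covariance_diff_left covariance_add_left covariance_const_left xi S Z L2_fun_add L2_fun_const)
  moreover have "covariance M S ?Z = (\<Sum>l = 1..i - 1. a l * covariance M (x (i - l)) ?Z)"
    unfolding S_def
    by (subst covariance_sum_left) (auto intro!: sum.cong covariance_scale_left L2_fun_scale L2 Z)
  ultimately show ?thesis by simp
qed

text \<open>The joint law is a product of identical factors, and the injective reindexing by i + s
  maps such a product measure to itself.\<close>

lemma distr_iid_shift:
  fixes \<eta> :: "int \<Rightarrow> 'a \<Rightarrow> real"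
  assumes ind: "indep_vars (\<lambda>_. borel) \<eta> UNIV" and id: "\<And>i. distr M borel (\<eta> i) = distr M borel (\<eta> 0)"
  shows "distr M (\<Pi>\<^sub>M i\<in>UNIV. borel) (\<lambda>\<omega> i. \<eta> (i + s) \<omega>) = (\<Pi>\<^sub>M i\<in>UNIV. distr M borel (\<eta> 0))"
proof -
  let ?P = "\<Pi>\<^sub>M i\<in>(UNIV :: int set). (borel :: real measure)"
  let ?N = "\<lambda>i :: int. distr M borel (\<eta> 0)"
  have rv: "\<eta> i \<in> borel_measurable M" for i using ind by (simp add: indep_vars_def)
  have pN: "prob_space (?N i)" for i by (rule prob_space_distr[OF rv])
  have sets_eq: "sets (PiM UNIV ?N) = sets ?P" by (intro sets_PiM_cong) auto
  have m0: "(\<lambda>\<omega> i. \<eta> i \<omega>) \<in> measurable M ?P"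
    using rv by (intro measurable_PiM_single') auto
  have ms: "(\<lambda>z i. z (i + s)) \<in> measurable ?P ?P"
    by (intro measurable_PiM_single') (auto simp: space_PiM)
  have "distr M ?P (\<lambda>\<omega>. \<lambda>i\<in>UNIV. \<eta> i \<omega>) = (\<Pi>\<^sub>M i\<in>UNIV. distr M borel (\<eta> i))"
    using indep_vars_iff_distr_eq_PiM[where I = UNIV and M' = "\<lambda>_. borel" and X = \<eta>] rv ind by simp
  also have "\<dots> = PiM UNIV ?N" by (intro PiM_cong refl id)
  finally have eq0: "distr M ?P (\<lambda>\<omega> i. \<eta> i \<omega>) = PiM UNIV ?N" by (simp only: restrict_UNIV)
  have "distr M ?P (\<lambda>\<omega> i. \<eta> (i + s) \<omega>) = distr (distr M ?P (\<lambda>\<omega> i. \<eta> i \<omega>)) ?P (\<lambda>z i. z (i + s))"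
    by (subst distr_distr[OF ms m0]) (simp add: comp_def)
  also have "\<dots> = distr (PiM UNIV ?N) (PiM UNIV ?N) (\<lambda>z. \<lambda>i\<in>UNIV. z (i + s))"
    unfolding eq0 by (intro distr_cong) (simp_all add: sets_eq restrict_UNIV)
  also have "\<dots> = PiM UNIV ?N"
    using distr_PiM_reindex[of UNIV ?N "\<lambda>i. i + s" UNIV] pN by simp
  finally show ?thesis .
qed

text \<open>Both histories are functions of the whole two-sided innovation sequence, so each
  covariance is an integral against its shift-invariant law.\<close>

lemma covariance_history_shift:
  fixes \<eta> :: "int \<Rightarrow> 'a \<Rightarrow> real"
  assumes ind: "indep_vars (\<lambda>_. borel) \<eta> UNIV" and id: "\<And>i. distr M borel (\<eta> i) = distr M borel (\<eta> 0)"
    and g: "g \<in> borel_measurable (\<Pi>\<^sub>M k\<in>(UNIV :: nat set). borel)" 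
    and h: "h \<in> borel_measurable (\<Pi>\<^sub>M k\<in>(UNIV :: nat set). borel)"
  shows "covariance M (\<lambda>\<omega>. g (history \<eta> (k + s) \<omega>)) (\<lambda>\<omega>. h (history \<eta> (l + s) \<omega>))
       = covariance M (\<lambda>\<omega>. g (history \<eta> k \<omega>)) (\<lambda>\<omega>. h (history \<eta> l \<omega>))"
proof -
  let ?P = "\<Pi>\<^sub>M i\<in>(UNIV :: int set). (borel :: real measure)"
  let ?X = "\<lambda>s \<omega> i. \<eta> (i + s) \<omega>"
  have rv: "\<eta> i \<in> borel_measurable M" for i using ind by (simp add: indep_vars_def)
  have mX: "?X s \<in> measurable M ?P" for s
    using rv by (intro measurable_PiM_single') auto
  have int: "expectation (\<lambda>\<omega>. F (?X s \<omega>)) = integral\<^sup>L (\<Pi>\<^sub>M i\<in>UNIV. distr M borel (\<eta> 0)) F" 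
    if "F \<in> borel_measurable ?P" for F :: "_ \<Rightarrow> real" and s
    using integral_distr[OF mX that, of s] by (simp add: distr_iid_shift[OF ind id])
  have past: "(\<lambda>z j. z (k - int j)) \<in> measurable ?P (\<Pi>\<^sub>M k\<in>(UNIV :: nat set). borel)" for k
    by (intro measurable_PiM_single') (auto simp: space_PiM)
  define g' h' where "g' z = g (\<lambda>j. z (k - int j))" and "h' z = h (\<lambda>j. z (l - int j))" for z
  have mg: "g' \<in> borel_measurable ?P" unfolding g'_def by (rule measurable_compose[OF past g])
  have mh: "h' \<in> borel_measurable ?P" unfolding h'_def by (rule measurable_compose[OF past h])
  have eq: "g (history \<eta> (k + s) \<omega>) = g' (?X s \<omega>)" "h (history \<eta> (l + s) \<omega>) = h' (?X s \<omega>)" for s \<omega>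
    by (simp_all add: g'_def h'_def history_def diff_add_eq)
  have *: "covariance M (\<lambda>\<omega>. g' (?X s \<omega>)) (\<lambda>\<omega>. h' (?X s \<omega>)) 
     = covariance (\<Pi>\<^sub>M i\<in>UNIV. distr M borel (\<eta> 0)) g' h'" for s
    unfolding covariance_def int[OF mg] int[OF mh]
    by (subst int[of "\<lambda>z. (g' z - _) * (h' z - _)"]) (use mg mh in auto)
  show ?thesis
    using *[of s] *[of 0] eq[of s] eq[of 0] by simp
qed

end

lemma abs_diff_powr_le:
  fixes a b q :: real
  assumes "q > 0"
  shows "\<bar>a - b\<bar> powr q \<le> 2 powr q * (\<bar>a\<bar> powr q + \<bar>b\<bar> powr q)"
proof -
  have "\<bar>a - b\<bar> powr q \<le> (2 * max \<bar>a\<bar> \<bar>b\<bar>) powr q"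
    using assms by (intro powr_mono2) auto
  also have "\<dots> = 2 powr q * max \<bar>a\<bar> \<bar>b\<bar> powr q" by (simp add: powr_mult)
  also have "\<dots> \<le> 2 powr q * (\<bar>a\<bar> powr q + \<bar>b\<bar> powr q)"
    by (intro mult_left_mono) (auto simp: max_def)
  finally show ?thesis .
qed

text \<open>Write X, Y for the observations and X', Y' for their versions frozen at time i / n. Then
  Cov(X, Y) - Cov(X', Y') = Cov(X - X', Y) + Cov(Y - Y', X'), and each term is an L2 Lipschitz bound
  times a moment bound.\<close>

lemma physical_representation_covariance:
  assumes pr: "physical_representation M \<eta> G x" and ls: "locally_stationary q M \<eta> G" and q: "q > 2"
  obtains C where "C > 0"
    and "\<And>n k. k \<in> {1..n} \<Longrightarrow> L2_fun (M n) (x n k)"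
    and "\<And>n k. k \<in> {1..n} \<Longrightarrow> covariance (M n) (x n k) (x n k) \<le> C"
    and "\<And>n i k l. i \<in> {1..n} \<Longrightarrow> k \<in> {1..n} \<Longrightarrow> l \<in> {1..n} \<Longrightarrow>
      \<bar>covariance (M n) (x n k) (x n l) 
        - local_autocov (M n) (\<eta> n) (G n) (real i / real n) (nat \<bar>int k - int l\<bar>)\<bar>
      \<le> C * ((\<bar>real k - real i\<bar> + \<bar>real l - real i\<bar>) / real n)"
proof -
  let ?P = "\<Pi>\<^sub>M k\<in>(UNIV :: nat set). (borel :: real measure)"
  define Z where "Z n k t \<omega> = G n t (history (\<eta> n) (int k) \<omega>)" for n k t \<omega>
  obtain C1 where C1: "\<And>n i t1 t2. i \<in> {1..n} \<Longrightarrow> t1 \<in> {0..1} \<Longrightarrow> t2 \<in> {0..1} \<Longrightarrow> 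
      Lq_norm (M n) q (\<lambda>\<omega>. Z n i t1 \<omega> - Z n i t2 \<omega>) \<le> C1 * \<bar>t1 - t2\<bar>"
    using ls unfolding locally_stationary_def Z_def by blast
  obtain C2 where int: "\<And>n i t. i \<in> {1..n} \<Longrightarrow> t \<in> {0..1} \<Longrightarrow> integrable (M n) (\<lambda>\<omega>. \<bar>Z n i t \<omega>\<bar> powr q)"
      and C2: "\<And>n i t. i \<in> {1..n} \<Longrightarrow> t \<in> {0..1} \<Longrightarrow> Lq_norm (M n) q (\<lambda>\<omega>. Z n i t \<omega>) \<le> C2"
    using ls unfolding locally_stationary_def Z_def by blast
  define A B where "A = \<bar>C1\<bar> + 1" and "B = \<bar>C2\<bar> + 1"
  have AB: "A > 0" "B > 0" by (simp_all add: A_def B_def)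
  have ps: "prob_space (M n)" for n using pr by (simp add: physical_representation_def)
  have ind: "prob_space.indep_vars (M n) (\<lambda>_. borel) (\<eta> n) UNIV" for n
    using pr by (simp add: physical_representation_def)
  have id: "distr (M n) borel (\<eta> n i) = distr (M n) borel (\<eta> n 0)" for n i
    using pr by (auto simp: physical_representation_def)
  have xZ: "x n i \<omega> = Z n i (real i / real n) \<omega>" if "i \<in> {1..n}" "\<omega> \<in> space (M n)" for n i \<omega>
    using pr that unfolding physical_representation_def Z_def by blast
  have mG: "G n t \<in> borel_measurable ?P" if t: "t \<in> {0..1}" for n t
  proof -
    have "(\<lambda>(t, h). G n t h) \<in> borel_measurable (restrict_space borel {0..1} \<Otimes>\<^sub>M ?P)"
      using pr by (simp add: physical_representation_def)
    from measurable_Pair2[OF this, of t] show ?thesis using t by (simp add: space_restrict_space)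
  qed
  have mh: "history (\<eta> n) k \<in> measurable (M n) ?P" for n k
  proof -
    have "\<eta> n i \<in> borel_measurable (M n)" for i
      using ind[of n] unfolding prob_space.indep_vars_def[OF ps] by blast
    then have "(\<lambda>\<omega> j. \<eta> n (k - int j) \<omega>) \<in> measurable (M n) ?P"
      by (intro measurable_PiM_single') auto
    then show ?thesis by (simp add: history_def[abs_def])
  qed
  have mZ: "Z n k t \<in> borel_measurable (M n)" if "t \<in> {0..1}" for n k t
    using measurable_compose[OF mh mG[OF that]] by (simp add: Z_def[abs_def])
  have Z: "L2_fun (M n) (Z n k t)" "(\<integral>\<omega>. (Z n k t \<omega>)\<^sup>2 \<partial>M n) \<le> (sqrt 2 * B)\<^sup>2" 
    if "k \<in> {1..n}" "t \<in> {0..1}" for n k t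
  proof -
    have "Lq_norm (M n) q (Z n k t) \<le> B" using C2[OF that] by (simp add: B_def)
    from prob_space.Lq_norm_imp_L2[OF ps mZ[OF that(2)] int[OF that] q this] AB
    show "L2_fun (M n) (Z n k t)" "(\<integral>\<omega>. (Z n k t \<omega>)\<^sup>2 \<partial>M n) \<le> (sqrt 2 * B)\<^sup>2"
      by (auto simp: power_mult_distrib)
  qed
  have D: "(\<integral>\<omega>. (Z n k t \<omega> - Z n k s \<omega>)\<^sup>2 \<partial>M n) \<le> (sqrt 2 * (A * \<bar>t - s\<bar>))\<^sup>2" 
    if k: "k \<in> {1..n}" and t: "t \<in> {0..1}" and s: "s \<in> {0..1}" for n k t s
  proof -
    \<comment> \<open>Needed separately: the integral of a non-integrable function is 0 by default,
      so a small \<open>Lq_norm\<close> alone proves nothing.\<close>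
    have "integrable (M n) (\<lambda>\<omega>. \<bar>Z n k t \<omega> - Z n k s \<omega>\<bar> powr q)"
      by (rule Bochner_Integration.integrable_bound[of "M n" "\<lambda>\<omega>. 2 powr q * (\<bar>Z n k t \<omega>\<bar> powr q + \<bar>Z n k s \<omega>\<bar> powr q)"])
        (use int[OF k] t s q mZ abs_diff_powr_le[of q] in auto)
    moreover have "Lq_norm (M n) q (\<lambda>\<omega>. Z n k t \<omega> - Z n k s \<omega>) \<le> A * \<bar>t - s\<bar>"
      using C1[OF that] by (rule order_trans) (auto simp: A_def intro!: mult_right_mono)
    ultimately have "(\<integral>\<omega>. (Z n k t \<omega> - Z n k s \<omega>)\<^sup>2 \<partial>M n) \<le> 2 * (A * \<bar>t - s\<bar>)\<^sup>2"
      using mZ[OF t] mZ[OF s] q AB by (intro prob_space.Lq_norm_imp_L2(2)[OF ps]) auto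
    then show ?thesis by (simp add: power_mult_distrib)
  qed
  have stat: "covariance (M n) (Z n k t) (Z n l t) = local_autocov (M n) (\<eta> n) (G n) t (nat \<bar>int k - int l\<bar>)"
    if t: "t \<in> {0..1}" for n k l t
  proof -
    have *: "covariance (M n) (Z n k t) (Z n l t) = local_autocov (M n) (\<eta> n) (G n) t (l - k)" if "k \<le> l" for k l
      using prob_space.covariance_history_shift[where k = 0 and l = "int (l - k)" and s = "int k" and g = "G n t" and h = "G n t",
            OF ps ind id mG[OF t] mG[OF t]] that
      by (simp add: Z_def[abs_def] local_autocov_def of_nat_diff)
    show ?thesis
    proof (cases "k \<le> l")
      case True
      then show ?thesis using *[of k l] by (simp add: nat_diff_distrib')
    next
      case False
      then show ?thesis using *[of l k] by (simp add: covariance_commute[of _ "Z n k t"] nat_diff_distrib')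
    qed
  qed
  have xcov: "covariance (M n) (x n k) (x n l) = covariance (M n) (Z n k (real k / real n)) (Z n l (real l / real n))"
    if "k \<in> {1..n}" "l \<in> {1..n}" for n k l
    by (intro covariance_cong xZ that)
  have unit: "real k / real n \<in> {0..1}" if "k \<in> {1..n}" for k n using that by auto
  \<comment> \<open>The first summand serves the approximation, the second the variance
    bound.\<close>
  define C where "C = 2 * A * B + 2 * B\<^sup>2"
  show ?thesis
  proof
    show "C > 0" using AB by (simp add: C_def add_pos_pos)
    show "L2_fun (M n) (x n k)" if k: "k \<in> {1..n}" for n k
    proof -
      note L = Z(1)[OF k unit[OF k]]
      have "x n k \<in> borel_measurable (M n)"
        using L2_fun_measurable[OF L] xZ[OF k] by (subst measurable_cong) auto
      moreover have "integrable (M n) (\<lambda>\<omega>. (x n k \<omega>)\<^sup>2) \<longleftrightarrow> integrable (M n) (\<lambda>\<omega>. (Z n k (real k / real n) \<omega>)\<^sup>2)"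
        by (rule Bochner_Integration.integrable_cong) (auto simp: xZ[OF k])
      ultimately show ?thesis using L by (simp add: L2_fun_def)
    qed
    show "covariance (M n) (x n k) (x n k) \<le> C" if k: "k \<in> {1..n}" for n k
    proof -
      have "\<bar>covariance (M n) (Z n k (real k / real n)) (Z n k (real k / real n))\<bar> \<le> sqrt 2 * B * (sqrt 2 * B)"
        using AB by (intro prob_space.covariance_abs_le[OF ps] Z k unit) auto
      also have "\<dots> = 2 * B\<^sup>2" by (simp add: power2_eq_square)
      also have "\<dots> \<le> C" using AB by (simp add: C_def)
      finally show ?thesis using xcov[OF k k] by simp
    qed
    fix n i k l :: nat assume ikl: "i \<in> {1..n}" "k \<in> {1..n}" "l \<in> {1..n}"
    define t where "t = real i / real n"
    note ui = unit[OF ikl(1), folded t_def] and uk = unit[OF ikl(2)] and ul = unit[OF ikl(3)]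
    let ?X = "Z n k (real k / real n)" and ?X' = "Z n k t" and ?Y = "Z n l (real l / real n)" and ?Y' = "Z n l t"
    note L = Z(1)[OF ikl(2) uk] Z(1)[OF ikl(2) ui] Z(1)[OF ikl(3) ul] Z(1)[OF ikl(3) ui]
    have 1: "\<bar>covariance (M n) (\<lambda>\<omega>. ?X \<omega> - ?X' \<omega>) ?Y\<bar> \<le> sqrt 2 * (A * \<bar>real k / real n - t\<bar>) * (sqrt 2 * B)"
      using AB by (intro prob_space.covariance_abs_le[OF ps] L2_fun_diff L D Z uk ui ul ikl) auto
    have 2: "\<bar>covariance (M n) (\<lambda>\<omega>. ?Y \<omega> - ?Y' \<omega>) ?X'\<bar> \<le> sqrt 2 * (A * \<bar>real l / real n - t\<bar>) * (sqrt 2 * B)"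
      using AB by (intro prob_space.covariance_abs_le[OF ps] L2_fun_diff L D Z uk ui ul ikl) auto
    have "covariance (M n) ?X ?Y - covariance (M n) ?X' ?Y' 
      = covariance (M n) (\<lambda>\<omega>. ?X \<omega> - ?X' \<omega>) ?Y + covariance (M n) (\<lambda>\<omega>. ?Y \<omega> - ?Y' \<omega>) ?X'"
      using prob_space.covariance_diff_left[OF ps L(1,2,3)] prob_space.covariance_diff_left[OF ps L(3,4,2)]
        covariance_commute[of "M n" ?Y ?X'] covariance_commute[of "M n" ?Y' ?X'] by linarith
    then have "\<bar>covariance (M n) ?X ?Y - covariance (M n) ?X' ?Y'\<bar> 
        \<le> sqrt 2 * (A * \<bar>real k / real n - t\<bar>) * (sqrt 2 * B) + sqrt 2 * (A * \<bar>real l / real n - t\<bar>) * (sqrt 2 * B)"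
      using 1 2 by linarith
    also have "\<dots> = (sqrt 2 * sqrt 2) * A * B * (\<bar>real k / real n - t\<bar> + \<bar>real l / real n - t\<bar>)"
      by (simp only: algebra_simps)
    also have "\<dots> = 2 * A * B * (\<bar>real k / real n - t\<bar> + \<bar>real l / real n - t\<bar>)"
      by simp
    also have "\<bar>real k / real n - t\<bar> + \<bar>real l / real n - t\<bar> = (\<bar>real k - real i\<bar> + \<bar>real l - real i\<bar>) / real n"
      by (simp add: t_def diff_divide_distrib[symmetric] add_divide_distrib)
    also have "2 * A * B * \<dots> \<le> C * \<dots>"
      by (intro mult_right_mono) (auto simp: C_def)
    finally show "\<bar>covariance (M n) (x n k) (x n l) 
        - local_autocov (M n) (\<eta> n) (G n) (real i / real n) (nat \<bar>int k - int l\<bar>)\<bar>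
      \<le> C * ((\<bar>real k - real i\<bar> + \<bar>real l - real i\<bar>) / real n)"
      using stat[OF ui] xcov[OF ikl(2,3)] by (simp add: t_def)
  qed
qed

section \<open>The theorem\<close>

lemma yule_walker_cong:
  "(\<And>j. j \<in> {1..m} \<Longrightarrow> \<phi> j = \<psi> j) \<Longrightarrow> yule_walker m \<rho> \<phi> \<Longrightarrow> yule_walker m \<rho> \<psi>"
  by (simp add: yule_walker_def)

lemma mult_le_mult_sum:
  fixes p q r s :: real
  assumes "0 \<le> A" "0 \<le> B" "p \<le> r" "q \<le> s" "0 \<le> p" "0 \<le> q"
  shows "A * p + B * q \<le> (A + B) * (r + s)"
proof -
  have "A * p \<le> A * (r + s)" "B * q \<le> B * (r + s)" using assms by (auto intro!: mult_left_mono)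
  then show ?thesis by (simp add: distrib_right)
qed

theorem theorem3p1:
  fixes M :: "nat \<Rightarrow> 'a measure"
    and \<eta> :: "nat \<Rightarrow> int \<Rightarrow> 'a \<Rightarrow> real"
    and G :: "nat \<Rightarrow> real \<Rightarrow> (nat \<Rightarrow> real) \<Rightarrow> real"
    and x :: "nat \<Rightarrow> nat \<Rightarrow> 'a \<Rightarrow> real"
    and \<tau> q :: real
    and d :: nat
    and b :: "nat \<Rightarrow> nat"
    and \<phi> :: "nat \<Rightarrow> real \<Rightarrow> nat \<Rightarrow> real"
    and \<phi>_pred :: "nat \<Rightarrow> nat \<Rightarrow> nat \<Rightarrow> real"
  assumes "\<tau> > 1" and "d > 0" and "q > 2"
    and "physical_representation M \<eta> G x"
    and "UPDC M x"
    and "short_range_dependent \<tau> M x"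
    and "smoothness_condition d M \<eta> G x"
    and "locally_stationary q M \<eta> G"
    and "(\<lambda>n. real (b n) / ln (real (b n))) \<in> \<Theta>(\<lambda>n. real n powr (1 / (\<tau> + 1)))"
    and "\<And>n t j. \<phi> n t j = AR_coeff (local_autocov (M n) (\<eta> n) (G n)) (b n) t j"
    and "\<And>n i. i \<in> {1..n} \<Longrightarrow> best_linear_prediction (M n) (x n) i (\<phi>_pred n i)"
  shows
    "((\<forall>\<^sub>F n in sequentially. correlation_stationary (M n) (x n) n) \<longrightarrow>
       (\<exists>\<phi>_const :: nat \<Rightarrow> nat \<Rightarrow> real.
          (\<exists>C. \<forall>\<^sub>F n in sequentially. \<forall>i\<in>{1..n}.
             L2_set (\<lambda>j. \<phi> n (real i / real n) j - \<phi>_const n j) {1..b n}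
             \<le> C * (real (b n) ^ 2 / real n)) \<and>
          (\<exists>C. \<forall>\<^sub>F n in sequentially. \<forall>i\<in>{b n<..n}.
             L2_set (\<lambda>j. \<phi>_pred n i j - \<phi>_const n j) {1..b n}
             \<le> C * (ln (real (b n)) powr (\<tau> - 1) * real (b n) powr (- \<tau> + 1)
                    + real (b n) ^ 2 / real n))))
     \<and>
     ((\<forall>\<^sub>F n in sequentially. \<forall>j\<in>{1..b n}. (\<lambda>t. \<phi> n t j) constant_on {0..1}) \<longrightarrow>
       (\<exists>\<rho> :: nat \<Rightarrow> real \<Rightarrow> real. (\<forall>n. smooth (\<rho> n)) \<and>
          (\<exists>C. \<forall>\<^sub>F n in sequentially. \<forall>i j. 1 \<le> i \<and> i + j \<le> n \<longrightarrow>
             \<bar>correlation (M n) (x n i) (x n (i + j)) - \<rho> n (real j)\<bar>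
             \<le> C * (ln (real (b n)) powr (\<tau> - 1) * real (b n) powr (- (\<tau> - 2))
                    + real (b n) powr (5 / 2) / real n))))"
proof -
  note \<tau> = assms(1) and q = assms(3) and pr = assms(4) and ls = assms(8) 
    and \<phi>_eq = assms(10) and pred = assms(11)
  define K where "K n k l = covariance (M n) (x n k) (x n l)" for n k l
  define \<gamma> where "\<gamma> n i = local_autocov (M n) (\<eta> n) (G n) (real i / real n)" for n i :: nat
  have ps: "prob_space (M n)" for n using pr by (simp add: physical_representation_def)
  obtain \<kappa> where \<kappa>: "\<kappa> > 0" and updc: "\<forall>\<^sub>F n in sequentially. Min (spectrum (cov_matrix (M n) (x n) n)) \<ge> \<kappa>"
    using assms(5) unfolding UPDC_def by blast
  obtain C1 where C1: "C1 > 0"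
    and L2: "\<And>n k. k \<in> {1..n} \<Longrightarrow> L2_fun (M n) (x n k)"
    and diag: "\<And>n k. k \<in> {1..n} \<Longrightarrow> K n k k \<le> C1"
    and approx: "\<And>n i k l. i \<in> {1..n} \<Longrightarrow> k \<in> {1..n} \<Longrightarrow> l \<in> {1..n} \<Longrightarrow>
      \<bar>K n k l - toeplitz (\<gamma> n i) k l\<bar> \<le> C1 * ((\<bar>real k - real i\<bar> + \<bar>real l - real i\<bar>) / real n)"
    unfolding K_def \<gamma>_def toeplitz_def by (rule physical_representation_covariance[OF pr ls q]) blast
  from assms(6)[unfolded short_range_dependent_def, folded K_def, THEN conjunct1] 
  obtain C2 where C2: "\<forall>n. \<forall>k\<in>{1..n}. \<forall>r\<in>{- int k + 1..int n - int k}. r \<noteq> 0 \<longrightarrow>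
      \<bar>K n k (nat (int k + r))\<bar> \<le> C2 * real_of_int \<bar>r\<bar> powr (- \<tau>)"
    by (rule exE)
  define C where "C = C1 + \<bar>C2\<bar>"
  have C: "C > 0" "C1 \<le> C" "C2 \<le> C" using C1 by (auto simp: C_def)
  note b_top = bandwidth_asymptotics(1)[OF \<tau> assms(9)] and b_small = bandwidth_asymptotics(2)[OF \<tau> assms(9)]
  have b_ge: "\<forall>\<^sub>F n in sequentially. y \<le> real (b n)" for y
    using b_top by (simp add: filterlim_at_top)
  have b_sq: "\<forall>\<^sub>F n in sequentially. (real (b n))\<^sup>2 / real n < y" if "y > 0" for y
    using order_tendstoD(2)[OF b_small that] .
  \<comment> \<open>With b^2 / n < 1/2 and b \<le> b^2 one gets 2 b < n. The second threshold gives
    2 C (b + 1)^2 / n \<le> 8 C b^2 / n \<le> \<kappa> / 2.\<close>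
  have half: "1 / 2 > (0 :: real)" and eps: "\<kappa> / (16 * C) > 0" using \<kappa> C by simp_all
  have row: "\<forall>\<^sub>F n in sequentially. covariance_row n (b n) (K n) (\<gamma> n) \<kappa> C \<tau>"
    using updc b_ge[of 1] b_sq[OF half] b_sq[OF eps] eventually_gt_at_top[of 0]
  proof eventually_elim
    case (elim n)
    then have n: "n > 0" and b1: "real (b n) \<ge> 1" by auto
    have b_le: "real (b n) \<le> (real (b n))\<^sup>2"
      using b1 by (simp add: power2_eq_square mult_le_cancel_right1)
    show ?case
    proof
      show "\<kappa> > 0" "\<tau> > 1" "1 \<le> b n" using \<kappa> \<tau> b1 by auto
      have "(real (b n))\<^sup>2 < real n / 2" using elim n by (simp add: field_simps)
      then show "2 * b n < n" using b_le by linarith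
      have "(real (b n) + 1)\<^sup>2 \<le> (2 * real (b n))\<^sup>2" using b1 by (intro power_mono) auto
      then have "2 * C * (real (b n) + 1)\<^sup>2 / real n \<le> 2 * C * (4 * (real (b n))\<^sup>2) / real n"
        using C by (intro divide_right_mono mult_left_mono) (auto simp: power_mult_distrib)
      also have "\<dots> = 8 * C * ((real (b n))\<^sup>2 / real n)" by simp
      also have "\<dots> \<le> 8 * C * (\<kappa> / (16 * C))" using C elim by (intro mult_left_mono) auto
      also have "\<dots> = \<kappa> / 2" using C by simp
      finally show "2 * C * (real (b n) + 1)\<^sup>2 / real n \<le> \<kappa> / 2" .
      show "coercive \<kappa> {1..n} (K n)"
        using coercive_cov_if_spectrum_ge[OF n elim(1)] by (simp add: K_def[abs_def])
      show "K n k l = K n l k" for k l by (simp add: K_def covariance_commute)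
      show "K n k k \<le> C" if "k \<in> {1..n}" for k using diag[OF that] C by linarith
      show "\<bar>K n k l\<bar> \<le> C * \<bar>real k - real l\<bar> powr - \<tau>" if "k \<in> {1..n}" "l \<in> {1..n}" "k \<noteq> l" for k l
      proof -
        have "\<bar>K n k l\<bar> \<le> C2 * \<bar>real k - real l\<bar> powr - \<tau>"
          using C2[rule_format, of k n "int l - int k"] that by (simp add: abs_minus_commute)
        also have "\<dots> \<le> C * \<bar>real k - real l\<bar> powr - \<tau>" using C by (intro mult_right_mono) auto
        finally show ?thesis .
      qed
      show "\<bar>K n k l - toeplitz (\<gamma> n i) k l\<bar> \<le> C * ((\<bar>real k - real i\<bar> + \<bar>real l - real i\<bar>) / real n)"
        if "i \<in> {1..n}" "k \<in> {1..n}" "l \<in> {1..n}" for i k l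
        using approx[OF that] by (rule order_trans) (intro mult_right_mono, use C in auto)
    qed
  qed
  have yw: "yule_walker (b n) (\<gamma> n i) (\<phi> n (real i / real n))" 
    if "covariance_row n (b n) (K n) (\<gamma> n) \<kappa> C \<tau>" "i \<in> {1..n}" for n i
  proof -
    have "yule_walker (b n) (\<gamma> n i) (AR_coeff (local_autocov (M n) (\<eta> n) (G n)) (b n) (real i / real n))"
      unfolding \<gamma>_def
      by (rule yule_walker_AR_coeff[where \<gamma> = "local_autocov (M n) (\<eta> n) (G n)" and t = "real i / real n", 
            OF covariance_row.window[OF that, unfolded \<gamma>_def]]) (use \<kappa> in auto)
    then show ?thesis by (simp add: \<phi>_eq[abs_def])
  qed
  define B where "B = srd_bound (\<kappa> / C) (C / \<kappa>) \<tau> / (\<kappa> / C)"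
  have ln_ge: "\<forall>\<^sub>F n in sequentially. 1 \<le> ln (real (b n))"
    using b_ge[of "exp 1"]
  proof eventually_elim
    case (elim n)
    have "0 < real (b n)" using elim exp_gt_zero[of "1 :: real"] by linarith
    then show ?case using elim ln_le_cancel_iff[of "exp 1" "real (b n)"] by simp
  qed
  have ln_powr: "1 \<le> ln (real (b n)) powr (\<tau> - 1)" if "1 \<le> ln (real (b n))" for n
    using that \<tau> by (intro ge_one_powr_ge_zero) auto
  show ?thesis
  proof (intro conjI impI)
    assume stat: "\<forall>\<^sub>F n in sequentially. correlation_stationary (M n) (x n) n"
    have "\<kappa> / C > 0" using \<kappa> C by simp
    \<comment> \<open>Obtained before n is fixed, so \<open>D\<close> is a genuine constant.\<close>
    then obtain D b\<^sub>0 where D: "D \<ge> 0"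
      and tail: "\<And>\<rho> m \<alpha> b. srd_toeplitz \<rho> m (\<kappa> / C) (C / \<kappa>) \<tau> \<Longrightarrow> yule_walker m \<rho> \<alpha> \<Longrightarrow> b\<^sub>0 \<le> real b \<Longrightarrow>
        L2_set \<alpha> {b<..m} \<le> D * (ln (real b) powr (\<tau> - 1) * real b powr (1 - \<tau>))"
      by (rule yule_walker_tail[where C = "C / \<kappa>", OF _ \<tau>]) blast
    define D1 where "D1 = 2 / \<kappa> * (C * (C / \<kappa> + 2 * C\<^sup>2 / \<kappa>\<^sup>2)) * (1 + B)"
    define D2 where "D2 = B * D + 2 * C / \<kappa> * B"
    \<comment> \<open>Both estimates are bundled so that a single choice of the vector for each n
      serves them.\<close>
    define Q where "Q n \<psi> \<longleftrightarrow> 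
      (\<forall>i\<in>{1..n}. L2_set (\<lambda>j. \<phi> n (real i / real n) j - \<psi> j) {1..b n} \<le> D1 * (real (b n) ^ 2 / real n)) \<and>
      (\<forall>i\<in>{b n<..n}. L2_set (\<lambda>j. \<phi>_pred n i j - \<psi> j) {1..b n}
         \<le> D2 * (ln (real (b n)) powr (\<tau> - 1) * real (b n) powr (- \<tau> + 1) + real (b n) ^ 2 / real n))" for n \<psi>
    have "\<forall>\<^sub>F n in sequentially. \<exists>\<psi>. Q n \<psi>"
      using row stat b_ge[of b\<^sub>0] b_ge[of 1]
    proof eventually_elim
      case (elim n)
      interpret R: covariance_row n "b n" "K n" "\<gamma> n" \<kappa> C \<tau> by (rule elim(1))
      obtain \<rho> where \<rho>: "\<And>k l. k \<in> {1..n} \<Longrightarrow> l \<in> {1..n} \<Longrightarrow> correlation (M n) (x n k) (x n l) = toeplitz \<rho> k l"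
        using elim(2) unfolding correlation_stationary_def toeplitz_def by blast
      interpret S: stationary_row n "b n" "K n" "\<gamma> n" \<kappa> C \<tau> \<rho> "\<phi>_pred n"
      proof
        show "R.corr k l = toeplitz \<rho> k l" if "k \<in> {1..n}" "l \<in> {1..n}" for k l
          using \<rho>[OF that] by (simp add: R.corr_def R.sd_def K_def correlation_def)
        show "(\<Sum>l=1..i - 1. \<phi>_pred n i l * K n (i - l) (i - k)) = K n i (i - k)" 
          if "i \<in> {1..n}" "k \<in> {1..i - 1}" for i k
          unfolding K_def using that
          by (intro prob_space.best_linear_prediction_normal_equations[OF ps _ pred] L2) auto
      qed
      have B: "B > 0" using S.bnd \<kappa> C by (simp add: B_def)
      have "L2_set (\<lambda>j. \<phi> n (real i / real n) j - S.\<beta> j) {1..b n} \<le> D1 * (real (b n) ^ 2 / real n)" if "i \<in> {1..n}" for i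
        using S.local_coefficients_approx[OF that yw[OF elim(1) that]] by (simp only: D1_def B_def)
      moreover have "L2_set (\<lambda>j. \<phi>_pred n i j - S.\<beta> j) {1..b n}
         \<le> D2 * (ln (real (b n)) powr (\<tau> - 1) * real (b n) powr (- \<tau> + 1) + real (b n) ^ 2 / real n)" 
        if i: "i \<in> {b n<..n}" for i
      proof -
        define T where "T = ln (real (b n)) powr (\<tau> - 1) * real (b n) powr (1 - \<tau>)"
        have i1: "i \<in> {1..n}" "i - 1 < n" using i by auto
        have "L2_set (S.\<alpha> i) {b n<..i - 1} \<le> D * T"
          unfolding T_def by (rule tail[OF S.srd_toeplitz[OF i1(2)] S.yule_walker_\<alpha>[OF i1(1)] elim(3)])
        from S.predictor_approx[OF i this]
        have "L2_set (\<lambda>j. \<phi>_pred n i j - S.\<beta> j) {1..b n} \<le> B * D * T + 2 * C / \<kappa> * B * (real (b n) / real n)"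
          by (simp only: B_def mult.assoc)
        also have "\<dots> \<le> (B * D + 2 * C / \<kappa> * B) * (T + real (b n) ^ 2 / real n)"
        proof (rule mult_le_mult_sum)
          show "real (b n) / real n \<le> real (b n) ^ 2 / real n"
            using elim(4) by (intro divide_right_mono) (auto simp: power2_eq_square mult_le_cancel_right1)
        qed (use B D C \<kappa> in \<open>auto simp: T_def\<close>)
        finally show ?thesis by (simp add: D2_def T_def add.commute[of 1] algebra_simps)
      qed
      ultimately show ?case unfolding Q_def by blast
    qed
    then have "\<forall>\<^sub>F n in sequentially. Q n (SOME \<psi>. Q n \<psi>)"
    proof eventually_elim
      case (elim n)
      then show ?case by (rule someI_ex[of "Q n"])
    qed
    then show "\<exists>\<phi>_const :: nat \<Rightarrow> nat \<Rightarrow> real.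
          (\<exists>C. \<forall>\<^sub>F n in sequentially. \<forall>i\<in>{1..n}.
             L2_set (\<lambda>j. \<phi> n (real i / real n) j - \<phi>_const n j) {1..b n}
             \<le> C * (real (b n) ^ 2 / real n)) \<and>
          (\<exists>C. \<forall>\<^sub>F n in sequentially. \<forall>i\<in>{b n<..n}.
             L2_set (\<lambda>j. \<phi>_pred n i j - \<phi>_const n j) {1..b n}
             \<le> C * (ln (real (b n)) powr (\<tau> - 1) * real (b n) powr (- \<tau> + 1)
                    + real (b n) ^ 2 / real n))"
      unfolding Q_def
      by (intro exI[of _ "\<lambda>n. SOME \<psi>. Q n \<psi>"] conjI exI[of _ D1] exI[of _ D2]) 
        (auto simp: Q_def elim: eventually_mono)
  next
    assume const: "\<forall>\<^sub>F n in sequentially. \<forall>j\<in>{1..b n}. (\<lambda>t. \<phi> n t j) constant_on {0..1}"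
    define r where "r n k = (if k \<le> b n then \<gamma> n 1 k / \<gamma> n 1 0 else 0)" for n k
    \<comment> \<open>Lags below n suffice: \<open>1 \<le> i\<close> and
      \<open>i + j \<le> n\<close> force j < n.\<close>
    have "\<exists>f. smooth f \<and> (\<forall>j<n. f (real j) = r n j)" for n
      using smooth_interpolation[of n "r n"] by blast
    then obtain \<rho> where \<rho>: "\<And>n. smooth (\<rho> n)" "\<And>n j. j < n \<Longrightarrow> \<rho> n (real j) = r n j"
      by metis
    define D where "D = C / \<kappa> + (C / \<kappa> + 2 * C\<^sup>2 / \<kappa>\<^sup>2)"
    have "\<forall>\<^sub>F n in sequentially. \<forall>i j. 1 \<le> i \<and> i + j \<le> n \<longrightarrow>
             \<bar>correlation (M n) (x n i) (x n (i + j)) - \<rho> n (real j)\<bar>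
             \<le> D * (ln (real (b n)) powr (\<tau> - 1) * real (b n) powr (- (\<tau> - 2))
                    + real (b n) powr (5 / 2) / real n)"
      using row const b_ge[of 1] ln_ge
    proof eventually_elim
      case (elim n)
      interpret R: covariance_row n "b n" "K n" "\<gamma> n" \<kappa> C \<tau> by (rule elim(1))
      have yw0: "yule_walker (b n) (\<gamma> n i) (\<phi> n 0)" if i: "i \<in> {1..n}" for i
      proof (rule yule_walker_cong[OF _ yw[OF elim(1) i]])
        fix j assume "j \<in> {1..b n}"
        with elim(2) have "(\<lambda>t. \<phi> n t j) constant_on {0..1}" by blast
        then obtain y where "\<forall>t\<in>{0..1}. \<phi> n t j = y" unfolding constant_on_def by blast
        then show "\<phi> n (real i / real n) j = \<phi> n 0 j" using i by auto
      qed
      show ?case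
      proof (intro allI impI)
        fix i j assume ij: "1 \<le> i \<and> i + j \<le> n"
        have "correlation (M n) (x n i) (x n (i + j)) = R.corr i (i + j)"
          by (simp add: R.corr_def R.sd_def K_def correlation_def)
        moreover have "\<rho> n (real j) = r n j" using ij by (intro \<rho>(2)) auto
        ultimately have "\<bar>correlation (M n) (x n i) (x n (i + j)) - \<rho> n (real j)\<bar> 
          \<le> C / \<kappa> * real (b n) powr (-\<tau>) + (C / \<kappa> + 2 * C\<^sup>2 / \<kappa>\<^sup>2) * (real (b n) / real n)"
          using R.constant_coefficients_corr[OF yw0] ij by (simp add: r_def add.commute)
        also have "\<dots> \<le> D * (ln (real (b n)) powr (\<tau> - 1) * real (b n) powr (- (\<tau> - 2)) + real (b n) powr (5 / 2) / real n)"
          unfolding D_def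
        \<comment> \<open>The bound obtained, O(b^(-\<tau>) + b / n), is sharper than the claimed
          rate; it is relaxed here using b \<ge> 1 and ln b \<ge> 1.\<close>
        proof (rule mult_le_mult_sum)
          have "real (b n) powr (-\<tau>) \<le> real (b n) powr (- (\<tau> - 2))"
            using elim(3) by (intro powr_mono) auto
          also have "\<dots> \<le> ln (real (b n)) powr (\<tau> - 1) * real (b n) powr (- (\<tau> - 2))"
            using mult_right_mono[OF ln_powr[OF elim(4)], of "real (b n) powr (- (\<tau> - 2))"] by simp
          finally show "real (b n) powr (-\<tau>) \<le> ln (real (b n)) powr (\<tau> - 1) * real (b n) powr (- (\<tau> - 2))" .
          have "real (b n) powr 1 \<le> real (b n) powr (5 / 2)" using elim(3) by (intro powr_mono) auto
          then show "real (b n) / real n \<le> real (b n) powr (5 / 2) / real n"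
            using elim(3) by (intro divide_right_mono) auto
        qed (use \<kappa> C in auto)
        finally show "\<bar>correlation (M n) (x n i) (x n (i + j)) - \<rho> n (real j)\<bar>
             \<le> D * (ln (real (b n)) powr (\<tau> - 1) * real (b n) powr (- (\<tau> - 2))
                    + real (b n) powr (5 / 2) / real n)" .
      qed
    qed
    then show "\<exists>\<rho> :: nat \<Rightarrow> real \<Rightarrow> real. (\<forall>n. smooth (\<rho> n)) \<and>
          (\<exists>C. \<forall>\<^sub>F n in sequentially. \<forall>i j. 1 \<le> i \<and> i + j \<le> n \<longrightarrow>
             \<bar>correlation (M n) (x n i) (x n (i + j)) - \<rho> n (real j)\<bar>
             \<le> C * (ln (real (b n)) powr (\<tau> - 1) * real (b n) powr (- (\<tau> - 2))
                    + real (b n) powr (5 / 2) / real n))"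
      using \<rho>(1) by blast
  qed
qed

end
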